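(* (Ito's theorem) Let $x_t(\sigma,\tau,\upsilon)$ and $y_t(\sigma,\tau,\upsilon)$ be of class $\mathcal C^1$ with values in $B(\mathfrak k)$. Assume that for all $f,g\in\mathcal K_s(\mathfrak R,\mathfrak k)$ the sesquilinear forms $\langle f|\mathcal B(F_t,G_t)|g\rangle$ exist in norm and that $t\in\mathbb R\mapsto\langle f|\mathcal B(F_t,G_t)|g\rangle$ is locally integrable, where $$F_t\in\{x_t,\partial^cx_t,R^1_\pm x_t,R^0_\pm x_t,R^{-1}_\pm x_t\},\qquad G_t\in\{y_t,\partial^cy_t,R^1_\pm y_t,R^0_\pm y_t,R^{-1}_\pm y_t\}$$ are any of these functions. Then the Schwartz derivative of $t\mapsto\langle f|\mathcal B(x_t,y_t)|g\rangle$ is a locally integrable function and \begin{align*}\partial\langle f|\mathcal B(x_t,y_t)|g\rangle=&\ \langle f|\mathcal B(\partial^cx_t,y_t)+\mathcal B(x_t,\partial^cy_t)+I_{-1,+1,t}|g\rangle\\&+\langle a(t)f|\mathcal B(D^1x_t,y_t)+\mathcal B(x_t,D^1y_t)+I_{0,+1,t}|g\rangle\\&+\langle a(t)f|\mathcal B(D^0x_t,y_t)+\mathcal B(x_t,D^0y_t)+I_{0,0,t}|a(t)g\rangle\\&+\langle f|\mathcal B(D^{-1}x_t,y_t)+\mathcal B(x_t,D^{-1}y_t)+I_{-1,0,t}|a(t)g\rangle\end{align*} with $I_{i,j,t}=\mathcal B(R^i_+x_t,R^j_+y_t)-\mathcal B(R^i_-x_t,R^j_-y_t)$.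
   Context: $\mathfrak k$ is a Hilbert space with countable base, $B(\mathfrak k)$ its bounded operators; for $x\in\mathfrak k$, $x^+$ is the dual vector, $x^+y=\langle x,y\rangle$. $\mathfrak R=\{\emptyset\}+\mathbb R+\mathbb R^2+\cdots$ (disjoint union). For a finite index set $\alpha$, $t_\alpha=(t_c)_{c\in\alpha}$; a symmetric function $f$ on $\mathfrak R$ has well defined values $f(t_\alpha)$, abbreviated $f(\alpha)$; $+$ of index sets is disjoint union. $\mathcal K_s(\mathfrak R,\mathfrak k)$: symmetric norm-continuous functions $\mathfrak R\to\mathfrak k$ with compact support (compact sets meet only finitely many $\mathbb R^n$). $(a(t)f)(t_1,\dots,t_n)=f(t,t_1,\dots,t_n)$. Class $\mathcal C^1$. A function $x:(t,t_\sigma,t_\tau,t_\upsilon)\in\mathbb R\times\mathfrak R^3\mapsto x_t(t_\sigma,t_\tau,t_\upsilon)\in B(\mathfrak k)$, symmetric in each of $t_\sigma,t_\tau,t_\upsilon$, is of class $\mathcal C^0$ if it is locally integrable (in norm, Lebesgue measure) and continuous on the subspace where $t$ and all coordinates of $t_\sigma,t_\tau,t_\upsilon$ are pairwise different. It is of class $\mathcal C^1$ if it is of class $\mathcal C^0$ and on the same subspace the functions $(\partial^cx)_t=\frac{d}{dt}x_t$ and $(R^1_\pm x)_t(t_\sigma,t_\tau,t_\upsilon)=x_{t\pm0}(t_\sigma+\{t\},t_\tau,t_\upsilon)$, $(R^0_\pm x)_t=x_{t\pm0}(t_\sigma,t_\tau+\{t\},t_\upsilon)$, $(R^{-1}_\pm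 x)_t=x_{t\pm0}(t_\sigma,t_\tau,t_\upsilon+\{t\})$ (one-sided limits in the time subscript) exist and are of class $\mathcal C^0$. $D^ix_t=R^i_+x_t-R^i_-x_t$. The measure $\mathfrak m$. Consider the monomial $a_\pi a^+_{\sigma_1+\tau_1}a_{\tau_1+\upsilon_1}a^+_{\sigma_2+\tau_2}a_{\tau_2+\upsilon_2}a^+_\varrho$ with pairwise disjoint index sets $\pi,\sigma_1,\tau_1,\upsilon_1,\sigma_2,\tau_2,\upsilon_2,\varrho$, where $a_\alpha=\prod_{c\in\alpha}a_c$, $a^+_\alpha=\prod_{c\in\alpha}a^+_c$. For every perfect matching $\mathfrak p$ of the annihilators $a_b$ with the creators $a_c^+$ occurring in it, such that each annihilator stands to the left of the creator matched to it, partition the set of all indices into the classes of the equivalence relation generated by $b\sim c$ whenever $a_b$ is matched to $a^+_c$; to $\mathfrak p$ belongs the measure $\prod_\gamma\Lambda(\gamma)$ over the classes $\gamma$, where $\int\Lambda(dt_1,\dots,dt_k)\varphi(t_1,\dots,t_k)=\int_{\mathbb R}\varphi(t,\dots,t)\,dt$. Then $\mathfrak m(\pi,\sigma_1,\tau_1,\upsilon_1,\sigma_2,\tau_2,\upsilon_2,\varrho)=\langle a_\pi a^+_{\sigma_1+\tau_1}a_{\tau_1+\upsilon_1}a^+_{\sigma_2+\tau_2}a_{\tau_2+\upsilon_2}a^+_\varrho\rangle\lambda_{\pi+\upsilon_1+\upsilon_2}$ is the sum over all such matchings of these measures ($0$ if there are none). Letting the cardinalities vary one gets a measure on $\mathfrak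 R^8$; integrals against it are sums over all cardinalities, each with the factor $1/(\#\pi!\,\#\sigma_1!\cdots\#\varrho!)$. For measurable $F,G:\mathfrak R^3\to B(\mathfrak k)$, $$\langle f|\mathcal B(F,G)|g\rangle=\int\mathfrak m(\pi,\sigma_1,\tau_1,\upsilon_1,\sigma_2,\tau_2,\upsilon_2,\varrho)\,f^+(\pi)F(\sigma_1,\tau_1,\upsilon_1)G(\sigma_2,\tau_2,\upsilon_2)g(\varrho),$$ and it "exists in norm" if the integral with $\|f\|,\|F\|,\|G\|,\|g\|$ in place of $f,F,G,g$ is finite. The Schwartz derivative $\partial h$ of a locally integrable $h$ on $\mathbb R$ is the functional $\varphi\mapsto-\int h\varphi'dt$ on $C_c^\infty(\mathbb R)$; it is the locally integrable function $k$ if this equals $\int k\varphi\,dt$ for all $\varphi$.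
   Formalization: The hypothesis that t ↦ ⟨f|B(F_t,G_t)|g⟩ is locally integrable is taken in norm: the integral with ‖f‖,‖F_t‖,‖G_t‖,‖g‖ must be locally integrable in t. Without norms the claim fails: a bump escaping to infinity as t→0+ gives derivative δ_0 but right side 0. *)

theory Defs
  imports "HOL-Analysis.Analysis"
begin

section \<open>Separable complex Hilbert spaces and their bounded operators\<close>

text \<open>The inner product is antilinear in its first argument, so \<open>cinner x y\<close> is
  \<open>x\<^sup>+ y\<close>.\<close>

class separable_chilbert = banach + second_countable_topology +
  fixes scaleC :: "complex \<Rightarrow> 'a \<Rightarrow> 'a" (infixr "*\<^sub>C" 75)
    and cinner :: "'a \<Rightarrow> 'a \<Rightarrow> complex"
  assumes scaleC_add_right: "c *\<^sub>C (x + y) = c *\<^sub>C x + c *\<^sub>C y"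
    and scaleC_add_left: "(c + d) *\<^sub>C x = c *\<^sub>C x + d *\<^sub>C x"
    and scaleC_scaleC: "c *\<^sub>C (d *\<^sub>C x) = (c * d) *\<^sub>C x"
    and scaleC_of_real: "complex_of_real r *\<^sub>C x = r *\<^sub>R x"
    and cinner_commute: "cinner x y = cnj (cinner y x)"
    and cinner_add_right: "cinner x (y + z) = cinner x y + cinner x z"
    and cinner_scaleC_right: "cinner x (c *\<^sub>C y) = c * cinner x y"
    and cinner_same: "cinner x x = complex_of_real ((norm x)\<^sup>2)"

text \<open>The type \<open>'k \<Rightarrow>\<^sub>L 'k\<close> consists of the real-linear bounded maps with the operator norm;
  the algebra of bounded operators is its closed subspace of complex-linear elements.\<close>

definition bounded_ops :: "('k::separable_chilbert \<Rightarrow>\<^sub>L 'k) set" where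
  "bounded_ops = {A. \<forall>c v. blinfun_apply A (c *\<^sub>C v) = c *\<^sub>C blinfun_apply A v}"


section \<open>The configuration space\<close>

text \<open>The disjoint union of the spaces \<open>\<real>\<^sup>n\<close> is represented by \<open>real list\<close>, with the topology
  transported from the topological sum of the product spaces.\<close>

definition config_topology :: "real list topology" where
  "config_topology =
     pullback_topology UNIV (\<lambda>ts. (length ts, \<lambda>i\<in>{..<length ts}. ts ! i))
       (sum_topology (\<lambda>n. product_topology (\<lambda>_. euclideanreal) {..<n}) UNIV)"

definition config_borel :: "real list measure" where
  "config_borel = sigma UNIV {U. openin config_topology U}"

definition sum_measure :: "'i set \<Rightarrow> 'a measure \<Rightarrow> ('i \<Rightarrow> 'a measure) \<Rightarrow> 'a measure" where
  "sum_measure I N \<mu> =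
     measure_of (space N) (sets N) (\<lambda>A. \<integral>\<^sup>+ i. emeasure (\<mu> i) A \<partial>count_space I)"

definition config_lborel :: "real list measure" where
  "config_lborel = sum_measure UNIV config_borel
     (\<lambda>n. distr (\<Pi>\<^sub>M i\<in>{..<n}. lborel) config_borel (\<lambda>s. map s [0..<n]))"

definition symmetric :: "(real list \<Rightarrow> 'b) \<Rightarrow> bool" where
  "symmetric f \<longleftrightarrow> (\<forall>ts us. mset ts = mset us \<longrightarrow> f ts = f us)"

definition test_vectors :: "(real list \<Rightarrow> 'k::separable_chilbert) set" where
  "test_vectors = {f. symmetric f \<and> continuous_map config_topology euclidean f \<and>
     compactin config_topology (config_topology closure_of {ts. f ts \<noteq> 0})}"

definition annihilate :: "real \<Rightarrow> (real list \<Rightarrow> 'k) \<Rightarrow> real list \<Rightarrow> 'k" where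
  "annihilate t f = (\<lambda>ts. f (t # ts))"

text \<open>The completion is used since functions may take arbitrary values on null sets.\<close>

definition locally_integrable ::
    "'a topology \<Rightarrow> 'a measure \<Rightarrow> ('a \<Rightarrow> 'b::real_normed_vector) \<Rightarrow> bool" where
  "locally_integrable X M h \<longleftrightarrow> h \<in> borel_measurable (completion M) \<and>
     (\<forall>K. compactin X K \<longrightarrow> (\<integral>\<^sup>+p\<in>K. ennreal (norm (h p)) \<partial>completion M) < \<infinity>)"


section \<open>The classes \<open>C\<^sup>0\<close> and \<open>C\<^sup>1\<close>\<close>

type_synonym 'k kernel = "real list \<Rightarrow> real list \<Rightarrow> real list \<Rightarrow> 'k \<Rightarrow>\<^sub>L 'k"

type_synonym kernel_point = "real \<times> real list \<times> real list \<times> real list"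

definition kernel_topology :: "kernel_point topology" where
  "kernel_topology = prod_topology euclideanreal
     (prod_topology config_topology (prod_topology config_topology config_topology))"

definition kernel_lborel :: "kernel_point measure" where
  "kernel_lborel = lborel \<Otimes>\<^sub>M (config_lborel \<Otimes>\<^sub>M (config_lborel \<Otimes>\<^sub>M config_lborel))"

definition off_diagonal :: "kernel_point set" where
  "off_diagonal = {(t, \<sigma>, \<tau>, \<upsilon>). distinct (t # \<sigma> @ \<tau> @ \<upsilon>)}"

definition class_C0 :: "(real \<Rightarrow> 'k::separable_chilbert kernel) \<Rightarrow> bool" where
  "class_C0 x \<longleftrightarrow>
     (\<forall>t \<sigma> \<tau> \<upsilon>. x t \<sigma> \<tau> \<upsilon> \<in> bounded_ops) \<and>
     (\<forall>t \<sigma> \<tau> \<upsilon>. symmetric (\<lambda>\<alpha>. x t \<alpha> \<tau> \<upsilon>) \<and> symmetric (\<lambda>\<alpha>. x t \<sigma> \<alpha> \<upsilon>) \<and> symmetric (\<lambda>\<alpha>. x t \<sigma> \<tau> \<alpha>)) \<and>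
     locally_integrable kernel_topology kernel_lborel (\<lambda>(t, \<sigma>, \<tau>, \<upsilon>). x t \<sigma> \<tau> \<upsilon>) \<and>
     continuous_map (subtopology kernel_topology off_diagonal) euclidean (\<lambda>(t, \<sigma>, \<tau>, \<upsilon>). x t \<sigma> \<tau> \<upsilon>)"

text \<open>The slots stand for the upper indices \<open>+1\<close>, \<open>0\<close>, \<open>-1\<close> of \<open>R\<close> and \<open>D\<close>.\<close>

datatype slot = Creation | Number | Annihilation

fun insert_time :: "slot \<Rightarrow> real \<Rightarrow> 'k kernel \<Rightarrow> 'k kernel" where
  "insert_time Creation t F = (\<lambda>\<sigma> \<tau> \<upsilon>. F (t # \<sigma>) \<tau> \<upsilon>)"
| "insert_time Number t F = (\<lambda>\<sigma> \<tau> \<upsilon>. F \<sigma> (t # \<tau>) \<upsilon>)"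
| "insert_time Annihilation t F = (\<lambda>\<sigma> \<tau> \<upsilon>. F \<sigma> \<tau> (t # \<upsilon>))"

text \<open>The derivative and the one-sided limits only make sense off the diagonals. They are
  extended by zero, so that the predicate \<open>class_C0\<close> for total functions applies to them.\<close>

definition cderiv :: "(real \<Rightarrow> 'k::separable_chilbert kernel) \<Rightarrow> real \<Rightarrow> 'k kernel" where
  "cderiv x t \<sigma> \<tau> \<upsilon> =
     (if (t, \<sigma>, \<tau>, \<upsilon>) \<in> off_diagonal then vector_derivative (\<lambda>s. x s \<sigma> \<tau> \<upsilon>) (at t) else 0)"

definition Rplus :: "slot \<Rightarrow> (real \<Rightarrow> 'k::separable_chilbert kernel) \<Rightarrow> real \<Rightarrow> 'k kernel" where
  "Rplus i x t \<sigma> \<tau> \<upsilon> =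
     (if (t, \<sigma>, \<tau>, \<upsilon>) \<in> off_diagonal
      then Lim (at_right t) (\<lambda>s. insert_time i t (x s) \<sigma> \<tau> \<upsilon>) else 0)"

definition Rminus :: "slot \<Rightarrow> (real \<Rightarrow> 'k::separable_chilbert kernel) \<Rightarrow> real \<Rightarrow> 'k kernel" where
  "Rminus i x t \<sigma> \<tau> \<upsilon> =
     (if (t, \<sigma>, \<tau>, \<upsilon>) \<in> off_diagonal
      then Lim (at_left t) (\<lambda>s. insert_time i t (x s) \<sigma> \<tau> \<upsilon>) else 0)"

definition jump :: "slot \<Rightarrow> (real \<Rightarrow> 'k::separable_chilbert kernel) \<Rightarrow> real \<Rightarrow> 'k kernel" where
  "jump i x t \<sigma> \<tau> \<upsilon> = Rplus i x t \<sigma> \<tau> \<upsilon> - Rminus i x t \<sigma> \<tau> \<upsilon>"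

definition class_C1 :: "(real \<Rightarrow> 'k::separable_chilbert kernel) \<Rightarrow> bool" where
  "class_C1 x \<longleftrightarrow> class_C0 x \<and>
     (\<forall>(t, \<sigma>, \<tau>, \<upsilon>) \<in> off_diagonal.
        (\<lambda>s. x s \<sigma> \<tau> \<upsilon>) differentiable (at t) \<and>
        (\<forall>i. (\<exists>A. ((\<lambda>s. insert_time i t (x s) \<sigma> \<tau> \<upsilon>) \<longlongrightarrow> A) (at_right t)) \<and>
             (\<exists>A. ((\<lambda>s. insert_time i t (x s) \<sigma> \<tau> \<upsilon>) \<longlongrightarrow> A) (at_left t)))) \<and>
     class_C0 (cderiv x) \<and> (\<forall>i. class_C0 (Rplus i x) \<and> class_C0 (Rminus i x))"

definition C1_family :: "(real \<Rightarrow> 'k::separable_chilbert kernel) \<Rightarrow> (real \<Rightarrow> 'k kernel) set" where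
  "C1_family x = {x, cderiv x} \<union> range (\<lambda>i. Rplus i x) \<union> range (\<lambda>i. Rminus i x)"


section \<open>The measure \<open>\<mm>\<close>\<close>

datatype block = Bpi | Bsigma1 | Btau1 | Bupsilon1 | Bsigma2 | Btau2 | Bupsilon2 | Brho

instance block :: finite
proof
  have "(UNIV :: block set) = {Bpi, Bsigma1, Btau1, Bupsilon1, Bsigma2, Btau2, Bupsilon2, Brho}"
    by (auto intro: block.exhaust)
  then show "finite (UNIV :: block set)"
    by (metis finite.emptyI finite.insertI)
qed

text \<open>If the block \<open>b\<close> has \<open>n b\<close> elements, its indices are \<open>(b, 0), \<dots>, (b, n b - 1)\<close>.\<close>

type_synonym index = "block \<times> nat"

definition indices :: "(block \<Rightarrow> nat) \<Rightarrow> index set" where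
  "indices n = {(b, i). i < n b}"

datatype ladder = Annihilator | Creator

text \<open>The factors of the monomial from left to right. Any index occurs at most once as an
  annihilator and at most once as a creator, so a matching is a set of pairs of indices
  (annihilator, creator).\<close>

definition monomial :: "(ladder \<times> block set) list" where
  "monomial =
     [(Annihilator, {Bpi}),
      (Creator, {Bsigma1, Btau1}), (Annihilator, {Btau1, Bupsilon1}),
      (Creator, {Bsigma2, Btau2}), (Annihilator, {Btau2, Bupsilon2}),
      (Creator, {Brho})]"

definition occurs :: "ladder \<Rightarrow> nat \<Rightarrow> index \<Rightarrow> bool" where
  "occurs k p c \<longleftrightarrow> p < length monomial \<and> fst (monomial ! p) = k \<and> fst c \<in> snd (monomial ! p)"

definition matchings :: "(block \<Rightarrow> nat) \<Rightarrow> index rel set" where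
  "matchings n = {\<pp>. \<pp> \<subseteq> indices n \<times> indices n \<and>
     (\<forall>(b, c) \<in> \<pp>. \<exists>p q. occurs Annihilator p b \<and> occurs Creator q c \<and> p < q) \<and>
     (\<forall>b \<in> indices n. (\<exists>p. occurs Annihilator p b) \<longrightarrow> (\<exists>!c. (b, c) \<in> \<pp>)) \<and>
     (\<forall>c \<in> indices n. (\<exists>q. occurs Creator q c) \<longrightarrow> (\<exists>!b. (b, c) \<in> \<pp>))}"

definition match_equiv :: "(block \<Rightarrow> nat) \<Rightarrow> index rel \<Rightarrow> index rel" where
  "match_equiv n \<pp> = (\<pp> \<union> \<pp>\<inverse>)\<^sup>* \<inter> (indices n \<times> indices n)"

definition Lambda :: "index set \<Rightarrow> (index \<Rightarrow> real) measure" where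
  "Lambda \<gamma> = distr lborel (\<Pi>\<^sub>M c\<in>\<gamma>. lborel) (\<lambda>t. \<lambda>c\<in>\<gamma>. t)"

definition matching_measure :: "(block \<Rightarrow> nat) \<Rightarrow> index rel \<Rightarrow> (index \<Rightarrow> real) measure" where
  "matching_measure n \<pp> =
     distr (\<Pi>\<^sub>M \<gamma>\<in>indices n // match_equiv n \<pp>. Lambda \<gamma>) (\<Pi>\<^sub>M c\<in>indices n. lborel)
       (\<lambda>s. \<lambda>c\<in>indices n. s (match_equiv n \<pp> `` {c}) c)"

definition mm :: "(block \<Rightarrow> real list) measure" where
  "mm = sum_measure (SIGMA n:UNIV. matchings n) (\<Pi>\<^sub>M b\<in>UNIV. config_borel)
     (\<lambda>(n, \<pp>). scale_measure (ennreal (1 / (\<Prod>b\<in>UNIV. fact (n b))))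
        (distr (matching_measure n \<pp>) (\<Pi>\<^sub>M b\<in>UNIV. config_borel)
           (\<lambda>t b. map (\<lambda>i. t (b, i)) [0..<n b])))"

definition bform :: "(real list \<Rightarrow> 'k::separable_chilbert) \<Rightarrow> 'k kernel \<Rightarrow> 'k kernel \<Rightarrow>
    (real list \<Rightarrow> 'k) \<Rightarrow> complex" where
  "bform f F G g =
     (\<integral>\<omega>. cinner (f (\<omega> Bpi))
            (blinfun_apply (F (\<omega> Bsigma1) (\<omega> Btau1) (\<omega> Bupsilon1))
              (blinfun_apply (G (\<omega> Bsigma2) (\<omega> Btau2) (\<omega> Bupsilon2)) (g (\<omega> Brho)))) \<partial>completion mm)"

definition norm_integrand :: "(real list \<Rightarrow> 'k::separable_chilbert) \<Rightarrow> 'k kernel \<Rightarrow> 'k kernel \<Rightarrow>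
    (real list \<Rightarrow> 'k) \<Rightarrow> (block \<Rightarrow> real list) \<Rightarrow> real" where
  "norm_integrand f F G g \<omega> =
     norm (f (\<omega> Bpi)) * norm (F (\<omega> Bsigma1) (\<omega> Btau1) (\<omega> Bupsilon1)) *
     norm (G (\<omega> Bsigma2) (\<omega> Btau2) (\<omega> Bupsilon2)) * norm (g (\<omega> Brho))"

definition exists_in_norm :: "(real list \<Rightarrow> 'k::separable_chilbert) \<Rightarrow> 'k kernel \<Rightarrow> 'k kernel \<Rightarrow>
    (real list \<Rightarrow> 'k) \<Rightarrow> bool" where
  "exists_in_norm f F G g \<longleftrightarrow> integrable (completion mm) (norm_integrand f F G g)"

text \<open>Local integrability in \<open>t\<close> is understood in norm, like the existence of the forms.
  Local integrability of \<open>\<lambda>t. bform f (F t) (G t) g\<close> alone is too weak for Ito's formula: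
  let \<open>'k = complex\<close>, let \<open>x\<close> be supported on \<open>(\<emptyset>, \<emptyset>, {s})\<close> with value \<open>\<rho> (s - 1/t)\<close> for
  \<open>t > 0\<close> and \<open>0\<close> for \<open>t \<le> 0\<close>, where \<open>\<rho>\<close> is a smooth bump with integral 1, and let \<open>y\<close> be
  constantly 1 on \<open>({s}, \<emptyset>, \<emptyset>)\<close> and 0 elsewhere. Then the vacuum form is the indicator of
  \<open>t > 0\<close>, whereas the right hand side of the formula vanishes.\<close>

definition locally_integrable_in_norm ::
    "(real list \<Rightarrow> 'k::separable_chilbert) \<Rightarrow> (real \<Rightarrow> 'k kernel) \<Rightarrow> (real \<Rightarrow> 'k kernel) \<Rightarrow>
     (real list \<Rightarrow> 'k) \<Rightarrow> bool" where
  "locally_integrable_in_norm f F G g \<longleftrightarrow>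
     locally_integrable euclideanreal lborel
       (\<lambda>t. \<integral>\<omega>. norm_integrand f (F t) (G t) g \<omega> \<partial>completion mm)"

definition ito_correction :: "slot \<Rightarrow> slot \<Rightarrow> (real \<Rightarrow> 'k::separable_chilbert kernel) \<Rightarrow>
    (real \<Rightarrow> 'k kernel) \<Rightarrow> real \<Rightarrow> (real list \<Rightarrow> 'k) \<Rightarrow> (real list \<Rightarrow> 'k) \<Rightarrow> complex" where
  "ito_correction i j x y t f g =
     bform f (Rplus i x t) (Rplus j y t) g - bform f (Rminus i x t) (Rminus j y t) g"


section \<open>Schwartz derivatives\<close>

definition test_functions :: "(real \<Rightarrow> complex) set" where
  "test_functions = {\<phi>. compact (closure {t. \<phi> t \<noteq> 0}) \<and>
     (\<forall>n. ((\<lambda>\<psi> t. vector_derivative \<psi> (at t)) ^^ n) \<phi> differentiable_on UNIV)}"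

definition schwartz_derivative :: "(real \<Rightarrow> complex) \<Rightarrow> (real \<Rightarrow> complex) \<Rightarrow> complex" where
  "schwartz_derivative h \<phi> = - (\<integral>t. h t * vector_derivative \<phi> (at t) \<partial>lebesgue)"

definition has_schwartz_derivative :: "(real \<Rightarrow> complex) \<Rightarrow> (real \<Rightarrow> complex) \<Rightarrow> bool" where
  "has_schwartz_derivative h k \<longleftrightarrow>
     locally_integrable euclideanreal lborel h \<and> locally_integrable euclideanreal lborel k \<and>
     (\<forall>\<phi>\<in>test_functions. schwartz_derivative h \<phi> = (\<integral>t. k t * \<phi> t \<partial>lebesgue))"

end

theory Submission
  imports Defs
begin

text \<open>
  The classes of a matching are chains of blocks, each running from \<open>Bpi\<close>, \<open>Bupsilon1\<close> or \<open>Bupsilon2\<close>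
  to \<open>Bsigma1\<close>, \<open>Bsigma2\<close> or \<open>Brho\<close>; there are eleven types. Hence on functions that are symmetric in
  every block, \<open>mm\<close> is the Lebesgue-Poisson measure of finite point configurations whose points are
  marked by the chain types, and it satisfies a Mecke formula: integrating a sum over the points of a
  configuration amounts to adding one further point, of any of the types, at a time \<open>t\<close>, and
  integrating over \<open>t\<close>.

  For almost every configuration the integrand of \<open>bform f (x t) (y t) g\<close> is, as a function of \<open>t\<close>,
  continuously differentiable off the points of the configuration and has one-sided limits at
  them. Integrating by parts against a test function gives the integrand with the ordinary
  derivatives, and a sum of jumps over the points. By the Mecke formula the latter is a sum over
  the chain types: the type of the added point decides which of the four arguments receive \<open>t\<close>.
  The type \<open>{Bpi, Brho}\<close> does not meet the kernels and contributes nothing; the other ten types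
  give the ten terms of Ito's formula without derivatives.
\<close>

text \<open>Numbering the classes of a matching converts one measure into the other. A matching with
  m classes has m! numberings, and a colouring of m numbers by chain types is induced by as many
  numberings as the product of the factorials of its block sizes; so the weight of \<open>mm\<close>
  is traded for 1 / m!.

  The main obstacle is measurability. Kernels are continuous only where all their times differ. The
  integrand is therefore studied in real coordinates for fixed block sizes and set to zero where
  times within one kernel meet, which happens on a null set only. The jumps have to be measurable in
  time and configuration together, and are for this reason read along a fixed sequence.

  Jumps are taken of the whole integrand and not of each kernel. At a time entering both kernels, a
  product of right values minus a product of left values results, for which there is no product
  rule: this is the Ito correction. The right and the left products are integrable separately, in
  norm over compact sets of times, and this allows time and configuration integrals to be
  exchanged.\<close>

section \<open>Matchings and numberings of their classes\<close>

text \<open>An annihilator of block \<open>b\<close> stands to the left of a creator of block \<open>b'\<close> iff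
  \<open>level b < level b'\<close>. So levels increase along the matched pairs, and a matching is recovered from
  its classes by joining the elements of consecutive levels.\<close>

fun level :: "block \<Rightarrow> nat" where
  "level Bpi = 0"
| "level Bsigma1 = 1" | "level Btau1 = 1" | "level Bupsilon1 = 1"
| "level Bsigma2 = 2" | "level Btau2 = 2" | "level Bupsilon2 = 2"
| "level Brho = 3"

definition annihilators :: "block set" where
  "annihilators = {Bpi, Btau1, Bupsilon1, Btau2, Bupsilon2}"

definition creators :: "block set" where
  "creators = {Bsigma1, Btau1, Bsigma2, Btau2, Brho}"

text \<open>With the six positions of the monomial spelled out, statements about occurrences become
  finite case distinctions.\<close>

lemma ex_less_6: "(\<exists>p. p < length monomial \<and> P p) \<longleftrightarrow> P 0 \<or> P 1 \<or> P 2 \<or> P 3 \<or> P 4 \<or> P (5::nat)"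
proof -
  have "p < length monomial \<longleftrightarrow> p = 0 \<or> p = 1 \<or> p = 2 \<or> p = 3 \<or> p = 4 \<or> p = 5" for p
    unfolding monomial_def by simp arith
  then show ?thesis by metis
qed

lemma occurs_annihilator_iff: "(\<exists>p. occurs Annihilator p c) \<longleftrightarrow> fst c \<in> annihilators"
  unfolding occurs_def ex_less_6 by (auto simp: monomial_def annihilators_def numeral_eq_Suc)

lemma occurs_creator_iff: "(\<exists>p. occurs Creator p c) \<longleftrightarrow> fst c \<in> creators"
  unfolding occurs_def ex_less_6 by (auto simp: monomial_def creators_def numeral_eq_Suc)

lemma occurs_left_iff:
  "(\<exists>p q. occurs Annihilator p b \<and> occurs Creator q c \<and> p < q) \<longleftrightarrow>
     fst b \<in> annihilators \<and> fst c \<in> creators \<and> level (fst b) < level (fst c)"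
proof -
  have "(\<exists>p q. occurs Annihilator p b \<and> occurs Creator q c \<and> p < q) \<longleftrightarrow>
    (\<exists>p. p < length monomial \<and> (\<exists>q. q < length monomial \<and>
      fst (monomial ! p) = Annihilator \<and> fst b \<in> snd (monomial ! p) \<and>
      fst (monomial ! q) = Creator \<and> fst c \<in> snd (monomial ! q) \<and> p < q))"
    unfolding occurs_def by blast
  also have "\<dots> \<longleftrightarrow> fst b \<in> annihilators \<and> fst c \<in> creators \<and> level (fst b) < level (fst c)"
    unfolding ex_less_6
    by (cases "fst b"; cases "fst c")
       (auto simp: monomial_def creators_def annihilators_def numeral_eq_Suc)
  finally show ?thesis .
qed

lemma matchings_iff:
  "\<pp> \<in> matchings n \<longleftrightarrow> \<pp> \<subseteq> indices n \<times> indices n \<and>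
     (\<forall>(b, c) \<in> \<pp>. fst b \<in> annihilators \<and> fst c \<in> creators \<and> level (fst b) < level (fst c)) \<and>
     (\<forall>b \<in> indices n. fst b \<in> annihilators \<longrightarrow> (\<exists>!c. (b, c) \<in> \<pp>)) \<and>
     (\<forall>c \<in> indices n. fst c \<in> creators \<longrightarrow> (\<exists>!b. (b, c) \<in> \<pp>))"
  unfolding matchings_def occurs_left_iff occurs_annihilator_iff occurs_creator_iff by simp

definition chain_types :: "block set set" where
  "chain_types =
    {{Bpi, Bsigma1}, {Bpi, Btau1, Bsigma2}, {Bpi, Btau1, Btau2, Brho}, {Bpi, Btau1, Brho},
     {Bpi, Bsigma2}, {Bpi, Btau2, Brho}, {Bpi, Brho}, {Bupsilon1, Bsigma2},
     {Bupsilon1, Btau2, Brho}, {Bupsilon1, Brho}, {Bupsilon2, Brho}}"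

text \<open>Extensional functions, so that a colouring of m points is counted once.\<close>

abbreviation colourings :: "nat \<Rightarrow> (nat \<Rightarrow> block set) set" where
  "colourings m \<equiv> {..<m} \<rightarrow>\<^sub>E chain_types"

lemma all_block: "(\<forall>b. P b) \<longleftrightarrow> P Bpi \<and> P Bsigma1 \<and> P Btau1 \<and> P Bupsilon1 \<and> P Bsigma2 \<and>
    P Btau2 \<and> P Bupsilon2 \<and> P Brho"
  by (metis block.exhaust)

text \<open>These are the conditions that a path of matched pairs forces on its blocks. Existence is
  phrased by negated universal quantifiers, so that \<open>all_block\<close> turns everything into a
  propositional formula in the eight atoms \<open>b \<in> \<kappa>\<close>.\<close>

lemma chain_types_iff:
  "\<kappa> \<in> chain_types \<longleftrightarrow> \<kappa> \<noteq> {} \<and>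
     (\<forall>b. b \<in> \<kappa> \<longrightarrow> (\<forall>b'. b' \<in> \<kappa> \<longrightarrow> level b = level b' \<longrightarrow> b = b')) \<and>
     (\<forall>b. b \<in> \<kappa> \<longrightarrow> b \<in> creators \<longrightarrow> \<not> (\<forall>b'. b' \<in> \<kappa> \<longrightarrow> \<not> level b' < level b)) \<and>
     (\<forall>b. b \<in> \<kappa> \<longrightarrow> b \<in> annihilators \<longrightarrow> \<not> (\<forall>b'. b' \<in> \<kappa> \<longrightarrow> \<not> level b < level b')) \<and>
     (\<forall>b. b \<in> \<kappa> \<longrightarrow> (\<forall>b'. b' \<in> \<kappa> \<longrightarrow> level b < level b' \<longrightarrow> b \<in> annihilators \<and> b' \<in> creators))"
proof -
  have ne: "\<kappa> \<noteq> {} \<longleftrightarrow> \<not> (\<forall>b. b \<notin> \<kappa>)" by auto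
  show ?thesis
    unfolding ne all_block chain_types_def insert_iff set_eq_iff[of \<kappa>]
    unfolding annihilators_def creators_def
    by (simp; argo)
qed

definition block_class :: "(block \<Rightarrow> nat) \<Rightarrow> (index \<Rightarrow> nat) \<Rightarrow> nat \<Rightarrow> block set" where
  "block_class n k j = {b. \<exists>i<n b. k (b, i) = j}"

text \<open>Describes the numbered classes of matchings without mentioning a matching;
  \<open>matching_class_structure\<close> and \<open>consecutive_matching\<close> show that nothing
  is lost or added.\<close>

definition numberings :: "(block \<Rightarrow> nat) \<Rightarrow> nat \<Rightarrow> (index \<Rightarrow> nat) set" where
  "numberings n m = {k \<in> indices n \<rightarrow>\<^sub>E {..<m}.
     (\<forall>c\<in>indices n. \<forall>d\<in>indices n. fst c = fst d \<longrightarrow> k c = k d \<longrightarrow> c = d) \<and>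
     (\<forall>j<m. block_class n k j \<in> chain_types)}"

text \<open>A numbering of the classes is encoded as a function on the indices, so that numberings
  belonging to different matchings live in one set.\<close>

definition numbers_classes :: "(block \<Rightarrow> nat) \<Rightarrow> index rel \<Rightarrow> nat \<Rightarrow> (index \<Rightarrow> nat) set" where
  "numbers_classes n \<pp> m = {k \<in> indices n \<rightarrow>\<^sub>E {..<m}. k ` indices n = {..<m} \<and>
     (\<forall>c\<in>indices n. \<forall>d\<in>indices n. k c = k d \<longleftrightarrow> (c, d) \<in> match_equiv n \<pp>)}"

definition consecutive :: "(block \<Rightarrow> nat) \<Rightarrow> (index \<Rightarrow> nat) \<Rightarrow> index rel" where
  "consecutive n k = {(c, d). c \<in> indices n \<and> d \<in> indices n \<and> k c = k d \<and>
     level (fst c) < level (fst d) \<and>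
     \<not> (\<exists>e\<in>indices n. k e = k c \<and> level (fst c) < level (fst e) \<and> level (fst e) < level (fst d))}"

lemma finite_indices [simp]: "finite (indices n)"
proof -
  have "indices n = Sigma UNIV (\<lambda>b. {..<n b})" by (auto simp: indices_def)
  then show ?thesis by (metis finite_SigmaI finite_lessThan finite_class.finite_UNIV)
qed

text \<open>A matching uses every annihilator and every creator once, so it is an injective partial
  function along which levels increase. Its classes are directed paths with at most one element per
  level; inner elements and ends obey \<open>chain_types_iff\<close>, and neighbours on a path are
  the elements of consecutive levels.\<close>

lemma matching_class_structure:
  assumes pp: "\<pp> \<in> matchings n" and k: "k \<in> numbers_classes n \<pp> m"
  shows "k \<in> numberings n m" and "\<pp> = consecutive n k"
proof -
  have sub: "\<pp> \<subseteq> indices n \<times> indices n"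
    and edge: "\<And>c d. (c, d) \<in> \<pp> \<Longrightarrow> fst c \<in> annihilators \<and> fst d \<in> creators \<and> level (fst c) < level (fst d)"
    and out: "\<And>c. c \<in> indices n \<Longrightarrow> fst c \<in> annihilators \<Longrightarrow> \<exists>!d. (c, d) \<in> \<pp>"
    and inc: "\<And>d. d \<in> indices n \<Longrightarrow> fst d \<in> creators \<Longrightarrow> \<exists>!c. (c, d) \<in> \<pp>"
    using pp unfolding matchings_iff by blast+
  have sv: "d = e" if "(c, d) \<in> \<pp>" "(c, e) \<in> \<pp>" for c d e
    using that out[of c] sub edge by blast
  have inj: "c = e" if "(c, d) \<in> \<pp>" "(e, d) \<in> \<pp>" for c d e
    using that inc[of d] sub edge by blast
  \<comment> \<open>The matching does not branch in either direction: one more undirected step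
    lengthens the directed path or retraces an edge at its end.\<close>
  have linear: "(c, d) \<in> \<pp>\<^sup>* \<or> (d, c) \<in> \<pp>\<^sup>*" if "(c, d) \<in> (\<pp> \<union> \<pp>\<inverse>)\<^sup>*" for c d
    using that
  proof (induction rule: rtrancl_induct)
    case (step d e)
    consider "(c, d) \<in> \<pp>\<^sup>*" "(d, e) \<in> \<pp>" | "(c, d) \<in> \<pp>\<^sup>*" "(e, d) \<in> \<pp>"
      | "(d, c) \<in> \<pp>\<^sup>*" "(d, e) \<in> \<pp>" | "(d, c) \<in> \<pp>\<^sup>*" "(e, d) \<in> \<pp>"
      using step by blast
    then show ?case
    proof cases
      case 1 then show ?thesis by (meson rtrancl.rtrancl_into_rtrancl)
    next
      case 2 then show ?thesis
        by (metis inj r_into_rtrancl rtranclE)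
    next
      case 3 then show ?thesis
        by (metis sv r_into_rtrancl converse_rtranclE)
    next
      case 4 then show ?thesis by (meson converse_rtrancl_into_rtrancl)
    qed
  qed simp
  have up: "fst c \<in> annihilators \<and> fst d \<in> creators \<and> level (fst c) < level (fst d)" if "(c, d) \<in> \<pp>\<^sup>+" for c d
    using that
  proof (induction rule: trancl_induct)
    case (base d) then show ?case using edge by blast
  next
    case (step d e) then show ?case using edge[of d e] by auto
  qed
  have up': "level (fst c) \<le> level (fst d)" if "(c, d) \<in> \<pp>\<^sup>*" for c d
    using that up by (metis rtranclD order.refl less_imp_le)
  have kin: "k \<in> indices n \<rightarrow>\<^sub>E {..<m}" and onto: "k ` indices n = {..<m}"
    and ker: "\<And>c d. c \<in> indices n \<Longrightarrow> d \<in> indices n \<Longrightarrow> k c = k d \<longleftrightarrow> (c, d) \<in> match_equiv n \<pp>"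
    using k unfolding numbers_classes_def by auto
  have same: "(c, d) \<in> \<pp>\<^sup>+ \<or> (d, c) \<in> \<pp>\<^sup>+"
    if "c \<in> indices n" "d \<in> indices n" "k c = k d" "c \<noteq> d" for c d
    using ker[OF that(1,2)] that linear[of c d] unfolding match_equiv_def by (metis IntD1 rtranclD)
  have same_lt: "(c, d) \<in> \<pp>\<^sup>+"
    if "c \<in> indices n" "d \<in> indices n" "k c = k d" "level (fst c) < level (fst d)" for c d
    using same[OF that(1-3)] that(4) up[of d c] by auto
  have edge_k: "k c = k d" if "(c, d) \<in> \<pp>" for c d
  proof -
    have "(c, d) \<in> match_equiv n \<pp>" unfolding match_equiv_def using that sub by blast
    then show ?thesis using ker sub that by blast
  qed
  have level_inj: "c = d" if "c \<in> indices n" "d \<in> indices n" "k c = k d" "level (fst c) = level (fst d)" for c d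
    using same[OF that(1-3)] that(4) up[of c d] up[of d c] by auto
  have "block_class n k j \<in> chain_types" if j: "j < m" for j
    unfolding chain_types_iff
  proof (intro conjI allI impI)
    obtain c where "c \<in> indices n" "k c = j" using onto j by (metis imageE lessThan_iff)
    then show "block_class n k j \<noteq> {}" by (auto simp: block_class_def indices_def)
  next
    fix b b' assume "b \<in> block_class n k j" "b' \<in> block_class n k j" "level b = level b'"
    then obtain i i' where "(b, i) \<in> indices n" "k (b, i) = j" "(b', i') \<in> indices n" "k (b', i') = j"
      "level b = level b'"
      by (auto simp: block_class_def indices_def)
    then show "b = b'" using level_inj[of "(b, i)" "(b', i')"] by simp
  next
    fix b assume "b \<in> block_class n k j" "b \<in> creators"
    then obtain i where i: "(b, i) \<in> indices n" "k (b, i) = j" by (auto simp: block_class_def indices_def)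
    then obtain c where c: "(c, (b, i)) \<in> \<pp>" using inc[of "(b, i)"] \<open>b \<in> creators\<close> by auto
    then have "fst c \<in> block_class n k j"
      using sub edge_k[OF c] i by (cases c) (auto simp: block_class_def indices_def)
    moreover have "level (fst c) < level b" using edge[OF c] by simp
    ultimately show "\<not> (\<forall>b'. b' \<in> block_class n k j \<longrightarrow> \<not> level b' < level b)" by auto
  next
    fix b assume "b \<in> block_class n k j" "b \<in> annihilators"
    then obtain i where i: "(b, i) \<in> indices n" "k (b, i) = j" by (auto simp: block_class_def indices_def)
    then obtain c where c: "((b, i), c) \<in> \<pp>" using out[of "(b, i)"] \<open>b \<in> annihilators\<close> by auto
    then have "fst c \<in> block_class n k j"
      using sub edge_k[OF c] i by (cases c) (auto simp: block_class_def indices_def)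
    moreover have "level b < level (fst c)" using edge[OF c] by simp
    ultimately show "\<not> (\<forall>b'. b' \<in> block_class n k j \<longrightarrow> \<not> level b < level b')" by auto
  next
    fix b b' assume "b \<in> block_class n k j" "b' \<in> block_class n k j" and l: "level b < level b'"
    then obtain i i' where "(b, i) \<in> indices n" "k (b, i) = j" "(b', i') \<in> indices n" "k (b', i') = j"
      by (auto simp: block_class_def indices_def)
    then have "((b, i), (b', i')) \<in> \<pp>\<^sup>+" using same_lt l by simp
    then show "b \<in> annihilators" "b' \<in> creators" using up by force+
  qed
  then show "k \<in> numberings n m"
    unfolding numberings_def using kin level_inj by simp
  show "\<pp> = consecutive n k"
  proof (intro equalityI subrelI)
    fix c d assume cd: "(c, d) \<in> \<pp>"
    \<comment> \<open>An element e of the class above c is reached by a path from c, whose first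
      edge can only be (c, d); so e does not lie below d.\<close>
    have "\<not> level (fst e) < level (fst d)"
      if "e \<in> indices n" "k e = k c" "level (fst c) < level (fst e)" for e
    proof -
      have "(c, e) \<in> \<pp>\<^sup>+" using same_lt[of c e] that cd sub by auto
      then obtain d' where "(c, d') \<in> \<pp>" "(d', e) \<in> \<pp>\<^sup>*" by (meson tranclD)
      then show ?thesis using sv[OF cd] up' by (metis not_less)
    qed
    then show "(c, d) \<in> consecutive n k"
      unfolding consecutive_def using cd sub edge edge_k by blast
  next
    fix c d assume cd: "(c, d) \<in> consecutive n k"
    then have "(c, d) \<in> \<pp>\<^sup>+" using same_lt unfolding consecutive_def by auto
    then obtain d' where d': "(c, d') \<in> \<pp>" "(d', d) \<in> \<pp>\<^sup>*" by (meson tranclD)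
    \<comment> \<open>Otherwise the first stop d' of the path from c to d has a level strictly
      between theirs, against consecutiveness.\<close>
    have "d' = d"
    proof (rule ccontr)
      assume "d' \<noteq> d"
      then have "level (fst d') < level (fst d)" using d'(2) up by (metis rtranclD)
      moreover have "level (fst c) < level (fst d')" using edge[OF d'(1)] by simp
      moreover have "d' \<in> indices n" "k d' = k c" using sub d'(1) edge_k[OF d'(1)] by auto
      ultimately show False using cd unfolding consecutive_def by auto
    qed
    then show "(c, d) \<in> \<pp>" using d' by simp
  qed
qed

text \<open>The conditions on chain types give every annihilator an element above it in its class
  and every creator one below it. Levels separate the elements of a class, so the nearest such
  element is unique; the nearest neighbours form the matching.\<close>

lemma consecutive_matching:
  assumes k: "k \<in> numberings n m"
  shows "consecutive n k \<in> matchings n" and "k \<in> numbers_classes n (consecutive n k) m"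
proof -
  have kin: "k \<in> indices n \<rightarrow>\<^sub>E {..<m}"
    and inj: "\<And>c d. c \<in> indices n \<Longrightarrow> d \<in> indices n \<Longrightarrow> fst c = fst d \<Longrightarrow> k c = k d \<Longrightarrow> c = d"
    and chain: "\<And>j. j < m \<Longrightarrow> block_class n k j \<in> chain_types"
    using k unfolding numberings_def by blast+
  let ?P = "consecutive n k"
  have lt: "k c < m" if "c \<in> indices n" for c using kin that by auto
  have mem: "fst c \<in> block_class n k (k c)" if "c \<in> indices n" for c
    using that by (cases c) (auto simp: block_class_def indices_def)
  have ex: "\<exists>i. (b, i) \<in> indices n \<and> k (b, i) = j" if "b \<in> block_class n k j" for b j
    using that by (auto simp: block_class_def indices_def)
  have level_inj: "c = d" if "c \<in> indices n" "d \<in> indices n" "k c = k d" "level (fst c) = level (fst d)" for c d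
    using chain[OF lt[OF that(1)]] mem[OF that(1)] mem[OF that(2)] that inj
    unfolding chain_types_iff by metis
  have below: "\<exists>d\<in>indices n. k d = k c \<and> level (fst d) < level (fst c)"
    if "c \<in> indices n" "fst c \<in> creators" for c
    using chain[OF lt[OF that(1)]] mem[OF that(1)] that ex unfolding chain_types_iff by (metis fst_conv)
  have above: "\<exists>d\<in>indices n. k d = k c \<and> level (fst c) < level (fst d)"
    if "c \<in> indices n" "fst c \<in> annihilators" for c
    using chain[OF lt[OF that(1)]] mem[OF that(1)] that ex unfolding chain_types_iff by (metis fst_conv)
  have types: "fst c \<in> annihilators \<and> fst d \<in> creators"
    if "c \<in> indices n" "d \<in> indices n" "k c = k d" "level (fst c) < level (fst d)" for c d
    using chain[OF lt[OF that(1)]] mem[OF that(1)] mem[OF that(2)] that unfolding chain_types_iff by metis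
  have out: "\<exists>!d. (c, d) \<in> ?P" if c: "c \<in> indices n" "fst c \<in> annihilators" for c
  proof -
    let ?Q = "\<lambda>d. d \<in> indices n \<and> k d = k c \<and> level (fst c) < level (fst d)"
    obtain d where d: "?Q d" "\<And>e. ?Q e \<Longrightarrow> level (fst d) \<le> level (fst e)"
      using above[OF c] ex_has_least_nat[of ?Q _ "\<lambda>d. level (fst d)"] by metis
    then have "\<not> (\<exists>e\<in>indices n. k e = k c \<and> level (fst c) < level (fst e) \<and> level (fst e) < level (fst d))"
      by (metis not_less)
    then have "(c, d) \<in> ?P" unfolding consecutive_def using c d(1) by simp
    moreover have "e = d" if "(c, e) \<in> ?P" for e
    proof -
      have e: "?Q e" using that unfolding consecutive_def by auto
      have "\<not> level (fst d) < level (fst e)" using that d(1) unfolding consecutive_def by auto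
      then have "level (fst e) = level (fst d)" using d(2)[OF e] by linarith
      then show ?thesis using level_inj[of e d] e d(1) by metis
    qed
    ultimately show ?thesis by blast
  qed
  have inc: "\<exists>!d. (d, c) \<in> ?P" if c: "c \<in> indices n" "fst c \<in> creators" for c
  proof -
    let ?Q = "\<lambda>d. d \<in> indices n \<and> k d = k c \<and> level (fst d) < level (fst c)"
    have "\<forall>y. ?Q y \<longrightarrow> level (fst y) < level (fst c)" by simp
    then obtain d where d: "?Q d" "\<And>e. ?Q e \<Longrightarrow> level (fst e) \<le> level (fst d)"
      using below[OF c] ex_has_greatest_nat[of ?Q _ "\<lambda>d. level (fst d)" "level (fst c)"] by (metis less_imp_le)
    then have "\<not> (\<exists>e\<in>indices n. k e = k d \<and> level (fst d) < level (fst e) \<and> level (fst e) < level (fst c))"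
      by (metis not_less)
    then have "(d, c) \<in> ?P" unfolding consecutive_def using c d(1) by simp
    moreover have "e = d" if "(e, c) \<in> ?P" for e
    proof -
      have e: "?Q e" using that unfolding consecutive_def by auto
      have "\<not> level (fst e) < level (fst d)" using that d(1) unfolding consecutive_def by auto
      then have "level (fst e) = level (fst d)" using d(2)[OF e] by linarith
      then show ?thesis using level_inj[of e d] e d(1) by metis
    qed
    ultimately show ?thesis by blast
  qed
  show "?P \<in> matchings n"
    unfolding matchings_iff using out inc types by (auto simp: consecutive_def)
  \<comment> \<open>Induction on the level gap: the matched successor of c lies above c and, being
    nearest, not beyond d.\<close>
  have conn: "(c, d) \<in> ?P\<^sup>*"
    if "c \<in> indices n" "d \<in> indices n" "k c = k d" "level (fst c) < level (fst d)" for c d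
    using that
  proof (induction "level (fst d) - level (fst c)" arbitrary: c rule: less_induct)
    case less
    obtain e where e: "(c, e) \<in> ?P" using out types less.prems by blast
    then have e': "e \<in> indices n" "k e = k c" "level (fst c) < level (fst e)" unfolding consecutive_def by auto
    have "\<not> level (fst d) < level (fst e)" using e less.prems unfolding consecutive_def by auto
    then consider "e = d" | "level (fst e) < level (fst d)"
      using level_inj[of e d] e' less.prems by force
    then show ?case
    proof cases
      case 1 then show ?thesis using e by auto
    next
      case 2
      then have "(e, d) \<in> ?P\<^sup>*" using less.hyps[of e] e' less.prems by auto
      then show ?thesis using e by (meson converse_rtrancl_into_rtrancl)
    qed
  qed
  have "k c = k d \<longleftrightarrow> (c, d) \<in> match_equiv n ?P" if cd: "c \<in> indices n" "d \<in> indices n" for c d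
  proof
    assume kk: "k c = k d"
    have "(c, d) \<in> ?P\<^sup>* \<union> (?P\<inverse>)\<^sup>*"
      using conn[OF cd kk] conn[OF cd(2,1) kk[symmetric]] level_inj[OF cd kk]
      by (metis UnCI nat_neq_iff rtrancl.rtrancl_refl rtrancl_converseI)
    then show "(c, d) \<in> match_equiv n ?P"
      unfolding match_equiv_def using cd by (metis IntI SigmaI UnE in_rtrancl_UnI)
  next
    assume "(c, d) \<in> match_equiv n ?P"
    then have "(c, d) \<in> (?P \<union> ?P\<inverse>)\<^sup>*" unfolding match_equiv_def by auto
    then show "k c = k d"
      by (induction rule: rtrancl_induct) (auto simp: consecutive_def)
  qed
  moreover have "k ` indices n = {..<m}"
  proof -
    have "\<exists>c\<in>indices n. k c = j" if "j < m" for j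
    proof -
      have "block_class n k j \<noteq> {}" using chain[OF that] unfolding chain_types_iff by blast
      then show ?thesis using ex by blast
    qed
    then show ?thesis using lt by auto
  qed
  ultimately show "k \<in> numbers_classes n ?P m" unfolding numbers_classes_def using kin by simp
qed

section \<open>Counting the numberings of classes\<close>

lemma card_bijections:
  assumes "finite A" "finite B" "card A = card B"
  shows "card {f \<in> A \<rightarrow>\<^sub>E B. bij_betw f A B} = fact (card A)"
proof -
  have "{f \<in> A \<rightarrow>\<^sub>E B. bij_betw f A B} = {f \<in> A \<rightarrow>\<^sub>E B. inj_on f A}"
    using assms by (auto simp: bij_betw_def intro!: card_subset_eq card_image simp flip: card_image)
      (metis PiE_mem card_image card_subset_eq image_eqI image_subsetI)
  then show ?thesis
    using card_inj_on_subset_funcset[of A B A] assms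
    by (simp add: fact_prod_rev)
qed

text \<open>A function whose fibres are the classes factors through the quotient as an injection,
  and surjectivity makes it a bijection of the quotient with B; bijections are counted by the
  factorial.\<close>

lemma card_class_numberings:
  assumes E: "equiv A E" and fin: "finite A" "finite B"
  defines "N \<equiv> {k \<in> A \<rightarrow>\<^sub>E B. k ` A = B \<and> (\<forall>c\<in>A. \<forall>d\<in>A. k c = k d \<longleftrightarrow> (c, d) \<in> E)}"
  shows "card N = (if card B = card (A // E) then fact (card B) else 0)"
proof -
  let ?F = "{f \<in> A // E \<rightarrow>\<^sub>E B. bij_betw f (A // E) B}"
  let ?h = "\<lambda>f. \<lambda>c\<in>A. f (E `` {c})"
  have "N = ?h ` ?F"
  proof (intro equalityI subsetI)
    fix k assume k: "k \<in> N"
    have ker: "\<And>c d. c \<in> A \<Longrightarrow> d \<in> A \<Longrightarrow> k c = k d \<longleftrightarrow> (c, d) \<in> E"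
      using k by (simp add: N_def)
    \<comment> \<open>\<open>the_elem\<close> reads off the common value of k on a class.\<close>
    let ?f = "\<lambda>\<gamma>\<in>A // E. the_elem (k ` \<gamma>)"
    have f: "?f (E `` {c}) = k c" if c: "c \<in> A" for c
    proof -
      have "k ` (E `` {c}) = {k c}"
      proof -
        have "c \<in> E `` {c}" using E c by (rule equiv_class_self)
        moreover have "k d = k c" if "d \<in> E `` {c}" for d
        proof -
          have "(c, d) \<in> E" using that by simp
          then have "d \<in> A" using equiv_type[OF E] by blast
          with \<open>(c, d) \<in> E\<close> show ?thesis using ker[OF c, of d] by simp
        qed
        ultimately show ?thesis by blast
      qed
      then show ?thesis using c by (simp add: quotientI)
    qed
    have "bij_betw ?f (A // E) B"
      unfolding bij_betw_def
    proof
      show "inj_on ?f (A // E)"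
      proof (rule inj_onI)
        fix \<gamma> \<delta> assume "\<gamma> \<in> A // E" "\<delta> \<in> A // E" and eq: "?f \<gamma> = ?f \<delta>"
        then obtain c d where cd: "c \<in> A" "d \<in> A" "\<gamma> = E `` {c}" "\<delta> = E `` {d}" by (auto elim!: quotientE)
        then have "k c = k d" using eq f by metis
        then have "(c, d) \<in> E" using ker cd by simp
        then show "\<gamma> = \<delta>" using cd E by (simp add: equiv_class_eq)
      qed
      show "?f ` (A // E) = B"
      proof -
        have "?f ` (A // E) = (\<lambda>c. ?f (E `` {c})) ` A" by (auto simp: quotient_def)
        also have "\<dots> = k ` A" by (rule image_cong) (use f in simp_all)
        finally show ?thesis using k by (simp add: N_def)
      qed
    qed
    moreover from this have "?f \<in> A // E \<rightarrow>\<^sub>E B" by (auto simp: bij_betw_def simp del: restrict_apply)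
    moreover have "k = ?h ?f" using f k unfolding N_def by (auto simp: fun_eq_iff PiE_def extensional_def)
    ultimately show "k \<in> ?h ` ?F" by blast
  next
    fix k assume "k \<in> ?h ` ?F"
    then obtain f where f: "f \<in> A // E \<rightarrow>\<^sub>E B" "bij_betw f (A // E) B" "k = ?h f" by auto
    have kc: "k c = f (E `` {c})" if "c \<in> A" for c using f(3) that by simp
    have "k \<in> A \<rightarrow>\<^sub>E B" using f by (auto simp: quotientI)
    moreover have "k ` A = B"
    proof -
      have "A // E = (\<lambda>c. E `` {c}) ` A" by (auto simp: quotient_def)
      then have "f ` (A // E) = (\<lambda>c. f (E `` {c})) ` A" by auto
      then show ?thesis using f(2) kc by (auto simp: bij_betw_def)
    qed
    moreover have "k c = k d \<longleftrightarrow> (c, d) \<in> E" if "c \<in> A" "d \<in> A" for c d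
    proof -
      have "k c = k d \<longleftrightarrow> E `` {c} = E `` {d}"
        using that f(2) kc by (metis bij_betw_def inj_on_eq_iff quotientI)
      then show ?thesis using E that by (simp add: eq_equiv_class_iff)
    qed
    ultimately show "k \<in> N" unfolding N_def by simp
  qed
  moreover have "inj_on ?h ?F"
  proof (rule inj_onI)
    fix f g assume "f \<in> ?F" "g \<in> ?F" and eq: "?h f = ?h g"
    then have fg: "f \<in> A // E \<rightarrow>\<^sub>E B" "g \<in> A // E \<rightarrow>\<^sub>E B" by auto
    show "f = g"
    proof (rule PiE_ext[OF fg])
      fix \<gamma> assume "\<gamma> \<in> A // E"
      then obtain c where "c \<in> A" "\<gamma> = E `` {c}" by (auto elim!: quotientE)
      then show "f \<gamma> = g \<gamma>" using fun_cong[OF eq, of c] by simp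
    qed
  qed
  ultimately have "card N = card ?F" by (simp add: card_image)
  also have "\<dots> = (if card B = card (A // E) then fact (card B) else 0)"
  proof (cases "card B = card (A // E)")
    case True
    then show ?thesis using fin finite_quotient[OF fin(1)] E card_bijections[of "A // E" B]
      by (simp add: equiv_type)
  next
    case False
    then have "?F = {}" using bij_betw_same_card by fastforce
    then show ?thesis using False by (simp only: card.empty if_False)
  qed
  finally show ?thesis .
qed

lemma equiv_match_equiv: "equiv (indices n) (match_equiv n \<pp>)"
proof (rule equivI)
  show "match_equiv n \<pp> \<subseteq> indices n \<times> indices n" unfolding match_equiv_def by blast
  show "refl_on (indices n) (match_equiv n \<pp>)" unfolding match_equiv_def refl_on_def by auto
  show "sym (match_equiv n \<pp>)"
    unfolding match_equiv_def
    by (intro sym_Int sym_rtrancl) (auto simp: sym_def)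
  show "trans (match_equiv n \<pp>)"
    unfolding match_equiv_def
    by (intro trans_Int trans_rtrancl) (auto simp: trans_def)
qed

lemma card_numbers_classes:
  "card (numbers_classes n \<pp> m) =
     (if m = card (indices n // match_equiv n \<pp>) then fact m else 0)"
  using card_class_numberings[OF equiv_match_equiv, of n "{..<m}" \<pp>]
  unfolding numbers_classes_def by simp

lemma finite_numbers_classes: "finite (numbers_classes n \<pp> m)"
  by (rule finite_subset[of _ "indices n \<rightarrow>\<^sub>E {..<m}"]) (auto simp: numbers_classes_def intro!: finite_PiE)

lemma finite_matchings: "finite (matchings n)"
proof (rule finite_subset)
  show "matchings n \<subseteq> Pow (indices n \<times> indices n)" unfolding matchings_def by blast
qed simp

text \<open>\<open>consecutive\<close> recovers the matching from the numbering, so pairs of a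
  matching and a numbering of its classes correspond to elements of \<open>numberings\<close>. This
  removes the matchings from the computation of \<open>mm\<close>.\<close>

lemma sum_matchings_numbers_classes:
  "(\<Sum>\<pp>\<in>matchings n. \<Sum>k\<in>numbers_classes n \<pp> m. Y k) = (\<Sum>k\<in>numberings n m. Y k)"
proof -
  have "(\<Sum>\<pp>\<in>matchings n. \<Sum>k\<in>numbers_classes n \<pp> m. Y k) =
      (\<Sum>(\<pp>, k)\<in>Sigma (matchings n) (\<lambda>\<pp>. numbers_classes n \<pp> m). Y k)"
    by (intro sum.Sigma finite_matchings ballI finite_numbers_classes)
  also have "\<dots> = (\<Sum>k\<in>numberings n m. Y k)"
    by (rule sum.reindex_bij_witness[where i = "\<lambda>k. (consecutive n k, k)" and j = snd])
       (auto simp: matching_class_structure consecutive_matching simp flip: matching_class_structure(2))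
  finally show ?thesis .
qed

text \<open>Prescribing the colouring decouples the blocks: what remains free is, for each block, a
  bijection of its positions onto the classes that meet it.\<close>

lemma block_class_eq_iff:
  assumes k: "k \<in> indices n \<rightarrow>\<^sub>E {..<m}"
  shows "(\<forall>j<m. block_class n k j = \<kappa> j) \<and>
      (\<forall>c\<in>indices n. \<forall>d\<in>indices n. fst c = fst d \<longrightarrow> k c = k d \<longrightarrow> c = d) \<longleftrightarrow>
    (\<forall>b. bij_betw (\<lambda>i. k (b, i)) {..<n b} {j. j < m \<and> b \<in> \<kappa> j})" (is "?L \<longleftrightarrow> ?R")
proof
  assume L: ?L
  show ?R
  proof
    fix b
    show "bij_betw (\<lambda>i. k (b, i)) {..<n b} {j. j < m \<and> b \<in> \<kappa> j}"
      unfolding bij_betw_def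
    proof
      show "inj_on (\<lambda>i. k (b, i)) {..<n b}"
        using L by (auto simp: inj_on_def indices_def)
      have lt: "k (b, i) < m" if "i < n b" for i using k that by (auto simp: indices_def)
      show "(\<lambda>i. k (b, i)) ` {..<n b} = {j. j < m \<and> b \<in> \<kappa> j}"
      proof (intro equalityI subsetI)
        fix j assume "j \<in> {j. j < m \<and> b \<in> \<kappa> j}"
        then have "b \<in> block_class n k j" using L by blast
        then show "j \<in> (\<lambda>i. k (b, i)) ` {..<n b}" by (auto simp: block_class_def)
      next
        fix j assume "j \<in> (\<lambda>i. k (b, i)) ` {..<n b}"
        then obtain i where i: "i < n b" "j = k (b, i)" by auto
        then have "b \<in> block_class n k j" by (auto simp: block_class_def)
        then show "j \<in> {j. j < m \<and> b \<in> \<kappa> j}" using L lt i by simp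
      qed
    qed
  qed
next
  assume R: ?R
  have inj: "i = i'" if "i < n b" "i' < n b" "k (b, i) = k (b, i')" for b i i'
    using R that unfolding bij_betw_def inj_on_def by blast
  have img: "(\<exists>i<n b. k (b, i) = j) \<longleftrightarrow> j < m \<and> b \<in> \<kappa> j" for b j
  proof -
    have "(\<lambda>i. k (b, i)) ` {..<n b} = {j. j < m \<and> b \<in> \<kappa> j}" using R unfolding bij_betw_def by blast
    from arg_cong[OF this, of "\<lambda>S. j \<in> S"] show ?thesis by (auto simp: image_iff)
  qed
  show ?L
    using inj img by (auto simp: block_class_def indices_def)
qed

definition block_sizes :: "nat \<Rightarrow> (nat \<Rightarrow> block set) \<Rightarrow> block \<Rightarrow> nat" where
  "block_sizes m \<kappa> b = card {j. j < m \<and> b \<in> \<kappa> j}"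

lemma numberings_of_colouring:
  assumes \<kappa>: "\<kappa> \<in> colourings m"
  shows "{k \<in> numberings n m. restrict (block_class n k) {..<m} = \<kappa>} =
    {k \<in> indices n \<rightarrow>\<^sub>E {..<m}. \<forall>b. bij_betw (\<lambda>i. k (b, i)) {..<n b} {j. j < m \<and> b \<in> \<kappa> j}}"
proof -
  have eq: "restrict (block_class n k) {..<m} = \<kappa> \<longleftrightarrow> (\<forall>j<m. block_class n k j = \<kappa> j)" for k
    using \<kappa> by (auto simp: fun_eq_iff PiE_def extensional_def)
  have ch: "\<kappa> j \<in> chain_types" if "j < m" for j using \<kappa> that by auto
  show ?thesis
  proof (rule Collect_cong)
    fix k
    show "k \<in> numberings n m \<and> restrict (block_class n k) {..<m} = \<kappa> \<longleftrightarrow>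
      k \<in> indices n \<rightarrow>\<^sub>E {..<m} \<and> (\<forall>b. bij_betw (\<lambda>i. k (b, i)) {..<n b} {j. j < m \<and> b \<in> \<kappa> j})"
    proof (cases "k \<in> indices n \<rightarrow>\<^sub>E {..<m}")
      case True
      have "k \<in> numberings n m \<and> restrict (block_class n k) {..<m} = \<kappa> \<longleftrightarrow>
        (\<forall>j<m. block_class n k j = \<kappa> j) \<and>
        (\<forall>c\<in>indices n. \<forall>d\<in>indices n. fst c = fst d \<longrightarrow> k c = k d \<longrightarrow> c = d)"
        (is "_ \<longleftrightarrow> ?B \<and> ?I")
      proof -
        have "?B \<Longrightarrow> \<forall>j<m. block_class n k j \<in> chain_types" using ch by simp
        then show ?thesis unfolding numberings_def eq mem_Collect_eq using True by argo
      qed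
      with block_class_eq_iff[OF True, of \<kappa>] True show ?thesis by argo
    qed (simp add: numberings_def)
  qed
qed

text \<open>The bijections of the single blocks are chosen independently, which gives the very
  product of factorials by which \<open>mm\<close> divides. They exist only if each block has as
  many positions as there are classes meeting it.\<close>

lemma card_numberings_of_colouring:
  assumes \<kappa>: "\<kappa> \<in> colourings m"
  shows "card {k \<in> numberings n m. restrict (block_class n k) {..<m} = \<kappa>} =
    (if n = block_sizes m \<kappa> then (\<Prod>b\<in>UNIV. fact (n b)) else 0)"
proof -
  let ?J = "\<lambda>b. {j. j < m \<and> b \<in> \<kappa> j}"
  let ?K = "{k \<in> indices n \<rightarrow>\<^sub>E {..<m}. \<forall>b. bij_betw (\<lambda>i. k (b, i)) {..<n b} (?J b)}"
  let ?F = "\<lambda>b. {f \<in> {..<n b} \<rightarrow>\<^sub>E ?J b. bij_betw f {..<n b} (?J b)}"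
  let ?h = "\<lambda>g. \<lambda>c\<in>indices n. (g (fst c) (snd c) :: nat)"
  have "bij_betw ?h (PiE UNIV ?F) ?K"
  proof (rule bij_betw_byWitness[where f' = "\<lambda>k b. \<lambda>i\<in>{..<n b}. k (b, i)"])
    show "\<forall>g\<in>PiE UNIV ?F. (\<lambda>b. \<lambda>i\<in>{..<n b}. ?h g (b, i)) = g"
    proof (intro ballI ext)
      fix g b i assume "g \<in> PiE UNIV ?F"
      then have "g b \<in> {..<n b} \<rightarrow>\<^sub>E ?J b" by (auto simp: PiE_iff)
      then show "(\<lambda>i\<in>{..<n b}. ?h g (b, i)) i = g b i"
        by (auto simp: indices_def PiE_def extensional_def)
    qed
    show "\<forall>k\<in>?K. ?h (\<lambda>b. \<lambda>i\<in>{..<n b}. k (b, i)) = k"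
      by (auto simp: indices_def PiE_def extensional_def fun_eq_iff)
    show "?h ` PiE UNIV ?F \<subseteq> ?K"
    proof clarify
      fix g assume "g \<in> PiE UNIV ?F"
      then have g: "g b \<in> {..<n b} \<rightarrow>\<^sub>E ?J b" "bij_betw (g b) {..<n b} (?J b)" for b by (auto simp: PiE_iff)
      have "?h g c \<in> {..<m}" if "c \<in> indices n" for c
      proof -
        have "snd c \<in> {..<n (fst c)}" using that by (auto simp: indices_def)
        then show ?thesis using PiE_mem[OF g(1)] that by simp
      qed
      then have "?h g \<in> indices n \<rightarrow>\<^sub>E {..<m}" by (simp add: PiE_iff)
      moreover have "bij_betw (\<lambda>i. ?h g (b, i)) {..<n b} (?J b)" for b
        using g(2)[of b] by (rule bij_betw_cong[THEN iffD1, rotated]) (simp add: indices_def)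
      ultimately show "?h g \<in> indices n \<rightarrow>\<^sub>E {..<m} \<and> (\<forall>b. bij_betw (\<lambda>i. ?h g (b, i)) {..<n b} (?J b))"
        by blast
    qed
    show "(\<lambda>k b. \<lambda>i\<in>{..<n b}. k (b, i)) ` ?K \<subseteq> PiE UNIV ?F"
    proof clarify
      fix k assume k: "\<forall>b. bij_betw (\<lambda>i. k (b, i)) {..<n b} (?J b)"
      have "bij_betw (\<lambda>i\<in>{..<n b}. k (b, i)) {..<n b} (?J b)" for b
        using k[rule_format, of b] by (rule bij_betw_cong[THEN iffD1, rotated]) simp
      moreover from this have "(\<lambda>i\<in>{..<n b}. k (b, i)) \<in> {..<n b} \<rightarrow>\<^sub>E ?J b" for b
        using bij_betwE by (simp add: PiE_iff) blast
      ultimately show "(\<lambda>b. \<lambda>i\<in>{..<n b}. k (b, i)) \<in> PiE UNIV ?F" by (simp add: PiE_iff)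
    qed
  qed
  then have "card ?K = card (PiE UNIV ?F)" by (simp add: bij_betw_same_card)
  also have "\<dots> = (\<Prod>b\<in>UNIV. card (?F b))" by (simp add: card_PiE)
  also have "\<dots> = (if n = block_sizes m \<kappa> then (\<Prod>b\<in>UNIV. fact (n b)) else 0)"
  proof (cases "n = block_sizes m \<kappa>")
    case True
    then have "card (?F b) = fact (n b)" for b
      using card_bijections[of "{..<n b}" "?J b"] by (simp add: block_sizes_def)
    then show ?thesis using True by simp
  next
    case False
    then obtain b where b: "n b \<noteq> card (?J b)" by (auto simp: block_sizes_def fun_eq_iff)
    then have "?F b = {}" using bij_betw_same_card[of _ "{..<n b}" "?J b"] by auto
    then have "card (?F b) = 0" by (simp only: card.empty)
    then have "(\<Prod>b\<in>UNIV. card (?F b)) = 0"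
      by (intro prod_zero[OF finite_class.finite_UNIV] bexI[OF _ UNIV_I])
    then show ?thesis using False by simp
  qed
  finally show ?thesis unfolding numberings_of_colouring[OF \<kappa>] .
qed

section \<open>The inner product, configurations and test vectors\<close>

lemma cinner_add_left: "cinner (x + y) z = cinner x z + cinner y z"
  by (metis cinner_add_right cinner_commute complex_cnj_add)

lemma cinner_scaleR_right: "cinner x (r *\<^sub>R y) = r *\<^sub>R cinner x y"
  by (metis cinner_scaleC_right scaleC_of_real scaleR_conv_of_real)

lemma cinner_scaleR_left: "cinner (r *\<^sub>R x) y = r *\<^sub>R cinner x y"
  by (metis cinner_commute cinner_scaleR_right complex_cnj_scaleR)

lemma norm_scaleC: "norm (c *\<^sub>C x) = norm c * norm (x :: 'a::separable_chilbert)"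
proof -
  have "complex_of_real ((norm (c *\<^sub>C x))\<^sup>2) = cinner (c *\<^sub>C x) (c *\<^sub>C x)" by (simp add: cinner_same)
  also have "\<dots> = c * cnj c * cinner x x"
    by (metis (no_types) cinner_commute cinner_scaleC_right complex_cnj_mult mult.assoc)
  also have "\<dots> = complex_of_real ((norm c * norm x)\<^sup>2)"
    by (simp add: cinner_same complex_norm_square[symmetric] power_mult_distrib)
  finally have "(norm (c *\<^sub>C x))\<^sup>2 = (norm c * norm x)\<^sup>2" by (simp only: of_real_eq_iff)
  then show ?thesis by (simp add: power2_eq_iff_nonneg)
qed

text \<open>The class supplies a norm, so the triangle inequality is available in advance; squared
  and expanded, it is this real form of the Cauchy-Schwarz inequality.\<close>

lemma Re_cinner_le: "Re (cinner x y) \<le> norm x * norm (y :: 'a::separable_chilbert)"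
proof -
  have "complex_of_real ((norm (x + y))\<^sup>2) = cinner (x + y) (x + y)" by (simp add: cinner_same)
  also have "\<dots> = complex_of_real ((norm x)\<^sup>2) + complex_of_real ((norm y)\<^sup>2) + (cinner x y + cnj (cinner x y))"
    unfolding cinner_add_left cinner_add_right by (simp add: cinner_same cinner_commute[of y x])
  also have "\<dots> = complex_of_real ((norm x)\<^sup>2 + (norm y)\<^sup>2 + 2 * Re (cinner x y))"
    by (simp add: complex_add_cnj)
  finally have "(norm (x + y))\<^sup>2 = (norm x)\<^sup>2 + (norm y)\<^sup>2 + 2 * Re (cinner x y)" by (simp only: of_real_eq_iff)
  moreover have "(norm (x + y))\<^sup>2 \<le> (norm x + norm y)\<^sup>2" by (intro power_mono norm_triangle_ineq) simp
  ultimately show ?thesis by (simp add: power2_sum)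
qed

lemma norm_cinner_le: "norm (cinner x y) \<le> norm x * norm (y :: 'a::separable_chilbert)"
proof (cases "cinner x y = 0")
  case False
  \<comment> \<open>A factor of modulus one that turns the inner product onto the positive real
    axis.\<close>
  define c where "c = cnj (sgn (cinner x y))"
  have "norm c = 1" using False by (simp add: c_def norm_sgn)
  have "c * cinner x y = norm (cinner x y)"
    using False by (simp add: c_def sgn_div_norm complex_norm_square[symmetric] field_simps power2_eq_square
        scaleR_conv_of_real)
  then have "norm (cinner x y) = Re (cinner x (c *\<^sub>C y))" by (simp add: cinner_scaleC_right)
  also have "\<dots> \<le> norm x * norm y" using Re_cinner_le[of x "c *\<^sub>C y"] \<open>norm c = 1\<close> by (simp add: norm_scaleC)
  finally show ?thesis .
qed simp

lemma bounded_bilinear_cinner: "bounded_bilinear (cinner :: 'a::separable_chilbert \<Rightarrow> 'a \<Rightarrow> complex)"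
  by (rule bounded_bilinear.intro)
    (auto simp: cinner_add_left cinner_add_right cinner_scaleR_left cinner_scaleR_right
      intro!: exI[of _ 1] norm_cinner_le)

section \<open>Topology and Borel structure of the configuration space\<close>

lemma continuous_map_into_config:
  assumes "\<And>i. i < n \<Longrightarrow> continuous_map X euclideanreal (\<lambda>x. e x i)"
  shows "continuous_map X config_topology (\<lambda>x. map (e x) [0..<n])"
  unfolding config_topology_def
proof (rule continuous_map_pullback')
  have eq: "(\<lambda>ts. (length ts, \<lambda>i\<in>{..<length ts}. ts ! i)) \<circ> (\<lambda>x. map (e x) [0..<n]) =
    (\<lambda>r. (n, r)) \<circ> (\<lambda>x. \<lambda>i\<in>{..<n}. e x i)"
    by (auto simp: fun_eq_iff)
  show "continuous_map X (sum_topology (\<lambda>n. product_topology (\<lambda>_. euclideanreal) {..<n}) UNIV)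
    ((\<lambda>ts. (length ts, \<lambda>i\<in>{..<length ts}. ts ! i)) \<circ> (\<lambda>x. map (e x) [0..<n]))"
    unfolding eq
  proof (rule continuous_map_compose)
    show "continuous_map X (product_topology (\<lambda>_. euclideanreal) {..<n}) (\<lambda>x. \<lambda>i\<in>{..<n}. e x i)"
      unfolding continuous_map_componentwise using assms by auto
  qed (rule continuous_map_component_injection, simp)
qed simp

text \<open>A map out of a topological sum is continuous if it is so on each summand, and reading
  the indexed vector as a list undoes the embedding along which \<open>config_topology\<close> is
  pulled back.\<close>

lemma continuous_map_from_config:
  assumes "\<And>n. continuous_map (product_topology (\<lambda>_. euclideanreal) {..<n}) Y (\<lambda>r. h (map r [0..<n]))"
  shows "continuous_map config_topology Y h"
proof -
  let ?X = "\<lambda>n. product_topology (\<lambda>_. euclideanreal) {..<n}"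
  let ?g = "\<lambda>(n, r). h (map r [0..<n])"
  have "continuous_map (sum_topology ?X UNIV) Y ?g"
    unfolding continuous_map_def
  proof (intro conjI allI impI)
    show "?g \<in> topspace (sum_topology ?X UNIV) \<rightarrow> topspace Y"
    proof (rule Pi_I)
      fix p :: "nat \<times> (nat \<Rightarrow> real)" assume "p \<in> topspace (sum_topology ?X UNIV)"
      then have "snd p \<in> topspace (?X (fst p))" by auto
      from Pi_mem[OF continuous_map_funspace[OF assms[of "fst p"]] this]
      show "?g p \<in> topspace Y" by (simp add: case_prod_beta)
    qed
    fix U assume "openin Y U"
    then have "openin (?X n) {r \<in> topspace (?X n). h (map r [0..<n]) \<in> U}" for n
      using assms[of n] by (auto simp: continuous_map_def)
    then show "openin (sum_topology ?X UNIV) {x \<in> topspace (sum_topology ?X UNIV). ?g x \<in> U}"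
      unfolding openin_sum_topology by simp
  qed
  then have "continuous_map config_topology Y (?g \<circ> (\<lambda>ts. (length ts, \<lambda>i\<in>{..<length ts}. ts ! i)))"
    unfolding config_topology_def by (rule continuous_map_pullback)
  moreover have "map (\<lambda>i\<in>{..<length ts}. ts ! i) [0..<length ts] = ts" for ts :: "real list"
    by (rule nth_equalityI) simp_all
  ultimately show ?thesis by (simp add: comp_def)
qed

lemma topspace_config [simp]: "topspace config_topology = UNIV"
  unfolding config_topology_def topspace_pullback_topology by (auto simp: PiE_iff)

text \<open>Length is locally constant, so the default value 0 does not break continuity; it makes
  coordinates total functions.\<close>

lemma continuous_map_config_nth:
  "continuous_map config_topology euclideanreal (\<lambda>ts. if i < length ts then ts ! i else 0)"
proof (rule continuous_map_from_config)
  fix n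
  show "continuous_map (product_topology (\<lambda>_. euclideanreal) {..<n}) euclideanreal
     (\<lambda>r. if i < length (map r [0..<n]) then map r [0..<n] ! i else 0)"
    using continuous_map_product_projection[of i "{..<n}" "\<lambda>_. euclideanreal"]
    by (cases "i < n") simp_all
qed

text \<open>A gauge of configurations: a bound on it bounds both the number of points and their
  size, and it grows when a point is added. It serves to build dominating test vectors and to
  exhaust \<open>mm\<close> by sets of finite measure.\<close>

definition config_extent :: "real list \<Rightarrow> real" where
  "config_extent ts = real (length ts) + (\<Sum>t\<leftarrow>ts. \<bar>t\<bar>)"

lemma continuous_map_config_extent: "continuous_map config_topology euclideanreal config_extent"
proof (rule continuous_map_from_config)
  fix n
  have "config_extent (map r [0..<n]) = real n + (\<Sum>i<n. \<bar>r i\<bar>)" for r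
    by (simp add: config_extent_def comp_def interv_sum_list_conv_sum_set_nat lessThan_atLeast0)
  then show "continuous_map (product_topology (\<lambda>_. euclideanreal) {..<n}) euclideanreal
     (\<lambda>r. config_extent (map r [0..<n]))"
    by (auto intro!: continuous_intros continuous_map_real_abs)
qed

lemma space_config_borel [simp]: "space config_borel = UNIV"
  unfolding config_borel_def by (simp add: space_measure_of)

lemma sets_config_borel: "sets config_borel = sigma_sets UNIV {U. openin config_topology U}"
  unfolding config_borel_def by (simp add: sets_measure_of)

lemma measurable_into_config_borel:
  assumes "continuous_map euclidean config_topology g"
  shows "g \<in> borel \<rightarrow>\<^sub>M config_borel"
proof (rule measurable_sigma_sets[OF sets_config_borel])
  fix U assume "U \<in> {U. openin config_topology U}"
  then have "openin euclidean {x \<in> topspace euclidean. g x \<in> U}"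
    using assms unfolding continuous_map_def by blast
  then show "g -` U \<inter> space borel \<in> sets borel" by (simp add: vimage_def)
qed auto

lemma measurable_from_config_borel:
  fixes h :: "real list \<Rightarrow> 'b::topological_space"
  assumes "continuous_map config_topology euclidean h"
  shows "h \<in> borel_measurable config_borel"
proof (rule borel_measurableI)
  fix S :: "'b set" assume "open S"
  then have "openin config_topology {x \<in> topspace config_topology. h x \<in> S}"
    using assms unfolding continuous_map_def by simp
  then show "h -` S \<inter> space config_borel \<in> sets config_borel"
    unfolding sets_config_borel by (auto simp: vimage_def)
qed

lemma measurable_config_nth [measurable]:
  "(\<lambda>ts. if i < length ts then ts ! i else 0) \<in> borel_measurable config_borel"
  by (rule measurable_from_config_borel[OF continuous_map_config_nth])

lemma measurable_config_length [measurable]: "length \<in> config_borel \<rightarrow>\<^sub>M count_space UNIV"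
proof (rule measurable_count_space_eq2_countable[THEN iffD2], intro conjI ballI)
  fix n :: nat
  have "(\<lambda>ts. real (length ts)) \<in> borel_measurable config_borel"
    by (rule measurable_from_config_borel, rule continuous_map_from_config) simp
  then have "(\<lambda>ts. real (length ts)) -` {real n} \<inter> space config_borel \<in> sets config_borel"
    by (rule measurable_sets) simp
  then show "length -` {n} \<inter> space config_borel \<in> sets config_borel"
    by (simp add: vimage_def)
qed simp_all

lemma measurable_config_list:
  assumes "\<And>i. i < n \<Longrightarrow> (\<lambda>x. e x i) \<in> borel_measurable M"
  shows "(\<lambda>x. map (e x) [0..<n]) \<in> M \<rightarrow>\<^sub>M config_borel"
proof -
  have "(\<lambda>r::nat \<Rightarrow> real. map r [0..<n]) \<in> borel \<rightarrow>\<^sub>M config_borel"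
    by (intro measurable_into_config_borel continuous_map_into_config)
      (simp add: continuous_on_product_then_coordinatewise[OF continuous_on_id, unfolded id_def])
  moreover have "(\<lambda>x i. if i < n then e x i else 0) \<in> borel_measurable M"
  proof (rule measurable_coordinatewise_then_product)
    fix i show "(\<lambda>x. if i < n then e x i else 0) \<in> borel_measurable M"
      using assms by (cases "i < n") simp_all
  qed
  ultimately have "(\<lambda>r. map r [0..<n]) \<circ> (\<lambda>x i. if i < n then e x i else 0) \<in> M \<rightarrow>\<^sub>M config_borel"
    by (rule measurable_comp[rotated])
  moreover have "(\<lambda>r. map r [0..<n]) \<circ> (\<lambda>x i. if i < n then e x i else 0) = (\<lambda>x. map (e x) [0..<n])"
    by (auto simp: fun_eq_iff)
  ultimately show ?thesis by simp
qed

text \<open>There are countably many lengths, and for a given length measurability is that of the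
  coordinates.\<close>

lemma measurable_config:
  assumes len: "(\<lambda>x. length (g x)) \<in> M \<rightarrow>\<^sub>M count_space UNIV"
    and nth: "\<And>i. (\<lambda>x. if i < length (g x) then g x ! i else 0) \<in> borel_measurable M"
  shows "g \<in> M \<rightarrow>\<^sub>M config_borel"
proof -
  have "(\<lambda>x. map (\<lambda>i. if i < length (g x) then g x ! i else 0) [0..<length (g x)]) \<in> M \<rightarrow>\<^sub>M config_borel"
    by (rule measurable_compose_countable[OF _ len, where f = "\<lambda>n x. map (\<lambda>i. if i < length (g x) then g x ! i else 0) [0..<n]"])
      (rule measurable_config_list[OF nth])
  also have "(\<lambda>x. map (\<lambda>i. if i < length (g x) then g x ! i else 0) [0..<length (g x)]) = g"
    by (rule ext, rule nth_equalityI) simp_all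
  finally show ?thesis .
qed

lemma measurable_config_Cons:
  assumes [measurable]: "h \<in> borel_measurable M" "g \<in> M \<rightarrow>\<^sub>M config_borel"
  shows "(\<lambda>x. h x # g x) \<in> M \<rightarrow>\<^sub>M config_borel"
proof (rule measurable_config)
  have len [measurable]: "(\<lambda>x. length (g x)) \<in> M \<rightarrow>\<^sub>M count_space UNIV"
    using assms(2) by (rule measurable_compose[OF _ measurable_config_length])
  show "(\<lambda>x. length (h x # g x)) \<in> M \<rightarrow>\<^sub>M count_space UNIV" by simp
  fix i
  show "(\<lambda>x. if i < length (h x # g x) then (h x # g x) ! i else 0) \<in> borel_measurable M"
  proof (cases i)
    case 0 then show ?thesis by simp
  next
    case (Suc j)
    have "(\<lambda>x. if j < length (g x) then g x ! j else 0) \<in> borel_measurable M"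
      using assms(2) by (rule measurable_compose[OF _ measurable_config_nth])
    then show ?thesis unfolding Suc length_Cons Suc_less_eq nth_Cons_Suc .
  qed
qed

section \<open>Real coordinates for configurations of fixed block sizes\<close>

abbreviation blocks_borel :: "(block \<Rightarrow> real list) measure" where
  "blocks_borel \<equiv> \<Pi>\<^sub>M b\<in>UNIV. config_borel"

text \<open>Parametrises the configurations with block sizes n by a space of real vectors, on which
  continuity can be used. One space serves every n: coordinates outside \<open>indices n\<close> are
  ignored.\<close>

definition assemble :: "(block \<Rightarrow> nat) \<Rightarrow> (index \<Rightarrow> real) \<Rightarrow> block \<Rightarrow> real list" where
  "assemble n r b = map (\<lambda>i. r (b, i)) [0..<n b]"

definition coordinates :: "(block \<Rightarrow> real list) \<Rightarrow> index \<Rightarrow> real" where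
  "coordinates \<omega> = (\<lambda>(b, i). if i < length (\<omega> b) then \<omega> b ! i else 0)"

lemma assemble_coordinates: "assemble (\<lambda>b. length (\<omega> b)) (coordinates \<omega>) = \<omega>"
  by (rule ext, rule nth_equalityI) (simp_all add: assemble_def coordinates_def)

lemma space_blocks_borel [simp]: "space blocks_borel = UNIV"
  by (simp add: space_PiM)

lemma measurable_block [measurable]: "(\<lambda>\<omega>. \<omega> b) \<in> blocks_borel \<rightarrow>\<^sub>M config_borel"
  by (rule measurable_component_singleton) simp

lemma measurable_coordinates [measurable]: "coordinates \<in> borel_measurable blocks_borel"
proof (rule measurable_coordinatewise_then_product)
  fix c :: index
  obtain b i where c: "c = (b, i)" by (cases c)
  have "(\<lambda>\<omega>. if i < length (\<omega> b) then \<omega> b ! i else 0) \<in> borel_measurable blocks_borel"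
    by (rule measurable_compose[OF measurable_block measurable_config_nth])
  then show "(\<lambda>\<omega>. coordinates \<omega> c) \<in> borel_measurable blocks_borel"
    by (simp add: coordinates_def c)
qed

lemma measurable_block_length [measurable]: "(\<lambda>\<omega>. length (\<omega> b)) \<in> blocks_borel \<rightarrow>\<^sub>M count_space UNIV"
  by (rule measurable_compose[OF measurable_block measurable_config_length])

lemma measurable_block_lengths [measurable]:
  "(\<lambda>\<omega> b. length (\<omega> b)) \<in> blocks_borel \<rightarrow>\<^sub>M count_space UNIV"
proof (rule measurable_count_space_eq2_countable[THEN iffD2], intro conjI ballI)
  fix n :: "block \<Rightarrow> nat"
  have "(\<lambda>\<omega> b. length (\<omega> b)) -` {n} \<inter> space blocks_borel = {\<omega> \<in> space blocks_borel. \<forall>b. length (\<omega> b) = n b}"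
    by (auto simp: fun_eq_iff)
  also have "\<dots> \<in> sets blocks_borel" by measurable
  finally show "(\<lambda>\<omega> b. length (\<omega> b)) -` {n} \<inter> space blocks_borel \<in> sets blocks_borel" .
qed simp

text \<open>There are countably many tuples of block sizes; where they are fixed, the function is
  composed of \<open>coordinates\<close> and its expression in real coordinates.\<close>

lemma measurable_by_strata:
  assumes "\<And>n. (\<lambda>(t, r). \<Phi> t (assemble n r)) \<in> N \<Otimes>\<^sub>M borel \<rightarrow>\<^sub>M L"
  shows "(\<lambda>(t, \<omega>). \<Phi> t \<omega>) \<in> N \<Otimes>\<^sub>M blocks_borel \<rightarrow>\<^sub>M L"
proof -
  have "(\<lambda>(t, \<omega>). \<Phi> t (assemble n (coordinates \<omega>))) \<in> N \<Otimes>\<^sub>M blocks_borel \<rightarrow>\<^sub>M L" for n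
  proof -
    have "(\<lambda>(t, \<omega>). (t, coordinates \<omega>)) \<in> N \<Otimes>\<^sub>M blocks_borel \<rightarrow>\<^sub>M N \<Otimes>\<^sub>M borel" by measurable
    from measurable_compose[OF this assms[of n]] show ?thesis by (simp add: case_prod_beta')
  qed
  then have "(\<lambda>p. \<Phi> (fst p) (assemble (\<lambda>b. length (snd p b)) (coordinates (snd p)))) \<in> N \<Otimes>\<^sub>M blocks_borel \<rightarrow>\<^sub>M L"
    by (intro measurable_compose_countable[where g = "\<lambda>p b. length (snd p b)"
          and f = "\<lambda>n p. \<Phi> (fst p) (assemble n (coordinates (snd p)))"]
        measurable_compose[OF measurable_snd measurable_block_lengths]) (simp add: case_prod_beta')
  then show ?thesis by (simp add: assemble_coordinates case_prod_beta')
qed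

lemma measurable_by_strata':
  assumes "\<And>n. (\<lambda>r. \<Phi> (assemble n r)) \<in> borel \<rightarrow>\<^sub>M L"
  shows "\<Phi> \<in> blocks_borel \<rightarrow>\<^sub>M L"
proof -
  have "(\<lambda>\<omega>. \<Phi> (assemble (\<lambda>b. length (\<omega> b)) (coordinates \<omega>))) \<in> blocks_borel \<rightarrow>\<^sub>M L"
    by (intro measurable_compose_countable[where g = "\<lambda>\<omega> b. length (\<omega> b)"
          and f = "\<lambda>n \<omega>. \<Phi> (assemble n (coordinates \<omega>))"]
        measurable_block_lengths measurable_compose[OF measurable_coordinates assms])
  then show ?thesis by (simp add: assemble_coordinates)
qed

lemma continuous_map_assemble:
  assumes "\<And>c. continuous_map X euclideanreal (\<lambda>x. r x c)"
  shows "continuous_map X config_topology (\<lambda>x. assemble n (r x) b)"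
  unfolding assemble_def by (rule continuous_map_into_config[OF assms])

lemma measurable_assemble:
  assumes "\<And>c. c \<in> indices n \<Longrightarrow> (\<lambda>x. r x c) \<in> borel_measurable M"
  shows "(\<lambda>x. assemble n (r x)) \<in> M \<rightarrow>\<^sub>M blocks_borel"
proof (rule measurable_PiM_single')
  fix b :: block
  show "(\<lambda>x. assemble n (r x) b) \<in> M \<rightarrow>\<^sub>M config_borel"
    unfolding assemble_def by (rule measurable_config_list) (simp add: assms indices_def)
qed simp

lemma measurable_index: "(\<lambda>r::index \<Rightarrow> real. r d) \<in> borel_measurable borel"
  using continuous_on_product_then_coordinatewise[OF continuous_on_id, of UNIV d]
  by (intro borel_measurable_continuous_onI) simp

lemma pred_index_eq: "Measurable.pred borel (\<lambda>r::index \<Rightarrow> real. r c = r d)"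
  unfolding pred_def by (intro borel_measurable_eq measurable_index)

lemma measurable_distinct_blocks:
  "{\<omega> \<in> space blocks_borel. distinct (concat (map \<omega> bs))} \<in> sets blocks_borel" (is "?S \<in> _")
proof -
  have "distinct (concat (map (assemble n r) bs)) \<longleftrightarrow>
      distinct (map r (concat (map (\<lambda>b. map (\<lambda>i. (b, i)) [0..<n b]) bs)))" for n r
    by (simp add: assemble_def[abs_def] map_concat comp_def)
  moreover have "Measurable.pred borel (\<lambda>r::index \<Rightarrow> real. distinct (map r cs))" for cs
  proof (induction cs)
    case (Cons c cs)
    have eq: "distinct (map r (c # cs)) \<longleftrightarrow> (\<forall>d\<in>set cs. r c \<noteq> r d) \<and> distinct (map r cs)" for r :: "index \<Rightarrow> real"
      by auto
    note pred_index_eq[measurable]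
    note Cons.IH[measurable]
    show ?case unfolding eq by measurable
  qed simp
  ultimately have "Measurable.pred blocks_borel (\<lambda>\<omega>. distinct (concat (map \<omega> bs)))"
    by (intro measurable_by_strata') simp
  then show ?thesis unfolding pred_def .
qed

text \<open>Adding a point raises \<open>config_extent\<close>, so a bound that decreases with this
  gauge takes care of f and of all its annihilated versions at once. A plateau at the height of an
  upper bound of the norm of f, falling to zero beyond the support of f, is such a bound.\<close>

lemma test_vector_dominated:
  fixes f :: "real list \<Rightarrow> 'k::separable_chilbert"
  assumes f: "f \<in> test_vectors"
  obtains u :: "real list \<Rightarrow> 'k" where "u \<in> test_vectors"
    "\<And>ts. norm (f ts) \<le> norm (u ts)" "\<And>t ts. norm (f (t # ts)) \<le> norm (u ts)"
\<comment> \<open>A unit vector gives u its direction; without one the space is zero and f dominates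
  itself.\<close>
proof (cases "\<exists>e::'k. norm e = 1")
  case False
  have "v = 0" for v :: 'k
  proof (rule ccontr)
    assume "v \<noteq> 0"
    then have "norm (sgn v) = 1" by (simp add: norm_sgn)
    then show False using False by blast
  qed
  then have "norm (v::'k) = 0" for v by (metis norm_zero)
  then have "norm (v::'k) \<le> norm (w::'k)" for v w by (metis order_refl)
  then show ?thesis using that[OF f] by blast
next
  case True
  then obtain e :: 'k where e: "norm e = 1" by blast
  let ?K = "config_topology closure_of {ts. f ts \<noteq> 0}"
  have cont: "continuous_map config_topology euclidean f" and cpt: "compactin config_topology ?K"
    using f unfolding test_vectors_def by auto
  have "compactin euclidean (config_extent ` ?K)"
    by (rule image_compactin[OF cpt continuous_map_config_extent])
  then have "bounded (config_extent ` ?K)" by (simp add: compact_imp_bounded)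
  then obtain R where R: "\<And>ts. ts \<in> ?K \<Longrightarrow> config_extent ts \<le> R"
    unfolding bounded_real by (metis abs_le_D1 imageI)
  have "compactin euclidean (f ` ?K)" by (rule image_compactin[OF cpt cont])
  then have "bounded (f ` ?K)" by (simp add: compact_imp_bounded)
  then obtain C where C: "\<And>ts. ts \<in> ?K \<Longrightarrow> norm (f ts) \<le> C"
    unfolding bounded_iff by blast
  have sub: "ts \<in> ?K" if "f ts \<noteq> 0" for ts
    using that closure_of_subset[of "{ts. f ts \<noteq> 0}" config_topology] by auto
  define C' where "C' = max C 0"
  \<comment> \<open>Height \<open>C'\<close> up to extent R, a region containing the support of f,
    zero from R + 1 on, and linear in between for continuity.\<close>
  define u :: "real list \<Rightarrow> 'k" where "u = (\<lambda>ts. (C' * max 0 (min 1 (R + 1 - config_extent ts))) *\<^sub>R e)"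
  have nu: "norm (u ts) = C' * max 0 (min 1 (R + 1 - config_extent ts))" for ts
    by (simp add: u_def e C'_def)
  have big: "norm (f ts) \<le> norm (u us)" if "config_extent us \<le> config_extent ts" for ts us
  proof (cases "f ts = 0")
    case False
    then have "config_extent us \<le> R" using R[OF sub] that by force
    then show ?thesis using C[OF sub[OF False]] by (simp add: nu C'_def)
  qed simp
  show ?thesis
  proof
    show "norm (f ts) \<le> norm (u ts)" for ts by (rule big) simp
    show "norm (f (t # ts)) \<le> norm (u ts)" for t ts by (rule big) (simp add: config_extent_def)
    have "symmetric config_extent"
      unfolding symmetric_def config_extent_def
      by (metis mset_map size_mset sum_mset_sum_list)
    then have "symmetric u" unfolding symmetric_def u_def by metis
    moreover have "continuous_map config_topology euclidean u"
    proof -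
      have "continuous_map config_topology euclideanreal (\<lambda>ts. C' * max 0 (min 1 (R + 1 - config_extent ts)))"
        by (intro continuous_intros continuous_map_config_extent continuous_map_real_max
            continuous_map_real_min) auto
      moreover have "continuous_map euclideanreal euclidean (\<lambda>r. r *\<^sub>R e)"
        by (simp add: continuous_intros)
      ultimately show ?thesis
        unfolding u_def by (rule continuous_map_compose[unfolded comp_def])
    qed
    moreover have "compactin config_topology (config_topology closure_of {ts. u ts \<noteq> 0})"
    proof -
      let ?B = "{ts. config_extent ts \<le> R + 1}"
      have "closedin config_topology {ts \<in> topspace config_topology. config_extent ts \<in> {..R + 1}}"
        by (rule closedin_continuous_map_preimage[OF continuous_map_config_extent]) simp
      then have cl: "closedin config_topology ?B" by simp
      have "{ts. u ts \<noteq> 0} \<subseteq> ?B" by (auto simp: u_def)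
      then have sub: "config_topology closure_of {ts. u ts \<noteq> 0} \<subseteq> ?B"
        using cl by (rule closure_of_minimal)
      \<comment> \<open>A compact set of n-point configurations, the continuous image of a cube.
        Extent at most R + 1 leaves finitely many n.\<close>
      let ?Q = "\<lambda>n. (\<lambda>r. map r [0..<n]) ` (\<Pi>\<^sub>E i\<in>{..<n}. {-(R + 1)..R + 1})"
      have cQ: "compactin config_topology (?Q n)" for n
      proof (rule image_compactin)
        show "compactin (product_topology (\<lambda>_. euclideanreal) {..<n}) (\<Pi>\<^sub>E i\<in>{..<n}. {-(R + 1)..R + 1})"
          by (simp add: compactin_PiE)
        show "continuous_map (product_topology (\<lambda>_. euclideanreal) {..<n}) config_topology (\<lambda>r. map r [0..<n])"
          using continuous_map_product_projection[of _ "{..<n}" "\<lambda>_. euclideanreal"]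
          by (intro continuous_map_into_config) simp
      qed
      have "?B \<subseteq> (\<Union>n\<in>{..nat \<lceil>R + 1\<rceil>}. ?Q n)"
      proof
        fix ts assume "ts \<in> ?B"
        then have le: "real (length ts) + (\<Sum>t\<leftarrow>ts. \<bar>t\<bar>) \<le> R + 1" by (simp add: config_extent_def)
        have nn: "0 \<le> (\<Sum>t\<leftarrow>ts. \<bar>t\<bar>)" by (rule sum_list_nonneg) auto
        then have "length ts \<le> nat \<lceil>R + 1\<rceil>" using le by linarith
        moreover have "ts ! i \<in> {-(R + 1)..R + 1}" if "i < length ts" for i
        proof -
          have "\<bar>ts ! i\<bar> \<le> (\<Sum>t\<leftarrow>ts. \<bar>t\<bar>)"
            using that by (intro member_le_sum_list) auto
          then show ?thesis using le by (auto simp: abs_le_iff)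
        qed
        then have "ts \<in> ?Q (length ts)"
          by (intro image_eqI[where x = "\<lambda>i\<in>{..<length ts}. ts ! i"])
            (auto intro: nth_equalityI)
        ultimately show "ts \<in> (\<Union>n\<in>{..nat \<lceil>R + 1\<rceil>}. ?Q n)" by blast
      qed
      moreover have "compactin config_topology (\<Union>n\<in>{..nat \<lceil>R + 1\<rceil>}. ?Q n)"
        by (rule compactin_Union) (use cQ in blast)+
      ultimately show ?thesis
        using closed_compactin[OF _ subset_trans[OF sub] closedin_closure_of] by blast
    qed
    ultimately show "u \<in> test_vectors" unfolding test_vectors_def by simp
  qed
qed

section \<open>The matching measures\<close>

lemma
  assumes "\<And>i. i \<in> I \<Longrightarrow> sets (\<mu> i) = sets N"
  shows space_sum_measure: "space (sum_measure I N \<mu>) = space N"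
    and sets_sum_measure: "sets (sum_measure I N \<mu>) = sets N"
    and emeasure_sum_measure:
      "A \<in> sets N \<Longrightarrow> emeasure (sum_measure I N \<mu>) A = (\<integral>\<^sup>+ i. emeasure (\<mu> i) A \<partial>count_space I)"
proof -
  show "space (sum_measure I N \<mu>) = space N" unfolding sum_measure_def by simp
  show "sets (sum_measure I N \<mu>) = sets N" unfolding sum_measure_def by simp
  assume A: "A \<in> sets N"
  show "emeasure (sum_measure I N \<mu>) A = (\<integral>\<^sup>+ i. emeasure (\<mu> i) A \<partial>count_space I)"
  proof (rule emeasure_measure_of[OF sum_measure_def[of I N \<mu>]])
    show "sets N \<subseteq> Pow (space N)" by (rule sets.space_closed)
    show "A \<in> sets (sum_measure I N \<mu>)" using A unfolding sum_measure_def by simp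
    show "positive (sets (sum_measure I N \<mu>)) (\<lambda>A. \<integral>\<^sup>+ i. emeasure (\<mu> i) A \<partial>count_space I)"
      by (simp add: positive_def)
    show "countably_additive (sets (sum_measure I N \<mu>)) (\<lambda>A. \<integral>\<^sup>+ i. emeasure (\<mu> i) A \<partial>count_space I)"
    proof (rule countably_additiveI)
      fix F :: "nat \<Rightarrow> 'b set"
      assume F: "range F \<subseteq> sets (sum_measure I N \<mu>)" "disjoint_family F"
      then have "range F \<subseteq> sets (\<mu> i)" if "i \<in> I" for i using assms[OF that] unfolding sum_measure_def by simp
      then have "(\<Sum>n. emeasure (\<mu> i) (F n)) = emeasure (\<mu> i) (\<Union> (range F))" if "i \<in> I" for i
        using that F(2) by (intro suminf_emeasure) auto
      then show "(\<Sum>n. \<integral>\<^sup>+ i. emeasure (\<mu> i) (F n) \<partial>count_space I) = (\<integral>\<^sup>+ i. emeasure (\<mu> i) (\<Union> (range F)) \<partial>count_space I)"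
        by (subst nn_integral_suminf[symmetric]) (auto intro: nn_integral_cong)
    qed
  qed
qed

text \<open>The sum over I is an integral for the counting measure, so it commutes with increasing
  limits, and induction over nonnegative measurable functions works for any index set.\<close>

lemma nn_integral_sum_measure:
  assumes \<mu>: "\<And>i. i \<in> I \<Longrightarrow> sets (\<mu> i) = sets N" and f: "f \<in> borel_measurable N"
  shows "(\<integral>\<^sup>+ x. f x \<partial>sum_measure I N \<mu>) = (\<integral>\<^sup>+ i. \<integral>\<^sup>+ x. f x \<partial>\<mu> i \<partial>count_space I)"
proof -
  note s = sets_sum_measure[of I \<mu> N, OF \<mu>]
  have sp: "space (sum_measure I N \<mu>) = space N" by (rule space_sum_measure[OF \<mu>])
  have meas: "g \<in> borel_measurable N \<Longrightarrow> i \<in> I \<Longrightarrow> g \<in> borel_measurable (\<mu> i)" for g :: "'b \<Rightarrow> ennreal" and i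
    using measurable_cong_sets[OF \<mu> refl] by blast
  have meas': "g \<in> borel_measurable N \<Longrightarrow> g \<in> borel_measurable (sum_measure I N \<mu>)" for g :: "'b \<Rightarrow> ennreal"
    using measurable_cong_sets[OF s refl] by blast
  show ?thesis
    using f
  proof (induction rule: borel_measurable_induct)
    case (cong f g)
    have "(\<integral>\<^sup>+ x. f x \<partial>sum_measure I N \<mu>) = (\<integral>\<^sup>+ x. g x \<partial>sum_measure I N \<mu>)"
      using cong by (intro nn_integral_cong) (simp add: sp)
    moreover have "(\<integral>\<^sup>+ i. \<integral>\<^sup>+ x. f x \<partial>\<mu> i \<partial>count_space I) = (\<integral>\<^sup>+ i. \<integral>\<^sup>+ x. g x \<partial>\<mu> i \<partial>count_space I)"
      using cong sets_eq_imp_space_eq[OF \<mu>] by (intro nn_integral_cong) simp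
    ultimately show ?case using cong by simp
  next
    case (set A)
    have "(\<integral>\<^sup>+ i. \<integral>\<^sup>+ x. indicator A x \<partial>\<mu> i \<partial>count_space I) = (\<integral>\<^sup>+ i. emeasure (\<mu> i) A \<partial>count_space I)"
      using set \<mu> by (intro nn_integral_cong nn_integral_indicator) simp
    then show ?case using set emeasure_sum_measure[OF \<mu> set] s by simp
  next
    case (mult u c)
    have "(\<integral>\<^sup>+ i. \<integral>\<^sup>+ x. c * u x \<partial>\<mu> i \<partial>count_space I) = (\<integral>\<^sup>+ i. c * (\<integral>\<^sup>+ x. u x \<partial>\<mu> i) \<partial>count_space I)"
      by (intro nn_integral_cong nn_integral_cmult meas) (use mult in simp_all)
    moreover have "(\<integral>\<^sup>+ i. c * (\<integral>\<^sup>+ x. u x \<partial>\<mu> i) \<partial>count_space I) = c * (\<integral>\<^sup>+ i. \<integral>\<^sup>+ x. u x \<partial>\<mu> i \<partial>count_space I)"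
      by (rule nn_integral_cmult) simp
    moreover have "(\<integral>\<^sup>+ x. c * u x \<partial>sum_measure I N \<mu>) = c * (\<integral>\<^sup>+ x. u x \<partial>sum_measure I N \<mu>)"
      by (intro nn_integral_cmult meas') (use mult in simp)
    ultimately show ?case using mult by simp
  next
    case (add u v)
    have "(\<integral>\<^sup>+ i. \<integral>\<^sup>+ x. v x + u x \<partial>\<mu> i \<partial>count_space I) = (\<integral>\<^sup>+ i. (\<integral>\<^sup>+ x. v x \<partial>\<mu> i) + (\<integral>\<^sup>+ x. u x \<partial>\<mu> i) \<partial>count_space I)"
      by (intro nn_integral_cong nn_integral_add meas) (use add in simp_all)
    moreover have "(\<integral>\<^sup>+ i. (\<integral>\<^sup>+ x. v x \<partial>\<mu> i) + (\<integral>\<^sup>+ x. u x \<partial>\<mu> i) \<partial>count_space I) =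
        (\<integral>\<^sup>+ i. \<integral>\<^sup>+ x. v x \<partial>\<mu> i \<partial>count_space I) + (\<integral>\<^sup>+ i. \<integral>\<^sup>+ x. u x \<partial>\<mu> i \<partial>count_space I)"
      by (rule nn_integral_add) simp_all
    moreover have "(\<integral>\<^sup>+ x. v x + u x \<partial>sum_measure I N \<mu>) =
        (\<integral>\<^sup>+ x. v x \<partial>sum_measure I N \<mu>) + (\<integral>\<^sup>+ x. u x \<partial>sum_measure I N \<mu>)"
      by (intro nn_integral_add meas') (use add in simp_all)
    ultimately show ?case using add by simp
  next
    case (seq U)
    have "(\<integral>\<^sup>+ x. (SUP i. U i) x \<partial>sum_measure I N \<mu>) = (SUP n. \<integral>\<^sup>+ x. U n x \<partial>sum_measure I N \<mu>)"
      unfolding SUP_apply using seq(1,3)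
      by (intro nn_integral_monotone_convergence_SUP) (auto simp: incseq_def le_fun_def intro: meas')
    also have "\<dots> = (SUP n. \<integral>\<^sup>+ i. \<integral>\<^sup>+ x. U n x \<partial>\<mu> i \<partial>count_space I)" using seq by simp
    also have "\<dots> = (\<integral>\<^sup>+ i. (SUP n. \<integral>\<^sup>+ x. U n x \<partial>\<mu> i) \<partial>count_space I)"
      using seq(3) by (intro nn_integral_monotone_convergence_SUP[symmetric])
        (auto simp: incseq_def le_fun_def intro!: nn_integral_mono)
    also have "\<dots> = (\<integral>\<^sup>+ i. \<integral>\<^sup>+ x. (SUP i. U i) x \<partial>\<mu> i \<partial>count_space I)"
      unfolding SUP_apply using seq(1,3)
      by (intro nn_integral_cong nn_integral_monotone_convergence_SUP[symmetric])
        (auto simp: incseq_def le_fun_def intro: meas)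
    finally show ?case by simp
  qed
qed

interpretation lborel_product: product_sigma_finite "\<lambda>_. lborel :: real measure"
  by (rule product_sigma_finite.intro) (rule lborel.sigma_finite_measure_axioms)

lemma measurable_diagonal: "(\<lambda>t::real. \<lambda>c\<in>\<gamma>. t) \<in> lborel \<rightarrow>\<^sub>M (\<Pi>\<^sub>M c\<in>\<gamma>. lborel)"
  by (rule measurable_PiM_single') (auto simp: PiE_iff)

lemma sets_Lambda [simp]: "sets (Lambda \<gamma>) = sets (\<Pi>\<^sub>M c\<in>\<gamma>. lborel)"
  by (simp add: Lambda_def)

text \<open>The coordinate c determines a point of the diagonal, so the slabs on which it is bounded
  have finite measure. For the empty set this fails: the infinite mass of the line then sits on a
  single point.\<close>

lemma sigma_finite_Lambda:
  assumes "c \<in> \<gamma>"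
  shows "sigma_finite_measure (Lambda \<gamma>)"
proof -
  have m: "(\<lambda>x. x c) \<in> (\<Pi>\<^sub>M c\<in>\<gamma>. lborel) \<rightarrow>\<^sub>M (lborel :: real measure)"
    using assms by (rule measurable_component_singleton)
  define S :: "nat \<Rightarrow> (index \<Rightarrow> real) set" where
    "S N = (\<lambda>x. x c) -` {-real N..real N} \<inter> space (\<Pi>\<^sub>M c\<in>\<gamma>. lborel)" for N
  have S: "S N \<in> sets (Lambda \<gamma>)" for N
    unfolding S_def sets_Lambda by (rule measurable_sets[OF m]) simp
  have fin: "emeasure (Lambda \<gamma>) (S N) \<noteq> \<infinity>" for N
  proof -
    have "emeasure (Lambda \<gamma>) (S N) = emeasure lborel ((\<lambda>t. \<lambda>c\<in>\<gamma>. t) -` S N \<inter> space lborel)"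
      using S[of N] unfolding Lambda_def by (subst emeasure_distr[OF measurable_diagonal]) simp_all
    also have "(\<lambda>t. \<lambda>c\<in>\<gamma>. t) -` S N \<inter> space lborel = {-real N..real N}"
      using assms measurable_space[OF measurable_diagonal] by (auto simp: S_def)
    finally show ?thesis by simp
  qed
  have "(\<Union>N. S N) = space (Lambda \<gamma>)"
  proof -
    have "\<exists>N. -real N \<le> x c \<and> x c \<le> real N" for x :: "index \<Rightarrow> real"
      using real_arch_simple[of "\<bar>x c\<bar>"] by (metis abs_le_iff minus_le_iff)
    then show ?thesis by (auto simp: S_def Lambda_def)
  qed
  then show ?thesis
    using S fin by (intro sigma_finite_measure.intro exI[of _ "range S"]) auto
qed

text \<open>A class has one free time, copied to all its indices. With the classes numbered, the
  product of the diagonal measures is therefore the image of Lebesgue measure on m times.\<close>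

lemma matching_measure_eq:
  assumes k: "k \<in> numbers_classes n \<pp> m"
  shows "matching_measure n \<pp> =
    distr (\<Pi>\<^sub>M i\<in>{..<m}. lborel) (\<Pi>\<^sub>M c\<in>indices n. lborel) (\<lambda>s. \<lambda>c\<in>indices n. s (k c))"
proof -
  let ?E = "match_equiv n \<pp>"
  let ?Q = "indices n // ?E"
  have kin: "k \<in> indices n \<rightarrow>\<^sub>E {..<m}" and onto: "k ` indices n = {..<m}"
    and ker: "\<And>c d. c \<in> indices n \<Longrightarrow> d \<in> indices n \<Longrightarrow> k c = k d \<longleftrightarrow> (c, d) \<in> ?E"
    using k unfolding numbers_classes_def by auto
  note E = equiv_match_equiv[of n \<pp>]
  have finQ: "finite ?Q" by (rule finite_quotient) (simp_all add: equiv_type[OF E])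
  define num where "num \<gamma> = k (SOME c. c \<in> \<gamma>)" for \<gamma>
  have cls: "c \<in> ?E `` {c}" "?E `` {c} \<subseteq> indices n" if "c \<in> indices n" for c
    using equiv_class_self[OF E that] equiv_type[OF E] by auto
  have num: "num (?E `` {c}) = k c" if c: "c \<in> indices n" for c
  proof -
    define d where "d = (SOME d. d \<in> ?E `` {c})"
    have "d \<in> ?E `` {c}" unfolding d_def using cls(1)[OF c] by (rule someI)
    then have "(c, d) \<in> ?E" "d \<in> indices n" using cls(2)[OF c] by auto
    then have "k d = k c" using ker[OF c, of d] by simp
    then show ?thesis by (simp only: num_def d_def[symmetric])
  qed
  have bij: "bij_betw num ?Q {..<m}"
    unfolding bij_betw_def
  proof
    show "inj_on num ?Q"
    proof (rule inj_onI)
      fix \<gamma> \<delta> assume "\<gamma> \<in> ?Q" "\<delta> \<in> ?Q" and eq: "num \<gamma> = num \<delta>"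
      then obtain c d where cd: "c \<in> indices n" "d \<in> indices n" "\<gamma> = ?E `` {c}" "\<delta> = ?E `` {d}"
        by (auto elim!: quotientE)
      then have "(c, d) \<in> ?E" using eq num ker by metis
      then show "\<gamma> = \<delta>" using cd equiv_class_eq[OF E] by simp
    qed
    have "num ` ?Q = (\<lambda>c. num (?E `` {c})) ` indices n" by (auto simp: quotient_def)
    also have "\<dots> = k ` indices n" by (rule image_cong) (use num in simp_all)
    finally show "num ` ?Q = {..<m}" using onto by simp
  qed
  \<comment> \<open>The product locale asks for sigma-finiteness at every set of indices, which
    fails for \<open>Lambda {}\<close>; outside the quotient, the measure of a one-element class
    takes its place.\<close>
  define M' where "M' \<gamma> = (if \<gamma> \<in> ?Q then Lambda \<gamma> else Lambda {(Bpi, 0)})" for \<gamma>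
  interpret Q: product_sigma_finite M'
  proof (rule product_sigma_finite.intro)
    fix \<gamma>
    show "sigma_finite_measure (M' \<gamma>)"
    proof (cases "\<gamma> \<in> ?Q")
      case True
      then obtain c where "c \<in> \<gamma>" using cls(1) by (auto elim!: quotientE)
      then show ?thesis using True sigma_finite_Lambda by (simp add: M'_def)
    next
      case False
      then show ?thesis using sigma_finite_Lambda[of "(Bpi, 0)" "{(Bpi, 0)}"] by (simp add: M'_def)
    qed
  qed
  let ?g = "\<lambda>s. \<lambda>\<gamma>\<in>?Q. \<lambda>c\<in>\<gamma>. (s (num \<gamma>) :: real)"
  have numlt: "num \<gamma> < m" if "\<gamma> \<in> ?Q" for \<gamma> using bij that by (auto simp: bij_betw_def)
  have gmeas: "?g \<in> (\<Pi>\<^sub>M i\<in>{..<m}. lborel) \<rightarrow>\<^sub>M (\<Pi>\<^sub>M \<gamma>\<in>?Q. M' \<gamma>)"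
  proof (rule measurable_restrict)
    fix \<gamma> assume \<gamma>: "\<gamma> \<in> ?Q"
    have "(\<lambda>s. s (num \<gamma>)) \<in> (\<Pi>\<^sub>M i\<in>{..<m}. lborel) \<rightarrow>\<^sub>M (lborel :: real measure)"
      using numlt[OF \<gamma>] by (intro measurable_component_singleton) simp
    from measurable_compose[OF this measurable_diagonal[of \<gamma>]]
    have "(\<lambda>s. \<lambda>c\<in>\<gamma>. s (num \<gamma>)) \<in> (\<Pi>\<^sub>M i\<in>{..<m}. lborel) \<rightarrow>\<^sub>M (\<Pi>\<^sub>M c\<in>\<gamma>. (lborel :: real measure))" .
    moreover have "sets (M' \<gamma>) = sets (\<Pi>\<^sub>M c\<in>\<gamma>. lborel)" using \<gamma> by (simp add: M'_def)
    ultimately show "(\<lambda>s. \<lambda>c\<in>\<gamma>. s (num \<gamma>)) \<in> (\<Pi>\<^sub>M i\<in>{..<m}. lborel) \<rightarrow>\<^sub>M M' \<gamma>"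
      using measurable_cong_sets[OF refl] by blast
  qed
  \<comment> \<open>It suffices to compare boxes. The preimage of a box is a box of times, whose
    sides are preimages under the diagonal maps.\<close>
  have "distr (\<Pi>\<^sub>M i\<in>{..<m}. lborel) (\<Pi>\<^sub>M \<gamma>\<in>?Q. M' \<gamma>) ?g = (\<Pi>\<^sub>M \<gamma>\<in>?Q. M' \<gamma>)"
  proof (rule Q.PiM_eqI[OF finQ])
    fix A assume A: "\<And>\<gamma>. \<gamma> \<in> ?Q \<Longrightarrow> A \<gamma> \<in> sets (M' \<gamma>)"
    define B where "B \<gamma> = (\<lambda>t. \<lambda>c\<in>\<gamma>. t) -` A \<gamma> \<inter> space (lborel :: real measure)" for \<gamma> :: "index set"
    have B: "B \<gamma> \<in> sets lborel" if "\<gamma> \<in> ?Q" for \<gamma>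
      unfolding B_def using A[OF that] that by (intro measurable_sets[OF measurable_diagonal]) (simp add: M'_def)
    let ?inv = "the_inv_into ?Q num"
    have inv: "?inv (num \<gamma>) = \<gamma>" if "\<gamma> \<in> ?Q" for \<gamma>
      using bij that by (simp add: bij_betw_def the_inv_into_f_f)
    have invQ: "?inv j \<in> ?Q" if "j < m" for j
      using bij that by (metis bij_betw_def lessThan_iff order_refl the_inv_into_into)
    have "?g -` (Pi\<^sub>E ?Q A) \<inter> space (\<Pi>\<^sub>M i\<in>{..<m}. lborel) = (\<Pi>\<^sub>E j\<in>{..<m}. B (?inv j))"
    proof (intro equalityI subsetI)
      fix s assume s: "s \<in> ?g -` (Pi\<^sub>E ?Q A) \<inter> space (\<Pi>\<^sub>M i\<in>{..<m}. lborel)"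
      have "s j \<in> B (?inv j)" if j: "j < m" for j
      proof -
        have "?g s (?inv j) \<in> A (?inv j)" using s invQ[OF j] by (auto simp: PiE_iff)
        moreover have "num (?inv j) = j" using bij j by (simp add: bij_betw_def f_the_inv_into_f)
        ultimately show ?thesis using invQ[OF j] by (simp add: B_def)
      qed
      then show "s \<in> (\<Pi>\<^sub>E j\<in>{..<m}. B (?inv j))" using s by (auto simp: space_PiM PiE_iff)
    next
      fix s assume s: "s \<in> (\<Pi>\<^sub>E j\<in>{..<m}. B (?inv j))"
      have "(\<lambda>c\<in>\<gamma>. s (num \<gamma>)) \<in> A \<gamma>" if \<gamma>: "\<gamma> \<in> ?Q" for \<gamma>
      proof -
        have "s (num \<gamma>) \<in> B (?inv (num \<gamma>))" using s numlt[OF \<gamma>] by (auto simp: PiE_iff)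
        then show ?thesis using inv[OF \<gamma>] by (simp add: B_def)
      qed
      then show "s \<in> ?g -` (Pi\<^sub>E ?Q A) \<inter> space (\<Pi>\<^sub>M i\<in>{..<m}. lborel)"
        using s by (auto simp: space_PiM PiE_iff)
    qed
    moreover have "Pi\<^sub>E ?Q A \<in> sets (\<Pi>\<^sub>M \<gamma>\<in>?Q. M' \<gamma>)" using A finQ by (intro sets_PiM_I_finite) auto
    ultimately have "emeasure (distr (\<Pi>\<^sub>M i\<in>{..<m}. lborel) (\<Pi>\<^sub>M \<gamma>\<in>?Q. M' \<gamma>) ?g) (Pi\<^sub>E ?Q A) =
        emeasure (\<Pi>\<^sub>M i\<in>{..<m}. lborel) (\<Pi>\<^sub>E j\<in>{..<m}. B (?inv j))"
      by (simp add: emeasure_distr[OF gmeas])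
    also have "\<dots> = (\<Prod>j\<in>{..<m}. emeasure lborel (B (?inv j)))"
      using B invQ by (intro lborel_product.emeasure_PiM) auto
    also have "\<dots> = (\<Prod>\<gamma>\<in>?Q. emeasure lborel (B (?inv (num \<gamma>))))"
      by (rule prod.reindex_bij_betw[OF bij, symmetric])
    also have "\<dots> = (\<Prod>\<gamma>\<in>?Q. emeasure (M' \<gamma>) (A \<gamma>))"
    proof (rule prod.cong[OF refl])
      fix \<gamma> assume \<gamma>: "\<gamma> \<in> ?Q"
      have "emeasure (Lambda \<gamma>) (A \<gamma>) = emeasure lborel (B \<gamma>)"
        unfolding Lambda_def B_def using A[OF \<gamma>] \<gamma>
        by (intro emeasure_distr measurable_diagonal) (simp add: M'_def)
      then show "emeasure lborel (B (?inv (num \<gamma>))) = emeasure (M' \<gamma>) (A \<gamma>)"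
        using \<gamma> inv[OF \<gamma>] by (simp add: M'_def)
    qed
    finally show "emeasure (distr (\<Pi>\<^sub>M i\<in>{..<m}. lborel) (\<Pi>\<^sub>M \<gamma>\<in>?Q. M' \<gamma>) ?g) (Pi\<^sub>E ?Q A) =
        (\<Prod>\<gamma>\<in>?Q. emeasure (M' \<gamma>) (A \<gamma>))" .
  qed simp
  moreover have "(\<Pi>\<^sub>M \<gamma>\<in>?Q. M' \<gamma>) = (\<Pi>\<^sub>M \<gamma>\<in>?Q. Lambda \<gamma>)" by (rule PiM_cong) (simp_all add: M'_def)
  ultimately have D: "(\<Pi>\<^sub>M \<gamma>\<in>?Q. Lambda \<gamma>) = distr (\<Pi>\<^sub>M i\<in>{..<m}. lborel) (\<Pi>\<^sub>M \<gamma>\<in>?Q. Lambda \<gamma>) ?g" 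
    and gmeas': "?g \<in> (\<Pi>\<^sub>M i\<in>{..<m}. lborel) \<rightarrow>\<^sub>M (\<Pi>\<^sub>M \<gamma>\<in>?Q. Lambda \<gamma>)"
    using gmeas by simp_all
  let ?h = "\<lambda>s. \<lambda>c\<in>indices n. s (?E `` {c}) c :: real"
  have hmeas: "?h \<in> (\<Pi>\<^sub>M \<gamma>\<in>?Q. Lambda \<gamma>) \<rightarrow>\<^sub>M (\<Pi>\<^sub>M c\<in>indices n. lborel)"
  proof (rule measurable_restrict)
    fix c assume c: "c \<in> indices n"
    have 1: "(\<lambda>s. s (?E `` {c})) \<in> (\<Pi>\<^sub>M \<gamma>\<in>?Q. Lambda \<gamma>) \<rightarrow>\<^sub>M Lambda (?E `` {c})"
      using c by (intro measurable_component_singleton quotientI)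
    have "(\<lambda>x. x c) \<in> (\<Pi>\<^sub>M d\<in>?E `` {c}. lborel) \<rightarrow>\<^sub>M (lborel :: real measure)"
      using cls(1)[OF c] by (rule measurable_component_singleton)
    then have "(\<lambda>x. x c) \<in> Lambda (?E `` {c}) \<rightarrow>\<^sub>M (lborel :: real measure)"
      using measurable_cong_sets[OF sets_Lambda refl] by blast
    from measurable_compose[OF 1 this]
    show "(\<lambda>s. s (?E `` {c}) c) \<in> (\<Pi>\<^sub>M \<gamma>\<in>?Q. Lambda \<gamma>) \<rightarrow>\<^sub>M lborel" .
  qed
  have "?h \<circ> ?g = (\<lambda>s. \<lambda>c\<in>indices n. s (k c))"
    using num cls by (auto simp: fun_eq_iff restrict_def quotientI)
  then show ?thesis
    unfolding matching_measure_def by (subst D) (simp add: distr_distr[OF hmeas gmeas'])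
qed

section \<open>The measure \<open>mm\<close> on block-symmetric functions\<close>

definition block_symmetric :: "((block \<Rightarrow> real list) \<Rightarrow> 'a) \<Rightarrow> bool" where
  "block_symmetric \<Psi> \<longleftrightarrow> (\<forall>\<omega> \<omega>'. (\<forall>b. mset (\<omega> b) = mset (\<omega>' b)) \<longrightarrow> \<Psi> \<omega> = \<Psi> \<omega>')"

text \<open>The order of the points inside a block, here by number, is arbitrary; this is why the
  integrals below are restricted to block-symmetric functions.\<close>

definition arrange :: "nat \<Rightarrow> (nat \<Rightarrow> block set) \<Rightarrow> (nat \<Rightarrow> real) \<Rightarrow> block \<Rightarrow> real list" where
  "arrange m \<kappa> s b = map s (filter (\<lambda>j. b \<in> \<kappa> j) [0..<m])"

abbreviation points :: "nat \<Rightarrow> (nat \<Rightarrow> real) measure" where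
  "points m \<equiv> \<Pi>\<^sub>M i\<in>{..<m}. lborel"

lemma block_symmetricD: "block_symmetric \<Psi> \<Longrightarrow> (\<And>b. mset (\<omega> b) = mset (\<omega>' b)) \<Longrightarrow> \<Psi> \<omega> = \<Psi> \<omega>'"
  unfolding block_symmetric_def by blast

lemma mset_arrange: "mset (arrange m \<kappa> s b) = image_mset s (mset_set {j. j < m \<and> b \<in> \<kappa> j})"
proof -
  have "{j. j < m \<and> b \<in> \<kappa> j} = {j \<in> {0..<m}. b \<in> \<kappa> j}" by auto
  then show ?thesis by (simp add: arrange_def mset_filter del: mset_upt add: mset_upt)
qed

lemma measurable_arrange [measurable]: "arrange m \<kappa> \<in> points m \<rightarrow>\<^sub>M blocks_borel"
proof (rule measurable_PiM_single')
  fix b :: block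
  let ?L = "filter (\<lambda>j. b \<in> \<kappa> j) [0..<m]"
  have eq: "arrange m \<kappa> s b = map (\<lambda>i. s (?L ! i)) [0..<length ?L]" for s
    by (rule nth_equalityI) (simp_all add: arrange_def)
  show "(\<lambda>s. arrange m \<kappa> s b) \<in> points m \<rightarrow>\<^sub>M config_borel"
    unfolding eq
  proof (rule measurable_config_list)
    fix i assume "i < length ?L"
    then have "?L ! i \<in> set ?L" by (rule nth_mem)
    then show "(\<lambda>s. s (?L ! i)) \<in> borel_measurable (points m)" by simp
  qed
qed simp

lemma nn_integral_count_space_single:
  "(\<integral>\<^sup>+ n. (if n = a then c else 0) \<partial>count_space UNIV) = (c :: ennreal)"
proof -
  have "(\<integral>\<^sup>+ n. (if n = a then c else 0) \<partial>count_space UNIV) = (\<integral>\<^sup>+ n. c * indicator {a} n \<partial>count_space UNIV)"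
    by (intro nn_integral_cong) (auto split: split_indicator)
  then show ?thesis by (simp add: nn_integral_cmult_indicator)
qed

lemma nn_integral_count_space_Sigma_finite:
  assumes "\<And>n. finite (B n)"
  shows "(\<integral>\<^sup>+ p. f p \<partial>count_space (Sigma UNIV B)) = (\<integral>\<^sup>+ n. (\<Sum>y\<in>B n. f (n, y)) \<partial>count_space UNIV)"
proof -
  have "(\<integral>\<^sup>+ p. f p \<partial>count_space (Sigma UNIV B)) = (\<integral>\<^sup>+ p. f p * indicator (Sigma UNIV B) p \<partial>count_space UNIV)"
    by (rule nn_integral_count_space_indicator) simp
  also have "\<dots> = (\<integral>\<^sup>+ n. \<integral>\<^sup>+ y. f (n, y) * indicator (Sigma UNIV B) (n, y) \<partial>count_space UNIV \<partial>count_space UNIV)"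
    by (rule nn_integral_fst_count_space[symmetric])
  also have "\<dots> = (\<integral>\<^sup>+ n. \<integral>\<^sup>+ y. f (n, y) \<partial>count_space (B n) \<partial>count_space UNIV)"
  proof (rule nn_integral_cong)
    fix n
    have "(\<integral>\<^sup>+ y. f (n, y) * indicator (Sigma UNIV B) (n, y) \<partial>count_space UNIV) =
      (\<integral>\<^sup>+ y. f (n, y) * indicator (B n) y \<partial>count_space UNIV)"
      by (intro nn_integral_cong) (auto split: split_indicator)
    also have "\<dots> = (\<integral>\<^sup>+ y. f (n, y) \<partial>count_space (B n))"
      by (rule nn_integral_count_space_indicator[symmetric]) simp
    finally show "(\<integral>\<^sup>+ y. f (n, y) * indicator (Sigma UNIV B) (n, y) \<partial>count_space UNIV) =
      (\<integral>\<^sup>+ y. f (n, y) \<partial>count_space (B n))" .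
  qed
  also have "\<dots> = (\<integral>\<^sup>+ n. (\<Sum>y\<in>B n. f (n, y)) \<partial>count_space UNIV)"
    by (intro nn_integral_cong nn_integral_count_space_finite assms)
  finally show ?thesis .
qed

lemma finite_chain_types [simp]: "finite chain_types"
  by (simp add: chain_types_def)

lemma finite_colourings [simp]: "finite (colourings m)"
  by (intro finite_PiE) simp_all

lemma ennreal_inverse_fact: "ennreal (1 / fact m) * (of_nat (fact m) * c) = c"
proof -
  have "ennreal (1 / fact m) * of_nat (fact m) = ennreal (1 / fact m) * ennreal (fact m)"
    by (simp add: ennreal_of_nat_eq_real_of_nat)
  also have "\<dots> = 1" by (simp add: ennreal_mult[symmetric])
  finally show ?thesis by (simp flip: mult.assoc)
qed

lemma ennreal_inverse_prod_fact:
  fixes n :: "block \<Rightarrow> nat"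
  shows "ennreal (1 / (\<Prod>b\<in>UNIV. fact (n b))) * (of_nat (\<Prod>b\<in>UNIV. fact (n b)) * c) = c"
proof -
  have "of_nat (\<Prod>b\<in>UNIV. fact (n b)) = ennreal (\<Prod>b\<in>UNIV. fact (n b))"
    by (simp only: ennreal_of_nat_eq_real_of_nat of_nat_prod of_nat_fact)
  moreover have "0 < (\<Prod>b\<in>UNIV. fact (n b) :: real)" by (intro prod_pos) simp
  ultimately have "ennreal (1 / (\<Prod>b\<in>UNIV. fact (n b))) * of_nat (\<Prod>b\<in>UNIV. fact (n b)) = 1"
    by (simp only: ennreal_mult[symmetric] divide_nonneg_nonneg less_imp_le zero_le_one) simp
  then show ?thesis by (simp flip: mult.assoc)
qed

lemma sets_matching_measure [simp]: "sets (matching_measure n \<pp>) = sets (\<Pi>\<^sub>M c\<in>indices n. lborel)"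
  by (simp add: matching_measure_def)

lemma measurable_assemble_matching:
  "assemble n \<in> matching_measure n \<pp> \<rightarrow>\<^sub>M blocks_borel"
proof -
  have "assemble n \<in> (\<Pi>\<^sub>M c\<in>indices n. lborel) \<rightarrow>\<^sub>M blocks_borel"
    by (rule measurable_assemble) simp
  then show ?thesis using measurable_cong_sets[OF sets_matching_measure refl] by blast
qed

lemma mm_eq: "mm = sum_measure (SIGMA n:UNIV. matchings n) blocks_borel
     (\<lambda>(n, \<pp>). scale_measure (ennreal (1 / (\<Prod>b\<in>UNIV. fact (n b))))
        (distr (matching_measure n \<pp>) blocks_borel (assemble n)))"
  unfolding mm_def assemble_def[abs_def] ..

lemma sets_mm [simp, measurable_cong]: "sets mm = sets blocks_borel"
  unfolding mm_eq by (rule sets_sum_measure) auto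

lemma space_mm [simp]: "space mm = UNIV"
  using sets_eq_imp_space_eq[OF sets_mm] by simp

lemma nn_integral_mm_matchings:
  assumes [measurable]: "\<Psi> \<in> borel_measurable blocks_borel"
  shows "(\<integral>\<^sup>+ \<omega>. \<Psi> \<omega> \<partial>mm) = (\<integral>\<^sup>+ n. (\<Sum>\<pp>\<in>matchings n. ennreal (1 / (\<Prod>b\<in>UNIV. fact (n b))) *
     (\<integral>\<^sup>+ t. \<Psi> (assemble n t) \<partial>matching_measure n \<pp>)) \<partial>count_space UNIV)"
proof -
  have "(\<integral>\<^sup>+ \<omega>. \<Psi> \<omega> \<partial>mm) = (\<integral>\<^sup>+ (n, \<pp>). ennreal (1 / (\<Prod>b\<in>UNIV. fact (n b))) *
     (\<integral>\<^sup>+ t. \<Psi> (assemble n t) \<partial>matching_measure n \<pp>) \<partial>count_space (SIGMA n:UNIV. matchings n))"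
    unfolding mm_eq
    by (subst nn_integral_sum_measure)
      (auto simp: nn_integral_scale_measure nn_integral_distr[OF measurable_assemble_matching]
        intro!: nn_integral_cong)
  also have "\<dots> = (\<integral>\<^sup>+ n. (\<Sum>\<pp>\<in>matchings n. ennreal (1 / (\<Prod>b\<in>UNIV. fact (n b))) *
     (\<integral>\<^sup>+ t. \<Psi> (assemble n t) \<partial>matching_measure n \<pp>)) \<partial>count_space UNIV)"
    by (subst nn_integral_count_space_Sigma_finite[OF finite_matchings]) simp
  finally show ?thesis .
qed

text \<open>Each block receives the same times, whether they are read index by index or collected
  from the classes that meet it. Only their order differs, which a block-symmetric function
  ignores.\<close>

lemma nn_integral_matching_measure:
  assumes meas: "\<Psi> \<in> borel_measurable blocks_borel" and sym: "block_symmetric \<Psi>"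
    and pp: "\<pp> \<in> matchings n" and k: "k \<in> numbers_classes n \<pp> m"
  shows "(\<integral>\<^sup>+ t. \<Psi> (assemble n t) \<partial>matching_measure n \<pp>) =
    (\<integral>\<^sup>+ s. \<Psi> (arrange m (restrict (block_class n k) {..<m}) s) \<partial>points m)"
proof -
  have kN: "k \<in> numberings n m" by (rule matching_class_structure(1)[OF pp k])
  then have kin: "k \<in> indices n \<rightarrow>\<^sub>E {..<m}" unfolding numberings_def by simp
  let ?\<kappa> = "restrict (block_class n k) {..<m}"
  have bij: "bij_betw (\<lambda>i. k (b, i)) {..<n b} {j. j < m \<and> b \<in> ?\<kappa> j}" for b
    using block_class_eq_iff[OF kin, of ?\<kappa>] kN unfolding numberings_def by simp
  have r: "(\<lambda>s. \<lambda>c\<in>indices n. s (k c)) \<in> points m \<rightarrow>\<^sub>M (\<Pi>\<^sub>M c\<in>indices n. (lborel :: real measure))"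
    using kin by (intro measurable_restrict measurable_component_singleton) auto
  have a: "assemble n \<in> (\<Pi>\<^sub>M c\<in>indices n. lborel) \<rightarrow>\<^sub>M blocks_borel"
    by (rule measurable_assemble) simp
  have "(\<integral>\<^sup>+ t. \<Psi> (assemble n t) \<partial>matching_measure n \<pp>) =
    (\<integral>\<^sup>+ s. \<Psi> (assemble n (\<lambda>c\<in>indices n. s (k c))) \<partial>points m)"
    unfolding matching_measure_eq[OF k]
    by (rule nn_integral_distr[OF r]) (subst measurable_distr_eq1, rule measurable_compose[OF a meas])
  also have "\<dots> = (\<integral>\<^sup>+ s. \<Psi> (arrange m ?\<kappa> s) \<partial>points m)"
  proof (intro nn_integral_cong block_symmetricD[OF sym])
    fix s b
    have "mset (assemble n (\<lambda>c\<in>indices n. s (k c)) b) = image_mset (\<lambda>i. s (k (b, i))) (mset_set {..<n b})"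
    proof -
      have "assemble n (\<lambda>c\<in>indices n. s (k c)) b = map (\<lambda>i. s (k (b, i))) [0..<n b]"
        by (simp add: assemble_def indices_def)
      then show ?thesis by (simp add: lessThan_atLeast0 flip: mset_upt)
    qed
    also have "\<dots> = image_mset s (image_mset (\<lambda>i. k (b, i)) (mset_set {..<n b}))"
      by (simp add: image_mset.compositionality comp_def)
    also have "\<dots> = image_mset s (mset_set {j. j < m \<and> b \<in> ?\<kappa> j})"
      using bij[of b] by (simp add: bij_betw_def image_mset_mset_set)
    finally show "mset (assemble n (\<lambda>c\<in>indices n. s (k c)) b) = mset (arrange m ?\<kappa> s b)"
      by (simp only: mset_arrange)
  qed
  finally show ?thesis .
qed

text \<open>On block-symmetric functions, \<open>mm\<close> is the Lebesgue-Poisson measure of point configurations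
  whose points are marked by chain types.\<close>

theorem nn_integral_mm:
  assumes meas: "\<Psi> \<in> borel_measurable blocks_borel" and sym: "block_symmetric \<Psi>"
  shows "(\<integral>\<^sup>+ \<omega>. \<Psi> \<omega> \<partial>mm) = (\<integral>\<^sup>+ m. ennreal (1 / fact m) *
    (\<Sum>\<kappa>\<in>colourings m. \<integral>\<^sup>+ s. \<Psi> (arrange m \<kappa> s) \<partial>points m) \<partial>count_space UNIV)"
proof -
  define Y where "Y m \<kappa> = (\<integral>\<^sup>+ s. \<Psi> (arrange m \<kappa> s) \<partial>points m)" for m \<kappa>
  define X where "X n \<pp> = (\<integral>\<^sup>+ t. \<Psi> (assemble n t) \<partial>matching_measure n \<pp>)" for n \<pp>
  define w :: "(block \<Rightarrow> nat) \<Rightarrow> ennreal" where "w n = ennreal (1 / (\<Prod>b\<in>UNIV. fact (n b)))" for n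
  let ?r = "\<lambda>n m k. restrict (block_class n k) {..<m::nat}"
  \<comment> \<open>Averaging over the m! numberings does not change the integral, and only m equal
    to the number of classes admits numberings. Thus m becomes a summation variable independent of
    the block sizes.\<close>
  have X: "X n \<pp> = (\<integral>\<^sup>+ m. ennreal (1 / fact m) * (\<Sum>k\<in>numbers_classes n \<pp> m. Y m (?r n m k)) \<partial>count_space UNIV)"
    if pp: "\<pp> \<in> matchings n" for n \<pp>
  proof -
    have "ennreal (1 / fact m) * (\<Sum>k\<in>numbers_classes n \<pp> m. Y m (?r n m k)) =
      (if m = card (indices n // match_equiv n \<pp>) then X n \<pp> else 0)" for m
    proof -
      have "(\<Sum>k\<in>numbers_classes n \<pp> m. Y m (?r n m k)) = (\<Sum>k\<in>numbers_classes n \<pp> m. X n \<pp>)"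
        by (intro sum.cong refl) (simp add: X_def Y_def nn_integral_matching_measure[OF meas sym pp])
      also have "\<dots> = of_nat (card (numbers_classes n \<pp> m)) * X n \<pp>" by simp
      finally show ?thesis
        unfolding card_numbers_classes by (simp add: ennreal_inverse_fact del: of_nat_fact)
    qed
    then show ?thesis by (simp add: nn_integral_count_space_single)
  qed
  have Nsum: "(\<Sum>k\<in>numberings n m. Y m (?r n m k)) =
     (\<Sum>\<kappa>\<in>colourings m. of_nat (card {k \<in> numberings n m. ?r n m k = \<kappa>}) * Y m \<kappa>)" for n m
  proof -
    have "finite (numberings n m)"
      by (rule finite_subset[of _ "indices n \<rightarrow>\<^sub>E {..<m}"]) (auto simp: numberings_def intro!: finite_PiE)
    then have "(\<Sum>k\<in>numberings n m. Y m (?r n m k)) =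
      (\<Sum>\<kappa>\<in>colourings m. \<Sum>k\<in>{k \<in> numberings n m. ?r n m k = \<kappa>}. Y m (?r n m k))"
      by (intro sum.group[symmetric]) (auto simp: numberings_def)
    also have "\<dots> = (\<Sum>\<kappa>\<in>colourings m. \<Sum>k\<in>{k \<in> numberings n m. ?r n m k = \<kappa>}. Y m \<kappa>)"
      by (intro sum.cong refl) auto
    finally show ?thesis by simp
  qed
  \<comment> \<open>A colouring fixes the block sizes, and the number of numberings inducing it
    cancels the weight of \<open>mm\<close>.\<close>
  have wsum: "w n * (\<Sum>k\<in>numberings n m. Y m (?r n m k)) =
     (\<Sum>\<kappa>\<in>colourings m. if n = block_sizes m \<kappa> then Y m \<kappa> else 0)" for n m
    unfolding Nsum sum_distrib_left
  proof (intro sum.cong refl)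
    fix \<kappa> assume \<kappa>: "\<kappa> \<in> colourings m"
    show "w n * (of_nat (card {k \<in> numberings n m. ?r n m k = \<kappa>}) * Y m \<kappa>) =
      (if n = block_sizes m \<kappa> then Y m \<kappa> else 0)"
      unfolding card_numberings_of_colouring[OF \<kappa>] w_def
      by (cases "n = block_sizes m \<kappa>") (simp_all only: if_True if_False refl ennreal_inverse_prod_fact, simp)
  qed
  have "(\<integral>\<^sup>+ \<omega>. \<Psi> \<omega> \<partial>mm) = (\<integral>\<^sup>+ n. (\<Sum>\<pp>\<in>matchings n. w n * X n \<pp>) \<partial>count_space UNIV)"
    unfolding nn_integral_mm_matchings[OF meas] w_def X_def ..
  also have "\<dots> = (\<integral>\<^sup>+ n. \<integral>\<^sup>+ m. w n * (\<Sum>\<pp>\<in>matchings n. ennreal (1 / fact m) *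
      (\<Sum>k\<in>numbers_classes n \<pp> m. Y m (?r n m k))) \<partial>count_space UNIV \<partial>count_space UNIV)"
  proof (rule nn_integral_cong)
    fix n
    have "(\<Sum>\<pp>\<in>matchings n. w n * X n \<pp>) = w n * (\<Sum>\<pp>\<in>matchings n. X n \<pp>)"
      by (simp add: sum_distrib_left)
    also have "(\<Sum>\<pp>\<in>matchings n. X n \<pp>) = (\<integral>\<^sup>+ m. (\<Sum>\<pp>\<in>matchings n. ennreal (1 / fact m) *
      (\<Sum>k\<in>numbers_classes n \<pp> m. Y m (?r n m k))) \<partial>count_space UNIV)"
      by (subst nn_integral_sum) (simp_all add: X)
    finally show "(\<Sum>\<pp>\<in>matchings n. w n * X n \<pp>) = (\<integral>\<^sup>+ m. w n * (\<Sum>\<pp>\<in>matchings n. ennreal (1 / fact m) *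
      (\<Sum>k\<in>numbers_classes n \<pp> m. Y m (?r n m k))) \<partial>count_space UNIV)"
      by (simp add: nn_integral_cmult)
  qed
  also have "\<dots> = (\<integral>\<^sup>+ n. \<integral>\<^sup>+ m. ennreal (1 / fact m) * (w n * (\<Sum>k\<in>numberings n m. Y m (?r n m k)))
      \<partial>count_space UNIV \<partial>count_space UNIV)"
    unfolding sum_distrib_left[symmetric] sum_matchings_numbers_classes
    by (intro nn_integral_cong) (rule mult.left_commute)
  \<comment> \<open>In the exchanged order, the sum over block sizes has one possible nonzero term
    for each colouring.\<close>
  also have "\<dots> = (\<integral>\<^sup>+ m. \<integral>\<^sup>+ n. ennreal (1 / fact m) * (w n * (\<Sum>k\<in>numberings n m. Y m (?r n m k)))
      \<partial>count_space UNIV \<partial>count_space UNIV)"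
    by (rule nn_integral_count_space_nn_integral) simp_all
  also have "\<dots> = (\<integral>\<^sup>+ m. ennreal (1 / fact m) * (\<Sum>\<kappa>\<in>colourings m. Y m \<kappa>) \<partial>count_space UNIV)"
    unfolding wsum
    by (simp add: nn_integral_cmult nn_integral_sum nn_integral_count_space_single)
  finally show ?thesis unfolding Y_def .
qed

text \<open>Applied to the indicator of the exceptional set, \<open>nn_integral_mm\<close> reduces
  null sets of \<open>mm\<close> to Lebesgue null sets, one for each colouring.\<close>

lemma AE_mm:
  assumes meas: "{\<omega> \<in> space blocks_borel. P \<omega>} \<in> sets blocks_borel" and sym: "block_symmetric P"
    and ae: "\<And>m \<kappa>. \<kappa> \<in> colourings m \<Longrightarrow> AE s in points m. P (arrange m \<kappa> s)"
  shows "AE \<omega> in mm. P \<omega>"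
proof -
  let ?I = "indicator {\<omega>. \<not> P \<omega>} :: _ \<Rightarrow> ennreal"
  have S: "{\<omega>. \<not> P \<omega>} \<in> sets blocks_borel"
    using sets.compl_sets[OF meas] by (simp add: Collect_neg_eq Compl_eq_Diff_UNIV)
  have "(\<integral>\<^sup>+ \<omega>. ?I \<omega> \<partial>mm) = 0"
  proof -
    have "(\<integral>\<^sup>+ s. ?I (arrange m \<kappa> s) \<partial>points m) = 0" if "\<kappa> \<in> colourings m" for m \<kappa>
    proof -
      have "(\<integral>\<^sup>+ s. ?I (arrange m \<kappa> s) \<partial>points m) = (\<integral>\<^sup>+ s. 0 \<partial>points m)"
        using ae[OF that] by (intro nn_integral_cong_AE) (auto elim!: eventually_mono)
      then show ?thesis by simp
    qed
    moreover have "block_symmetric ?I"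
      unfolding block_symmetric_def
    proof (intro allI impI)
      fix \<omega> \<omega>' :: "block \<Rightarrow> real list" assume "\<forall>b. mset (\<omega> b) = mset (\<omega>' b)"
      then have "P \<omega> = P \<omega>'" by (intro block_symmetricD[OF sym]) simp
      then show "?I \<omega> = ?I \<omega>'" by (simp add: indicator_def)
    qed
    ultimately show ?thesis using S by (subst nn_integral_mm) simp_all
  qed
  then have "emeasure mm {\<omega>. \<not> P \<omega>} = 0" using S by simp
  then show ?thesis using S by (intro AE_I[of _ _ "{\<omega>. \<not> P \<omega>}"]) auto
qed

section \<open>Generic configurations\<close>

abbreviation time_blocks_borel :: "(real \<times> (block \<Rightarrow> real list)) measure" where
  "time_blocks_borel \<equiv> borel \<Otimes>\<^sub>M blocks_borel"

definition all_points :: "(block \<Rightarrow> real list) \<Rightarrow> real list" where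
  "all_points \<omega> = \<omega> Bpi @ \<omega> Bupsilon1 @ \<omega> Bupsilon2"

lemma mset_all_points_cong:
  "(\<And>b. mset (\<omega> b) = mset (\<omega>' b)) \<Longrightarrow> mset (all_points \<omega>) = mset (all_points \<omega>')"
  by (simp add: all_points_def)

text \<open>Every chain starts in exactly one of the blocks \<open>Bpi\<close>, \<open>Bupsilon1\<close>, \<open>Bupsilon2\<close>.\<close>

lemma mset_all_points_arrange:
  assumes \<kappa>: "\<kappa> \<in> colourings m"
  shows "mset (all_points (arrange m \<kappa> s)) = image_mset s (mset_set {..<m})"
proof -
  let ?J = "\<lambda>b. {j. j < m \<and> b \<in> \<kappa> j}"
  have ch: "\<kappa> j \<in> chain_types" if "j < m" for j using \<kappa> that by auto
  have "(Bpi \<in> c \<or> Bupsilon1 \<in> c \<or> Bupsilon2 \<in> c) \<and> \<not> (Bpi \<in> c \<and> Bupsilon1 \<in> c) \<and>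
      \<not> (Bpi \<in> c \<and> Bupsilon2 \<in> c) \<and> \<not> (Bupsilon1 \<in> c \<and> Bupsilon2 \<in> c)" if "c \<in> chain_types" for c
    using that by (auto simp: chain_types_def)
  then have "{..<m} = ?J Bpi \<union> (?J Bupsilon1 \<union> ?J Bupsilon2)" "?J Bpi \<inter> (?J Bupsilon1 \<union> ?J Bupsilon2) = {}"
      "?J Bupsilon1 \<inter> ?J Bupsilon2 = {}"
    using ch by blast+
  then have "mset_set {..<m} = mset_set (?J Bpi) + (mset_set (?J Bupsilon1) + mset_set (?J Bupsilon2))"
    by (simp add: mset_set_Union)
  then show ?thesis by (simp add: all_points_def mset_arrange)
qed

lemma sum_list_all_points_arrange:
  assumes \<kappa>: "\<kappa> \<in> colourings m"
  shows "(\<Sum>p\<leftarrow>all_points (arrange m \<kappa> s). h p) = (\<Sum>j<m. h (s j) :: 'a::comm_monoid_add)"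
proof -
  have "(\<Sum>p\<leftarrow>all_points (arrange m \<kappa> s). h p) = sum_mset (image_mset h (mset (all_points (arrange m \<kappa> s))))"
    by (metis mset_map sum_mset_sum_list)
  also have "\<dots> = (\<Sum>j<m. h (s j))"
    unfolding mset_all_points_arrange[OF \<kappa>]
    by (simp add: image_mset.compositionality sum_unfold_sum_mset comp_def)
  finally show ?thesis .
qed

lemma sum_list_cong_mset:
  assumes "mset xs = mset ys"
  shows "(\<Sum>p\<leftarrow>xs. h p) = (\<Sum>p\<leftarrow>ys. h p :: 'a::comm_monoid_add)"
  using assms by (metis mset_map sum_mset_sum_list)

text \<open>Integrate over coordinate i first: as c does not depend on it, the exceptional set has
  sections of at most one point.\<close>

lemma AE_points_neq:
  assumes i: "i < m" and c [measurable]: "c \<in> borel_measurable (points m)"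
    and indep: "\<And>s y. c (s(i := y)) = c s"
  shows "AE s in points m. s i \<noteq> c s"
proof -
  let ?I = "{..<m} - {i}"
  have ins: "insert i ?I = {..<m}" using i by auto
  have [measurable]: "(\<lambda>s. s i) \<in> borel_measurable (points m)" using i by simp
  have m [measurable]: "{s \<in> space (points m). s i = c s} \<in> sets (points m)" by measurable
  have "emeasure (points m) {s \<in> space (points m). s i = c s} =
    (\<integral>\<^sup>+ s. indicator {s \<in> space (points m). s i = c s} s \<partial>points m)" using m by simp
  also have "\<dots> = (\<integral>\<^sup>+ s. (\<integral>\<^sup>+ y. indicator {s \<in> space (points m). s i = c s} (s(i := y)) \<partial>lborel)
      \<partial>(\<Pi>\<^sub>M i\<in>?I. lborel))"
    using lborel_product.product_nn_integral_insert[of ?I i "indicator {s \<in> space (points m). s i = c s}"]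
    unfolding ins by simp
  also have "\<dots> \<le> (\<integral>\<^sup>+ s. (\<integral>\<^sup>+ y. indicator {c s} y \<partial>lborel) \<partial>(\<Pi>\<^sub>M i\<in>?I. lborel))"
    by (intro nn_integral_mono) (auto simp: indep split: split_indicator)
  also have "\<dots> = 0" by simp
  finally have "emeasure (points m) {s \<in> space (points m). s i = c s} = 0" by simp
  then show ?thesis using m by (intro AE_I[of _ _ "{s \<in> space (points m). s i = c s}"]) auto
qed

lemma AE_points_neq_const: "i < m \<Longrightarrow> AE s in points m. s i \<noteq> t"
  by (rule AE_points_neq) simp_all

lemma AE_points_inj: "AE s in points m. inj_on s {..<m}"
proof -
  have "AE s in points m. s i \<noteq> s j" if "i \<in> {..<m}" "j \<in> {..<m} - {i}" for i j
    using that by (intro AE_points_neq) simp_all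
  then have "AE s in points m. \<forall>i\<in>{..<m}. \<forall>j\<in>{..<m} - {i}. s i \<noteq> s j"
    by (intro AE_finite_allI) simp_all
  then show ?thesis by eventually_elim (auto simp: inj_on_def)
qed

text \<open>Times are shared along a chain between the kernels and the vectors, but not within one
  kernel; hence the separate distinctness conditions. The last clause confines the times at which
  the integrand can be irregular to \<open>all_points\<close>.\<close>

definition generic :: "(block \<Rightarrow> real list) \<Rightarrow> bool" where
  "generic \<omega> \<longleftrightarrow> distinct (\<omega> Bsigma1 @ \<omega> Btau1 @ \<omega> Bupsilon1) \<and>
     distinct (\<omega> Bsigma2 @ \<omega> Btau2 @ \<omega> Bupsilon2) \<and> distinct (all_points \<omega>) \<and>
     (\<forall>b. set (\<omega> b) \<subseteq> set (all_points \<omega>))"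

lemma generic_cong:
  assumes "\<And>b. mset (\<omega> b) = mset (\<omega>' b)"
  shows "generic \<omega> = generic \<omega>'"
proof -
  have "mset (\<omega> Bsigma1 @ \<omega> Btau1 @ \<omega> Bupsilon1) = mset (\<omega>' Bsigma1 @ \<omega>' Btau1 @ \<omega>' Bupsilon1)"
    "mset (\<omega> Bsigma2 @ \<omega> Btau2 @ \<omega> Bupsilon2) = mset (\<omega>' Bsigma2 @ \<omega>' Btau2 @ \<omega>' Bupsilon2)"
    using assms by simp_all
  then show ?thesis
    unfolding generic_def using mset_all_points_cong[of \<omega> \<omega>', OF assms] assms
    by (metis mset_eq_imp_distinct_iff mset_eq_setD)
qed

lemma measurable_generic: "{\<omega> \<in> space blocks_borel. generic \<omega>} \<in> sets blocks_borel"
proof -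
  have 1: "Measurable.pred blocks_borel (\<lambda>\<omega>. distinct (concat (map \<omega> bs)))" for bs
    unfolding pred_def by (rule measurable_distinct_blocks)
  have 2: "Measurable.pred blocks_borel (\<lambda>\<omega>. \<forall>b. set (\<omega> b) \<subseteq> set (all_points \<omega>))"
  proof (rule measurable_by_strata')
    fix n
    let ?S = "{d \<in> indices n. fst d \<in> {Bpi, Bupsilon1, Bupsilon2}}"
    have eq: "(\<forall>b. set (assemble n r b) \<subseteq> set (all_points (assemble n r))) \<longleftrightarrow>
        (\<forall>c\<in>indices n. \<exists>d\<in>?S. r c = r d)" for r
    proof -
      have "set (all_points (assemble n r)) = r ` ?S"
        by (auto simp: all_points_def assemble_def indices_def)
      moreover have "(\<forall>b. set (assemble n r b) \<subseteq> T) \<longleftrightarrow> (\<forall>c\<in>indices n. r c \<in> T)" for T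
        by (fastforce simp: assemble_def indices_def)
      ultimately show ?thesis by (simp only: image_iff)
    qed
    note pred_index_eq[measurable]
    show "Measurable.pred borel (\<lambda>r. \<forall>b. set (assemble n r b) \<subseteq> set (all_points (assemble n r)))"
      unfolding eq by (intro pred_intros_finite) (simp_all, measurable)
  qed
  have "generic \<omega> \<longleftrightarrow> distinct (concat (map \<omega> [Bsigma1, Btau1, Bupsilon1])) \<and>
      distinct (concat (map \<omega> [Bsigma2, Btau2, Bupsilon2])) \<and>
      distinct (concat (map \<omega> [Bpi, Bupsilon1, Bupsilon2])) \<and> (\<forall>b. set (\<omega> b) \<subseteq> set (all_points \<omega>))" for \<omega>
    by (simp add: generic_def all_points_def)
  then have eq: "generic = (\<lambda>\<omega>. distinct (concat (map \<omega> [Bsigma1, Btau1, Bupsilon1])) \<and>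
      distinct (concat (map \<omega> [Bsigma2, Btau2, Bupsilon2])) \<and>
      distinct (concat (map \<omega> [Bpi, Bupsilon1, Bupsilon2])) \<and> (\<forall>b. set (\<omega> b) \<subseteq> set (all_points \<omega>)))"
    by (rule ext)
  have "Measurable.pred blocks_borel generic"
    unfolding eq by (intro pred_intros_logic 1 2)
  then show ?thesis unfolding pred_def .
qed

text \<open>The blocks of one kernel have the same level, so no chain type contains two of them; nor
  does it contain two starting blocks. Distinct times of the points then give distinct
  entries.\<close>

lemma generic_arrange:
  assumes \<kappa>: "\<kappa> \<in> colourings m" and s: "inj_on s {..<m}"
  shows "generic (arrange m \<kappa> s)"
proof -
  have ch: "\<kappa> j \<in> chain_types" if "j < m" for j using \<kappa> that by auto
  have dist: "distinct (arrange m \<kappa> s b1 @ arrange m \<kappa> s b2 @ arrange m \<kappa> s b3)"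
    if "\<And>c. c \<in> chain_types \<Longrightarrow> \<not> (b1 \<in> c \<and> b2 \<in> c) \<and> \<not> (b1 \<in> c \<and> b3 \<in> c) \<and> \<not> (b2 \<in> c \<and> b3 \<in> c)"
    for b1 b2 b3
  proof -
    let ?L = "filter (\<lambda>j. b1 \<in> \<kappa> j) [0..<m] @ filter (\<lambda>j. b2 \<in> \<kappa> j) [0..<m] @ filter (\<lambda>j. b3 \<in> \<kappa> j) [0..<m]"
    have "distinct ?L" using that ch by auto
    moreover have "inj_on s (set ?L)" by (rule inj_on_subset[OF s]) auto
    ultimately have "distinct (map s ?L)" by (simp only: distinct_map)
    then show ?thesis by (simp add: arrange_def)
  qed
  have set: "set (all_points (arrange m \<kappa> s)) = s ` {..<m}"
    using arg_cong[OF mset_all_points_arrange[OF \<kappa>, of s], of set_mset] by simp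
  show ?thesis
    unfolding generic_def
  proof (intro conjI allI)
    show "distinct (arrange m \<kappa> s Bsigma1 @ arrange m \<kappa> s Btau1 @ arrange m \<kappa> s Bupsilon1)"
      by (rule dist) (auto simp: chain_types_def)
    show "distinct (arrange m \<kappa> s Bsigma2 @ arrange m \<kappa> s Btau2 @ arrange m \<kappa> s Bupsilon2)"
      by (rule dist) (auto simp: chain_types_def)
    show "distinct (all_points (arrange m \<kappa> s))"
      unfolding all_points_def by (rule dist) (auto simp: chain_types_def)
    show "set (arrange m \<kappa> s b) \<subseteq> set (all_points (arrange m \<kappa> s))" for b
      unfolding set by (auto simp: arrange_def)
  qed
qed

lemma AE_mm_generic: "AE \<omega> in mm. generic \<omega>"
proof (rule AE_mm[OF measurable_generic])
  show "block_symmetric generic" unfolding block_symmetric_def using generic_cong by blast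
  show "AE s in points m. generic (arrange m \<kappa> s)" if "\<kappa> \<in> colourings m" for m \<kappa>
    using AE_points_inj by eventually_elim (rule generic_arrange[OF that])
qed

lemma measurable_notin_blocks:
  "{p \<in> space (time_blocks_borel). fst p \<notin> set (concat (map (snd p) bs))} \<in> sets (time_blocks_borel)"
proof -
  have "(\<lambda>(t, \<omega>). t \<notin> set (concat (map \<omega> bs))) \<in> time_blocks_borel \<rightarrow>\<^sub>M count_space UNIV"
  proof (rule measurable_by_strata)
    fix n
    let ?S = "{d \<in> indices n. fst d \<in> set bs}"
    have "set (concat (map (assemble n r) bs)) = r ` ?S" for r
      by (auto simp: assemble_def indices_def)
    then have eq: "t \<notin> set (concat (map (assemble n r) bs)) \<longleftrightarrow> (\<forall>d\<in>?S. t \<noteq> r d)" for r t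
      by (simp only: image_iff) blast
    have pd: "Measurable.pred (borel \<Otimes>\<^sub>M borel) (\<lambda>p::real \<times> (index \<Rightarrow> real). fst p \<noteq> snd p d)" for d
    proof -
      have [measurable]: "(\<lambda>p::real \<times> (index \<Rightarrow> real). snd p d) \<in> borel_measurable (borel \<Otimes>\<^sub>M borel)"
        by (rule measurable_compose[OF measurable_snd measurable_index])
      show ?thesis by measurable
    qed
    show "(\<lambda>(t, r). t \<notin> set (concat (map (assemble n r) bs))) \<in> borel \<Otimes>\<^sub>M borel \<rightarrow>\<^sub>M count_space UNIV"
      unfolding eq case_prod_beta by (intro pred_intros_finite pd) simp
  qed
  then show ?thesis unfolding pred_def case_prod_beta .
qed

lemma all_points_concat: "all_points \<omega> = concat (map \<omega> [Bpi, Bupsilon1, Bupsilon2])"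
  by (simp add: all_points_def)

lemma AE_mm_notin_all_points: "AE \<omega> in mm. t \<notin> set (all_points \<omega>)"
proof (rule AE_mm)
  have "(\<lambda>\<omega>. (t, \<omega>)) -` {p \<in> space (time_blocks_borel). fst p \<notin> set (all_points (snd p))} \<inter> space blocks_borel
      \<in> sets blocks_borel"
    unfolding all_points_concat by (rule measurable_sets[OF _ measurable_notin_blocks]) simp
  then show "{\<omega> \<in> space blocks_borel. t \<notin> set (all_points \<omega>)} \<in> sets blocks_borel"
    by (simp add: space_pair_measure vimage_def)
  show "block_symmetric (\<lambda>\<omega>. t \<notin> set (all_points \<omega>))"
    unfolding block_symmetric_def using mset_all_points_cong by (metis mset_eq_setD)
  show "AE s in points m. t \<notin> set (all_points (arrange m \<kappa> s))" if \<kappa>: "\<kappa> \<in> colourings m" for m \<kappa>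
  proof -
    have "set (all_points (arrange m \<kappa> s)) = s ` {..<m}" for s
      using arg_cong[OF mset_all_points_arrange[OF \<kappa>, of s], of set_mset] by simp
    moreover have "AE s in points m. \<forall>j\<in>{..<m}. s j \<noteq> t"
      by (intro AE_finite_allI) (simp_all add: AE_points_neq_const)
    ultimately show ?thesis by (auto elim!: eventually_mono)
  qed
qed

text \<open>If the sum of 1 + |p| over the points p of a configuration is at most N, there are at
  most N points, all within distance N of 0. For each number of points, these have finite volume and
  finitely many colourings.\<close>

lemma sigma_finite_mm: "sigma_finite_measure mm"
proof -
  \<comment> \<open>Only the blocks in which chains start enter, so that each point is counted once
    and not once per block of its chain.\<close>
  define V where "V \<omega> = config_extent (\<omega> Bpi) + config_extent (\<omega> Bupsilon1) + config_extent (\<omega> Bupsilon2)"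
    for \<omega> :: "block \<Rightarrow> real list"
  have V_sum: "V \<omega> = (\<Sum>p\<leftarrow>all_points \<omega>. 1 + \<bar>p\<bar>)" for \<omega>
    by (simp add: V_def all_points_def config_extent_def sum_list_addf sum_list_triv)
  have [measurable]: "config_extent \<in> borel_measurable config_borel"
    by (rule measurable_from_config_borel[OF continuous_map_config_extent])
  have [measurable]: "V \<in> borel_measurable blocks_borel"
    unfolding V_def by measurable
  define A where "A N = {\<omega>. V \<omega> \<le> real N}" for N :: nat
  have A [measurable]: "A N \<in> sets blocks_borel" for N
  proof -
    have "{\<omega> \<in> space blocks_borel. V \<omega> \<le> real N} \<in> sets blocks_borel" by measurable
    then show ?thesis by (simp add: A_def)
  qed
  have "emeasure mm (A N) \<noteq> \<infinity>" for N
  proof -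
    have bound: "(\<integral>\<^sup>+ s. indicator (A N) (arrange m \<kappa> s) \<partial>points m) \<le>
        (if m \<le> N then ennreal (2 * real N) ^ m else 0)" if \<kappa>: "\<kappa> \<in> colourings m" for m \<kappa>
    proof -
      let ?B = "\<Pi>\<^sub>E j\<in>{..<m}. {-real N..real N}"
      have V: "V (arrange m \<kappa> s) = (\<Sum>j<m. 1 + \<bar>s j\<bar>)" for s
        unfolding V_sum by (rule sum_list_all_points_arrange[OF \<kappa>])
      have 1: "m \<le> N" if "V (arrange m \<kappa> s) \<le> real N" for s
      proof -
        have "real m \<le> (\<Sum>j<m. 1 + \<bar>s j\<bar>)" by (simp add: sum.distrib sum_nonneg)
        then show ?thesis using that unfolding V by linarith
      qed
      have 2: "s j \<in> {-real N..real N}" if "V (arrange m \<kappa> s) \<le> real N" "j < m" for s j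
      proof -
        have "1 + \<bar>s j\<bar> \<le> (\<Sum>j<m. 1 + \<bar>s j\<bar>)"
          using that(2) by (intro member_le_sum) auto
        then show ?thesis using that(1) unfolding V by auto
      qed
      have "(\<integral>\<^sup>+ s. indicator (A N) (arrange m \<kappa> s) \<partial>points m) \<le>
          (\<integral>\<^sup>+ s. (if m \<le> N then 1 else 0) * indicator ?B s \<partial>points m)"
        using 1 2 by (intro nn_integral_mono)
          (auto simp: A_def space_PiM PiE_iff split: split_indicator)
      also have "\<dots> = (if m \<le> N then 1 else 0) * emeasure (points m) ?B"
        by (intro nn_integral_cmult_indicator sets_PiM_I_finite) simp_all
      also have "emeasure (points m) ?B = (\<Prod>j<m. emeasure lborel {-real N..real N})"
        by (intro lborel_product.emeasure_PiM) simp_all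
      finally show ?thesis by (cases "m \<le> N") simp_all
    qed
    have "emeasure mm (A N) = (\<integral>\<^sup>+ \<omega>. indicator (A N) \<omega> \<partial>mm)" by simp
    also have "\<dots> = (\<integral>\<^sup>+ m. ennreal (1 / fact m) *
        (\<Sum>\<kappa>\<in>colourings m. \<integral>\<^sup>+ s. indicator (A N) (arrange m \<kappa> s) \<partial>points m) \<partial>count_space UNIV)"
    proof (rule nn_integral_mm)
      show "block_symmetric (indicator (A N) :: _ \<Rightarrow> ennreal)"
        unfolding block_symmetric_def
      proof (intro allI impI)
        fix \<omega> \<omega>' :: "block \<Rightarrow> real list" assume "\<forall>b. mset (\<omega> b) = mset (\<omega>' b)"
        then have "V \<omega> = V \<omega>'" unfolding V_sum by (intro sum_list_cong_mset mset_all_points_cong) simp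
        then show "(indicator (A N) \<omega> :: ennreal) = indicator (A N) \<omega>'" by (simp add: A_def indicator_def)
      qed
    qed simp
    also have "\<dots> \<le> (\<integral>\<^sup>+ m. (if m \<le> N then ennreal (1 / fact m) *
        (\<Sum>\<kappa>\<in>colourings m. ennreal (2 * real N) ^ m) else 0) \<partial>count_space UNIV)"
    proof (rule nn_integral_mono)
      fix m
      show "ennreal (1 / fact m) * (\<Sum>\<kappa>\<in>colourings m. \<integral>\<^sup>+ s. indicator (A N) (arrange m \<kappa> s) \<partial>points m)
        \<le> (if m \<le> N then ennreal (1 / fact m) * (\<Sum>\<kappa>\<in>colourings m. ennreal (2 * real N) ^ m) else 0)"
      proof (cases "m \<le> N")
        case True
        then show ?thesis using bound[of _ m]
          by (simp only: if_True) (intro mult_left_mono sum_mono, simp_all)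
      next
        case False
        then show ?thesis using bound[of _ m] by simp
      qed
    qed
    also have "\<dots> = (\<integral>\<^sup>+ m. ennreal (1 / fact m) * (\<Sum>\<kappa>\<in>colourings m. ennreal (2 * real N) ^ m) \<partial>count_space {..N})"
      by (subst nn_integral_count_space_indicator) (auto intro!: nn_integral_cong split: split_indicator)
    also have "\<dots> < \<infinity>"
      by (simp add: nn_integral_count_space_finite ennreal_mult_less_top power_less_top_ennreal of_nat_less_top)
    finally show ?thesis by simp
  qed
  moreover have "(\<Union>N. A N) = UNIV"
    unfolding A_def using real_arch_simple by auto
  ultimately show ?thesis
    by (intro sigma_finite_measure.intro exI[of _ "range A"]) auto
qed

section \<open>Splitting off a point\<close>

definition add_point :: "block set \<Rightarrow> real \<Rightarrow> (block \<Rightarrow> real list) \<Rightarrow> block \<Rightarrow> real list" where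
  "add_point c t \<omega> = (\<lambda>b. if b \<in> c then t # \<omega> b else \<omega> b)"

lemma measurable_add_point [measurable]:
  "(\<lambda>p. add_point c (fst p) (snd p)) \<in> time_blocks_borel \<rightarrow>\<^sub>M blocks_borel"
proof (rule measurable_PiM_single')
  fix b :: block
  have "(\<lambda>p::real \<times> (block \<Rightarrow> real list). snd p b) \<in> time_blocks_borel \<rightarrow>\<^sub>M config_borel"
    by (rule measurable_compose[OF measurable_snd measurable_block])
  then show "(\<lambda>p. add_point c (fst p) (snd p) b) \<in> time_blocks_borel \<rightarrow>\<^sub>M config_borel"
    unfolding add_point_def by (cases "b \<in> c") (simp_all add: measurable_config_Cons)
qed simp

lemma block_symmetric_add_point:
  assumes sym: "block_symmetric \<Psi>"
  shows "block_symmetric (\<lambda>\<omega>. \<Psi> (add_point c t \<omega>))"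
  unfolding block_symmetric_def
proof (intro allI impI)
  fix \<omega> \<omega>' :: "block \<Rightarrow> real list" assume "\<forall>b. mset (\<omega> b) = mset (\<omega>' b)"
  then show "\<Psi> (add_point c t \<omega>) = \<Psi> (add_point c t \<omega>')"
    by (intro block_symmetricD[OF sym]) (simp add: add_point_def)
qed

text \<open>The number of summands varies with the configuration but takes countably many values;
  for a given number, the points are measurable coordinates.\<close>

lemma measurable_sum_all_points:
  fixes H :: "real \<Rightarrow> (block \<Rightarrow> real list) \<Rightarrow> 'a::{second_countable_topology, topological_comm_monoid_add}"
  assumes H: "(\<lambda>p. H (fst p) (snd p)) \<in> borel_measurable (time_blocks_borel)"
  shows "(\<lambda>\<omega>. \<Sum>p\<leftarrow>all_points \<omega>. H p \<omega>) \<in> borel_measurable blocks_borel"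
proof -
  have "(\<lambda>\<omega>. \<Sum>p\<leftarrow>\<omega> b. H p \<omega>) \<in> borel_measurable blocks_borel" for b
  proof -
    have eq: "(\<Sum>p\<leftarrow>\<omega> b. H p \<omega>) = (\<Sum>i<length (\<omega> b). H (coordinates \<omega> (b, i)) \<omega>)" for \<omega> :: "block \<Rightarrow> real list"
      by (subst sum_list_sum_nth) (simp add: coordinates_def lessThan_atLeast0)
    have co: "(\<lambda>\<omega>. H (coordinates \<omega> (b, i)) \<omega>) \<in> borel_measurable blocks_borel" for i
    proof -
      have "(\<lambda>\<omega>. if i < length (\<omega> b) then \<omega> b ! i else 0) \<in> borel_measurable blocks_borel"
        by (rule measurable_compose[OF measurable_block measurable_config_nth])
      then have "(\<lambda>\<omega>. coordinates \<omega> (b, i)) \<in> borel_measurable blocks_borel" by (simp add: coordinates_def)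
      then have "(\<lambda>\<omega>. (coordinates \<omega> (b, i), \<omega>)) \<in> blocks_borel \<rightarrow>\<^sub>M time_blocks_borel"
        by (intro measurable_Pair) simp_all
      from measurable_compose[OF this H] show ?thesis by simp
    qed
    show ?thesis
      unfolding eq
      by (rule measurable_compose_countable[OF _ measurable_block_length,
            where f = "\<lambda>l \<omega>. \<Sum>i<l. H (coordinates \<omega> (b, i)) \<omega>"])
        (intro borel_measurable_sum co)
  qed
  then show ?thesis unfolding all_points_def by simp
qed

lemma nn_integral_points_permute:
  assumes \<tau>: "bij_betw \<tau> {..<m} {..<m}" and F: "F \<in> borel_measurable (points m)"
  shows "(\<integral>\<^sup>+ s. F (\<lambda>i\<in>{..<m}. s (\<tau> i)) \<partial>points m) = (\<integral>\<^sup>+ s. F s \<partial>points m)"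
proof -
  let ?p = "\<lambda>s. \<lambda>i\<in>{..<m}. (s (\<tau> i) :: real)"
  have \<tau>lt: "\<tau> i < m" if "i < m" for i using \<tau> that by (auto simp: bij_betw_def)
  have p: "?p \<in> points m \<rightarrow>\<^sub>M points m"
    using \<tau>lt by (intro measurable_restrict measurable_component_singleton) simp
  have "distr (points m) (points m) ?p = points m"
  proof (rule lborel_product.PiM_eqI)
    fix A :: "nat \<Rightarrow> real set" assume A: "\<And>i. i \<in> {..<m} \<Longrightarrow> A i \<in> sets lborel"
    let ?i = "the_inv_into {..<m} \<tau>"
    have inv: "?i (\<tau> i) = i" if "i < m" for i
      using \<tau> that by (simp add: bij_betw_def the_inv_into_f_f)
    have inv': "\<tau> (?i j) = j" "?i j < m" if "j < m" for j
      using \<tau> that the_inv_into_into[of \<tau> "{..<m}" j "{..<m}"] by (auto simp: bij_betw_def f_the_inv_into_f)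
    have "?p -` Pi\<^sub>E {..<m} A \<inter> space (points m) = (\<Pi>\<^sub>E j\<in>{..<m}. A (?i j))"
    proof (intro equalityI subsetI)
      fix s assume s: "s \<in> ?p -` Pi\<^sub>E {..<m} A \<inter> space (points m)"
      have "s j \<in> A (?i j)" if "j < m" for j
      proof -
        have "?p s (?i j) \<in> A (?i j)" using s inv'(2)[OF that] by (auto simp: PiE_iff)
        then show ?thesis using inv'[OF that] by simp
      qed
      then show "s \<in> (\<Pi>\<^sub>E j\<in>{..<m}. A (?i j))" using s by (auto simp: space_PiM PiE_iff)
    next
      fix s assume s: "s \<in> (\<Pi>\<^sub>E j\<in>{..<m}. A (?i j))"
      have "s (\<tau> i) \<in> A i" if "i < m" for i
        using PiE_mem[OF s, of "\<tau> i"] \<tau>lt[OF that] inv[OF that] by simp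
      then show "s \<in> ?p -` Pi\<^sub>E {..<m} A \<inter> space (points m)"
        using s by (auto simp: space_PiM PiE_iff)
    qed
    moreover have "Pi\<^sub>E {..<m} A \<in> sets (points m)" using A by (intro sets_PiM_I_finite) simp_all
    ultimately have "emeasure (distr (points m) (points m) ?p) (Pi\<^sub>E {..<m} A) = emeasure (points m) (\<Pi>\<^sub>E j\<in>{..<m}. A (?i j))"
      by (simp add: emeasure_distr[OF p])
    also have "\<dots> = (\<Prod>j<m. emeasure lborel (A (?i j)))"
      using A inv' by (intro lborel_product.emeasure_PiM) auto
    also have "\<dots> = (\<Prod>i<m. emeasure lborel (A (?i (\<tau> i))))"
      by (rule prod.reindex_bij_betw[OF \<tau>, symmetric])
    also have "\<dots> = (\<Prod>i<m. emeasure lborel (A i))"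
      by (intro prod.cong refl) (simp add: inv)
    finally show "emeasure (distr (points m) (points m) ?p) (Pi\<^sub>E {..<m} A) = (\<Prod>i<m. emeasure lborel (A i))" .
  qed simp_all
  then have "(\<integral>\<^sup>+ s. F s \<partial>points m) = (\<integral>\<^sup>+ s. F s \<partial>distr (points m) (points m) ?p)" by simp
  also have "\<dots> = (\<integral>\<^sup>+ s. F (?p s) \<partial>points m)"
    by (rule nn_integral_distr[OF p]) (simp add: F)
  finally show ?thesis by simp
qed

lemma mset_arrange_permute:
  assumes \<tau>: "bij_betw \<tau> {..<m} {..<m}"
  shows "mset (arrange m (\<lambda>i\<in>{..<m}. \<kappa> (\<tau> i)) (\<lambda>i\<in>{..<m}. s (\<tau> i)) b) = mset (arrange m \<kappa> s b)"
proof -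
  let ?I = "{i. i < m \<and> b \<in> (\<lambda>i\<in>{..<m}. \<kappa> (\<tau> i)) i}" and ?J = "{j. j < m \<and> b \<in> \<kappa> j}"
  have I: "?I = {i. i < m \<and> b \<in> \<kappa> (\<tau> i)}" by auto
  have im: "\<tau> ` ?I = ?J"
  proof (intro equalityI subsetI)
    fix j assume j: "j \<in> ?J"
    then have "j \<in> \<tau> ` {..<m}" using \<tau> by (simp add: bij_betw_def)
    then obtain i where "i < m" "j = \<tau> i" by auto
    then show "j \<in> \<tau> ` ?I" using j unfolding I by auto
  next
    fix j assume "j \<in> \<tau> ` ?I"
    then show "j \<in> ?J" using \<tau> unfolding I by (auto simp: bij_betw_def)
  qed
  have "inj_on \<tau> ?I" using \<tau> by (auto simp: bij_betw_def intro: inj_on_subset)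
  then have "mset_set ?J = image_mset \<tau> (mset_set ?I)" using im by (simp add: image_mset_mset_set)
  moreover have "image_mset (\<lambda>i\<in>{..<m}. s (\<tau> i)) (mset_set ?I) = image_mset (\<lambda>i. s (\<tau> i)) (mset_set ?I)"
    by (rule image_mset_cong) auto
  ultimately show ?thesis
    unfolding mset_arrange by (simp add: image_mset.compositionality comp_def)
qed

lemma mset_arrange_Suc:
  "mset (arrange (Suc m) (\<kappa>(m := c)) (s(m := t)) b) = mset (add_point c t (arrange m \<kappa> s) b)"
proof -
  have "filter (\<lambda>j. b \<in> (\<kappa>(m := c)) j) [0..<m] = filter (\<lambda>j. b \<in> \<kappa> j) [0..<m]"
    by (rule filter_cong) auto
  moreover have "map (s(m := t)) (filter (\<lambda>j. b \<in> \<kappa> j) [0..<m]) = map s (filter (\<lambda>j. b \<in> \<kappa> j) [0..<m])"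
    by (rule map_cong) auto
  ultimately show ?thesis by (simp add: arrange_def add_point_def)
qed

text \<open>Points are exchangeable: transposing j and the last index preserves Lebesgue measure,
  permutes the colourings and changes the blocks only in their order.\<close>

lemma sum_colourings_last:
  assumes meas: "(\<lambda>p. H (fst p) (snd p)) \<in> borel_measurable (time_blocks_borel)"
    and sym: "\<And>t. block_symmetric (H t)" and j: "j < m"
  shows "(\<Sum>\<kappa>\<in>colourings m. \<integral>\<^sup>+ s. (H (s j) (arrange m \<kappa> s) :: ennreal) \<partial>points m) =
    (\<Sum>\<kappa>\<in>colourings m. \<integral>\<^sup>+ s. H (s (m - 1)) (arrange m \<kappa> s) \<partial>points m)"
proof -
  let ?l = "m - 1"
  define \<tau> where "\<tau> i = (if i = j then ?l else if i = ?l then j else i)" for i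
  have inv: "\<tau> (\<tau> i) = i" and lt: "i < m \<Longrightarrow> \<tau> i < m" for i using j by (auto simp: \<tau>_def)
  have \<tau>: "bij_betw \<tau> {..<m} {..<m}"
    by (rule bij_betw_byWitness[where f' = \<tau>]) (use inv lt in auto)
  have l: "\<tau> ?l = j" "?l < m" using j by (auto simp: \<tau>_def)
  let ?p = "\<lambda>\<kappa>. \<lambda>i\<in>{..<m}. \<kappa> (\<tau> i)"
  have "(\<Sum>\<kappa>\<in>colourings m. \<integral>\<^sup>+ s. H (s ?l) (arrange m \<kappa> s) \<partial>points m) =
    (\<Sum>\<kappa>\<in>colourings m. \<integral>\<^sup>+ s. H (s j) (arrange m \<kappa> (\<lambda>i\<in>{..<m}. s (\<tau> i))) \<partial>points m)"
  proof (intro sum.cong refl)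
    fix \<kappa> :: "nat \<Rightarrow> block set"
    have "(\<lambda>s. (s ?l, arrange m \<kappa> s)) \<in> points m \<rightarrow>\<^sub>M time_blocks_borel"
      using l by (intro measurable_Pair measurable_arrange) simp
    from measurable_compose[OF this meas]
    have "(\<lambda>s. H (s ?l) (arrange m \<kappa> s)) \<in> borel_measurable (points m)" by simp
    from nn_integral_points_permute[OF \<tau> this]
    show "(\<integral>\<^sup>+ s. H (s ?l) (arrange m \<kappa> s) \<partial>points m) = (\<integral>\<^sup>+ s. H (s j) (arrange m \<kappa> (\<lambda>i\<in>{..<m}. s (\<tau> i))) \<partial>points m)"
      using l by simp
  qed
  also have "\<dots> = (\<Sum>\<kappa>\<in>colourings m. \<integral>\<^sup>+ s. H (s j) (arrange m (?p \<kappa>) (\<lambda>i\<in>{..<m}. s (\<tau> i))) \<partial>points m)"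
  proof (rule sum.reindex_bij_witness[where i = ?p and j = ?p])
    fix \<kappa> assume \<kappa>: "\<kappa> \<in> colourings m"
    show pp: "?p (?p \<kappa>) = \<kappa>" using \<kappa> inv lt by (auto simp: fun_eq_iff PiE_def extensional_def)
    show "?p \<kappa> \<in> colourings m" using \<kappa> lt by (auto simp: PiE_iff)
    show "(\<integral>\<^sup>+ s. H (s j) (arrange m (?p (?p \<kappa>)) (\<lambda>i\<in>{..<m}. s (\<tau> i))) \<partial>points m) =
      (\<integral>\<^sup>+ s. H (s j) (arrange m \<kappa> (\<lambda>i\<in>{..<m}. s (\<tau> i))) \<partial>points m)" by (simp only: pp)
  next
    fix \<kappa> assume \<kappa>: "\<kappa> \<in> colourings m"
    show "?p (?p \<kappa>) = \<kappa>" using \<kappa> inv lt by (auto simp: fun_eq_iff PiE_def extensional_def)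
    show "?p \<kappa> \<in> colourings m" using \<kappa> lt by (auto simp: PiE_iff)
  qed
  also have "\<dots> = (\<Sum>\<kappa>\<in>colourings m. \<integral>\<^sup>+ s. H (s j) (arrange m \<kappa> s) \<partial>points m)"
    by (intro sum.cong refl nn_integral_cong block_symmetricD[OF sym] mset_arrange_permute[OF \<tau>])
  finally show ?thesis by simp
qed

text \<open>A colouring of m + 1 points is one of m points and a chain type for the last; Tonelli's
  theorem splits off the time of the last point.\<close>

lemma sum_colourings_Suc:
  assumes meas: "(\<lambda>p. H (fst p) (snd p)) \<in> borel_measurable (time_blocks_borel)"
    and sym: "\<And>t. block_symmetric (H t)"
  shows "(\<Sum>\<kappa>\<in>colourings (Suc m). \<integral>\<^sup>+ s. (H (s m) (arrange (Suc m) \<kappa> s) :: ennreal) \<partial>points (Suc m)) =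
    (\<Sum>c\<in>chain_types. \<Sum>\<kappa>\<in>colourings m.
      \<integral>\<^sup>+ t. \<integral>\<^sup>+ s. H t (add_point c t (arrange m \<kappa> s)) \<partial>points m \<partial>lborel)"
proof -
  let ?u = "\<lambda>(c, \<kappa>). \<kappa>(m := c)"
  have "colourings (Suc m) = ?u ` (chain_types \<times> colourings m)"
    unfolding lessThan_Suc by (rule PiE_insert_eq)
  moreover have "inj_on ?u (chain_types \<times> colourings m)"
    by (rule inj_combinator) simp
  ultimately have "(\<Sum>\<kappa>\<in>colourings (Suc m). \<integral>\<^sup>+ s. H (s m) (arrange (Suc m) \<kappa> s) \<partial>points (Suc m)) =
    (\<Sum>(c, \<kappa>)\<in>chain_types \<times> colourings m. \<integral>\<^sup>+ s. H (s m) (arrange (Suc m) (\<kappa>(m := c)) s) \<partial>points (Suc m))"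
    by (simp only: sum.reindex) (rule sum.cong, auto)
  also have "\<dots> = (\<Sum>(c, \<kappa>)\<in>chain_types \<times> colourings m.
      \<integral>\<^sup>+ t. \<integral>\<^sup>+ s. H t (add_point c t (arrange m \<kappa> s)) \<partial>points m \<partial>lborel)"
  proof (intro sum.cong refl, clarify)
    fix c and \<kappa> :: "nat \<Rightarrow> block set"
    have "(\<lambda>s. (s m, arrange (Suc m) (\<kappa>(m := c)) s)) \<in> points (Suc m) \<rightarrow>\<^sub>M time_blocks_borel"
      by (intro measurable_Pair measurable_arrange) simp
    from measurable_compose[OF this meas]
    have m: "(\<lambda>s. H (s m) (arrange (Suc m) (\<kappa>(m := c)) s)) \<in> borel_measurable (points (Suc m))" by simp
    have "(\<integral>\<^sup>+ s. H (s m) (arrange (Suc m) (\<kappa>(m := c)) s) \<partial>points (Suc m)) =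
      (\<integral>\<^sup>+ t. \<integral>\<^sup>+ s. H t (arrange (Suc m) (\<kappa>(m := c)) (s(m := t))) \<partial>points m \<partial>lborel)"
      using lborel_product.product_nn_integral_insert_rev[OF _ _ m[unfolded lessThan_Suc]]
      unfolding lessThan_Suc by simp
    also have "\<dots> = (\<integral>\<^sup>+ t. \<integral>\<^sup>+ s. H t (add_point c t (arrange m \<kappa> s)) \<partial>points m \<partial>lborel)"
      by (intro nn_integral_cong block_symmetricD[OF sym] mset_arrange_Suc)
    finally show "(\<integral>\<^sup>+ s. H (s m) (arrange (Suc m) (\<kappa>(m := c)) s) \<partial>points (Suc m)) =
      (\<integral>\<^sup>+ t. \<integral>\<^sup>+ s. H t (add_point c t (arrange m \<kappa> s)) \<partial>points m \<partial>lborel)" .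
  qed
  finally show ?thesis by (simp add: sum.cartesian_product)
qed

text \<open>The Mecke formula of \<open>mm\<close>.\<close>

theorem nn_integral_mm_sum_points:
  fixes H :: "real \<Rightarrow> (block \<Rightarrow> real list) \<Rightarrow> ennreal"
  assumes meas: "(\<lambda>p. H (fst p) (snd p)) \<in> borel_measurable (time_blocks_borel)"
    and sym: "\<And>t. block_symmetric (H t)"
  shows "(\<integral>\<^sup>+ \<omega>. (\<Sum>p\<leftarrow>all_points \<omega>. H p \<omega>) \<partial>mm) =
    (\<Sum>c\<in>chain_types. \<integral>\<^sup>+ t. \<integral>\<^sup>+ \<omega>. H t (add_point c t \<omega>) \<partial>mm \<partial>lborel)"
proof -
  define L where "L m = ennreal (1 / fact m) *
    (\<Sum>\<kappa>\<in>colourings m. \<integral>\<^sup>+ s. (\<Sum>p\<leftarrow>all_points (arrange m \<kappa> s). H p (arrange m \<kappa> s)) \<partial>points m)" for m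
  define R where "R c m = ennreal (1 / fact m) *
    (\<Sum>\<kappa>\<in>colourings m. \<integral>\<^sup>+ t. \<integral>\<^sup>+ s. H t (add_point c t (arrange m \<kappa> s)) \<partial>points m \<partial>lborel)" for c m
  have 1: "block_symmetric (\<lambda>\<omega>. \<Sum>p\<leftarrow>all_points \<omega>. H p \<omega>)"
    unfolding block_symmetric_def
  proof (intro allI impI)
    fix \<omega> \<omega>' :: "block \<Rightarrow> real list" assume eq: "\<forall>b. mset (\<omega> b) = mset (\<omega>' b)"
    then have "(\<Sum>p\<leftarrow>all_points \<omega>. H p \<omega>) = (\<Sum>p\<leftarrow>all_points \<omega>'. H p \<omega>)"
      by (intro sum_list_cong_mset mset_all_points_cong) simp
    moreover have "H p \<omega> = H p \<omega>'" for p using eq by (intro block_symmetricD[OF sym]) simp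
    ultimately show "(\<Sum>p\<leftarrow>all_points \<omega>. H p \<omega>) = (\<Sum>p\<leftarrow>all_points \<omega>'. H p \<omega>')" by simp
  qed
  have L0: "L 0 = 0"
  proof -
    have "all_points (arrange 0 \<kappa> s) = []" for \<kappa> s
      by (simp add: all_points_def arrange_def)
    then show ?thesis by (simp add: L_def)
  qed
  \<comment> \<open>The m + 1 points contribute equally by exchangeability, and (m + 1) / (m + 1)! =
    1 / m!: removing one point leaves the correct weight for m points.\<close>
  have LSuc: "L (Suc m) = (\<Sum>c\<in>chain_types. R c m)" for m
  proof -
    have "(\<Sum>\<kappa>\<in>colourings (Suc m). \<integral>\<^sup>+ s. (\<Sum>p\<leftarrow>all_points (arrange (Suc m) \<kappa> s). H p (arrange (Suc m) \<kappa> s)) \<partial>points (Suc m))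
      = (\<Sum>\<kappa>\<in>colourings (Suc m). \<Sum>j<Suc m. \<integral>\<^sup>+ s. H (s j) (arrange (Suc m) \<kappa> s) \<partial>points (Suc m))"
    proof (intro sum.cong refl)
      fix \<kappa> assume \<kappa>: "\<kappa> \<in> colourings (Suc m)"
      have "(\<lambda>s. H (s j) (arrange (Suc m) \<kappa> s)) \<in> borel_measurable (points (Suc m))" if "j < Suc m" for j
      proof -
        have "(\<lambda>s. (s j, arrange (Suc m) \<kappa> s)) \<in> points (Suc m) \<rightarrow>\<^sub>M time_blocks_borel"
          using that by (intro measurable_Pair measurable_arrange) simp
        from measurable_compose[OF this meas] show ?thesis by simp
      qed
      then show "(\<integral>\<^sup>+ s. (\<Sum>p\<leftarrow>all_points (arrange (Suc m) \<kappa> s). H p (arrange (Suc m) \<kappa> s)) \<partial>points (Suc m)) =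
        (\<Sum>j<Suc m. \<integral>\<^sup>+ s. H (s j) (arrange (Suc m) \<kappa> s) \<partial>points (Suc m))"
        unfolding sum_list_all_points_arrange[OF \<kappa>] by (intro nn_integral_sum) simp
    qed
    also have "\<dots> = (\<Sum>j<Suc m. \<Sum>\<kappa>\<in>colourings (Suc m). \<integral>\<^sup>+ s. H (s j) (arrange (Suc m) \<kappa> s) \<partial>points (Suc m))"
      by (rule sum.swap)
    also have "\<dots> = (\<Sum>j<Suc m. \<Sum>\<kappa>\<in>colourings (Suc m). \<integral>\<^sup>+ s. H (s m) (arrange (Suc m) \<kappa> s) \<partial>points (Suc m))"
    proof (rule sum.cong[OF refl])
      fix j assume "j \<in> {..<Suc m}"
      then have "j < Suc m" by simp
      from sum_colourings_last[OF meas sym this]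
      show "(\<Sum>\<kappa>\<in>colourings (Suc m). \<integral>\<^sup>+ s. H (s j) (arrange (Suc m) \<kappa> s) \<partial>points (Suc m)) =
        (\<Sum>\<kappa>\<in>colourings (Suc m). \<integral>\<^sup>+ s. H (s m) (arrange (Suc m) \<kappa> s) \<partial>points (Suc m))"
        by (simp only: diff_Suc_1)
    qed
    also have "\<dots> = of_nat (Suc m) * (\<Sum>\<kappa>\<in>colourings (Suc m). \<integral>\<^sup>+ s. H (s m) (arrange (Suc m) \<kappa> s) \<partial>points (Suc m))"
      by (simp only: sum_constant card_lessThan)
    finally have "L (Suc m) = ennreal (1 / fact (Suc m)) * of_nat (Suc m) *
        (\<Sum>c\<in>chain_types. \<Sum>\<kappa>\<in>colourings m. \<integral>\<^sup>+ t. \<integral>\<^sup>+ s. H t (add_point c t (arrange m \<kappa> s)) \<partial>points m \<partial>lborel)"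
      unfolding L_def sum_colourings_Suc[OF meas sym] by (simp only: mult.assoc)
    also have "ennreal (1 / fact (Suc m)) * of_nat (Suc m) = ennreal (1 / fact m)"
    proof -
      have "ennreal (1 / fact (Suc m)) * of_nat (Suc m) = ennreal (1 / fact (Suc m) * real (Suc m))"
        by (simp only: ennreal_of_nat_eq_real_of_nat ennreal_mult'[symmetric] of_nat_0_le_iff ennreal_mult'')
      also have "1 / fact (Suc m) * real (Suc m) = 1 / fact m" by (simp del: of_nat_Suc)
      finally show ?thesis .
    qed
    finally show ?thesis by (simp only: R_def sum_distrib_left)
  qed
  have "(\<integral>\<^sup>+ \<omega>. (\<Sum>p\<leftarrow>all_points \<omega>. H p \<omega>) \<partial>mm) = (\<integral>\<^sup>+ m. L m \<partial>count_space UNIV)"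
    unfolding L_def by (rule nn_integral_mm[OF measurable_sum_all_points[OF meas] 1])
  \<comment> \<open>The empty configuration has no points to sum over, so m starts at 1.\<close>
  also have "\<dots> = (\<integral>\<^sup>+ m. L m \<partial>count_space (range Suc))"
    by (rule nn_integral_count_space_eq[symmetric]) (use L0 in \<open>auto simp: image_iff, metis not0_implies_Suc\<close>)
  also have "\<dots> = (\<integral>\<^sup>+ m. L (Suc m) \<partial>count_space UNIV)"
    by (rule nn_integral_bij_count_space[symmetric]) (simp add: bij_betw_def)
  also have "\<dots> = (\<Sum>c\<in>chain_types. \<integral>\<^sup>+ m. R c m \<partial>count_space UNIV)"
    unfolding LSuc by (rule nn_integral_sum) simp
  also have "\<dots> = (\<Sum>c\<in>chain_types. \<integral>\<^sup>+ t. \<integral>\<^sup>+ \<omega>. H t (add_point c t \<omega>) \<partial>mm \<partial>lborel)"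
  proof (rule sum.cong[OF refl])
    fix c
    have m1: "(\<lambda>\<omega>. H t (add_point c t \<omega>)) \<in> borel_measurable blocks_borel" for t
    proof -
      have "(\<lambda>\<omega>. (t, add_point c t \<omega>)) \<in> blocks_borel \<rightarrow>\<^sub>M time_blocks_borel"
        using measurable_compose[OF measurable_Pair1'[of t borel blocks_borel] measurable_add_point[of c]]
        by (intro measurable_Pair) simp_all
      from measurable_compose[OF this meas] show ?thesis by simp
    qed
    have m2: "(\<lambda>t. \<integral>\<^sup>+ s. H t (add_point c t (arrange m \<kappa> s)) \<partial>points m) \<in> borel_measurable lborel" for m \<kappa>
    proof -
      interpret P: sigma_finite_measure "points m"
        by (rule lborel_product.sigma_finite) simp
      have "(\<lambda>p. (fst p, arrange m \<kappa> (snd p))) \<in> lborel \<Otimes>\<^sub>M points m \<rightarrow>\<^sub>M time_blocks_borel"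
        by (intro measurable_Pair measurable_compose[OF measurable_snd measurable_arrange]) simp
      from measurable_compose[OF this measurable_add_point, of c]
      have "(\<lambda>p. (fst p, add_point c (fst p) (arrange m \<kappa> (snd p)))) \<in> lborel \<Otimes>\<^sub>M points m \<rightarrow>\<^sub>M time_blocks_borel"
        by (intro measurable_Pair) simp_all
      from measurable_compose[OF this meas]
      show ?thesis by (intro P.borel_measurable_nn_integral) (simp add: case_prod_beta)
    qed
    have "(\<integral>\<^sup>+ t. \<integral>\<^sup>+ \<omega>. H t (add_point c t \<omega>) \<partial>mm \<partial>lborel) = (\<integral>\<^sup>+ t. \<integral>\<^sup>+ m. ennreal (1 / fact m) *
        (\<Sum>\<kappa>\<in>colourings m. \<integral>\<^sup>+ s. H t (add_point c t (arrange m \<kappa> s)) \<partial>points m) \<partial>count_space UNIV \<partial>lborel)"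
      by (intro nn_integral_cong nn_integral_mm m1 block_symmetric_add_point sym)
    also have "\<dots> = (\<integral>\<^sup>+ m. \<integral>\<^sup>+ t. ennreal (1 / fact m) *
        (\<Sum>\<kappa>\<in>colourings m. \<integral>\<^sup>+ s. H t (add_point c t (arrange m \<kappa> s)) \<partial>points m) \<partial>lborel \<partial>count_space UNIV)"
      using m2 by (intro nn_integral_count_space_nn_integral) (simp_all add: borel_measurable_sum)
    also have "\<dots> = (\<integral>\<^sup>+ m. R c m \<partial>count_space UNIV)"
      unfolding R_def using m2
      by (intro nn_integral_cong) (simp add: nn_integral_cmult nn_integral_sum borel_measurable_sum)
    finally show "(\<integral>\<^sup>+ m. R c m \<partial>count_space UNIV) = (\<integral>\<^sup>+ t. \<integral>\<^sup>+ \<omega>. H t (add_point c t \<omega>) \<partial>mm \<partial>lborel)" ..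
  qed
  finally show ?thesis .
qed

section \<open>Joint integrals over time and configuration, and Mecke's formula for complex
  functions\<close>

interpretation mm: sigma_finite_measure mm
  by (rule sigma_finite_mm)

interpretation lborel_mm: pair_sigma_finite "lborel :: real measure" mm ..

lemma sets_lborel_mm: "sets (lborel \<Otimes>\<^sub>M mm) = sets (time_blocks_borel)"
  by (rule sets_pair_measure_cong) simp_all

lemma measurable_lborel_mm: "f \<in> time_blocks_borel \<rightarrow>\<^sub>M N \<Longrightarrow> f \<in> lborel \<Otimes>\<^sub>M mm \<rightarrow>\<^sub>M N"
  using measurable_cong_sets[OF sets_lborel_mm refl] by blast

lemma measurable_mm: "f \<in> blocks_borel \<rightarrow>\<^sub>M N \<Longrightarrow> f \<in> mm \<rightarrow>\<^sub>M N"
  using measurable_cong_sets[OF sets_mm refl] by blast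

abbreviation with_point :: "block set \<Rightarrow> (real \<Rightarrow> (block \<Rightarrow> real list) \<Rightarrow> 'a) \<Rightarrow> real \<times> (block \<Rightarrow> real list) \<Rightarrow> 'a" where
  "with_point c H p \<equiv> H (fst p) (add_point c (fst p) (snd p))"

lemma measurable_add_point_fun:
  assumes "(\<lambda>p. H (fst p) (snd p)) \<in> borel_measurable (time_blocks_borel)"
  shows "(\<lambda>p. with_point c H p) \<in> borel_measurable (time_blocks_borel)"
proof -
  have "(\<lambda>p. (fst p, add_point c (fst p) (snd p))) \<in> time_blocks_borel \<rightarrow>\<^sub>M time_blocks_borel"
    by (intro measurable_Pair measurable_add_point) simp
  from measurable_compose[OF this assms] show ?thesis by simp
qed

text \<open>Integrability of every term with an added point makes Mecke's formula finite, so the sum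
  over the points is integrable and not merely measurable.\<close>

lemma mm_sum_points_nonneg:
  fixes H :: "real \<Rightarrow> (block \<Rightarrow> real list) \<Rightarrow> real"
  assumes meas: "(\<lambda>p. H (fst p) (snd p)) \<in> borel_measurable (time_blocks_borel)"
    and sym: "\<And>t. block_symmetric (H t)" and nonneg: "\<And>t \<omega>. 0 \<le> H t \<omega>"
    and int: "\<And>c. c \<in> chain_types \<Longrightarrow> integrable (lborel \<Otimes>\<^sub>M mm) (\<lambda>p. with_point c H p)"
  shows "has_bochner_integral mm (\<lambda>\<omega>. \<Sum>p\<leftarrow>all_points \<omega>. H p \<omega>)
    (\<Sum>c\<in>chain_types. \<integral>p. with_point c H p \<partial>(lborel \<Otimes>\<^sub>M mm))"
proof (rule has_bochner_integral_nn_integral)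
  show "(\<lambda>\<omega>. \<Sum>p\<leftarrow>all_points \<omega>. H p \<omega>) \<in> borel_measurable mm"
    by (rule measurable_mm[OF measurable_sum_all_points[OF meas]])
  show "AE \<omega> in mm. 0 \<le> (\<Sum>p\<leftarrow>all_points \<omega>. H p \<omega>)"
    by (intro AE_I2 sum_list_nonneg) (auto simp: nonneg)
  show "0 \<le> (\<Sum>c\<in>chain_types. \<integral>p. with_point c H p \<partial>(lborel \<Otimes>\<^sub>M mm))"
    by (intro sum_nonneg integral_nonneg_AE AE_I2 nonneg)
  have e: "ennreal (\<Sum>p\<leftarrow>xs. H p \<omega>) = (\<Sum>p\<leftarrow>xs. ennreal (H p \<omega>))" for xs \<omega>
  proof (induction xs)
    case (Cons a xs)
    have "0 \<le> (\<Sum>p\<leftarrow>xs. H p \<omega>)" by (rule sum_list_nonneg) (auto simp: nonneg)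
    then show ?case using Cons by (simp add: nonneg)
  qed simp
  have "(\<integral>\<^sup>+ \<omega>. ennreal (\<Sum>p\<leftarrow>all_points \<omega>. H p \<omega>) \<partial>mm) =
    (\<Sum>c\<in>chain_types. \<integral>\<^sup>+ t. \<integral>\<^sup>+ \<omega>. ennreal (H t (add_point c t \<omega>)) \<partial>mm \<partial>lborel)"
    unfolding e
  proof (rule nn_integral_mm_sum_points)
    show "block_symmetric (\<lambda>\<omega>. ennreal (H t \<omega>))" for t
      using sym[of t] unfolding block_symmetric_def by metis
  qed (use meas in measurable)
  also have "\<dots> = (\<Sum>c\<in>chain_types. ennreal (\<integral>p. with_point c H p \<partial>(lborel \<Otimes>\<^sub>M mm)))"
  proof (rule sum.cong[OF refl])
    fix c assume c: "c \<in> chain_types"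
    have "(\<lambda>p. ennreal (with_point c H p)) \<in> borel_measurable (lborel \<Otimes>\<^sub>M mm)"
      using measurable_lborel_mm[OF measurable_add_point_fun[OF meas, of c]] by measurable
    then have "(\<integral>\<^sup>+ t. \<integral>\<^sup>+ \<omega>. ennreal (H t (add_point c t \<omega>)) \<partial>mm \<partial>lborel) =
      (\<integral>\<^sup>+ p. ennreal (with_point c H p) \<partial>(lborel \<Otimes>\<^sub>M mm))"
      using mm.nn_integral_fst[of "\<lambda>p. ennreal (with_point c H p)" lborel] by simp
    also have "\<dots> = ennreal (\<integral>p. with_point c H p \<partial>(lborel \<Otimes>\<^sub>M mm))"
      by (rule nn_integral_eq_integral[OF int[OF c]]) (simp add: nonneg)
    finally show "(\<integral>\<^sup>+ t. \<integral>\<^sup>+ \<omega>. ennreal (H t (add_point c t \<omega>)) \<partial>mm \<partial>lborel) =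
      ennreal (\<integral>p. with_point c H p \<partial>(lborel \<Otimes>\<^sub>M mm))" .
  qed
  also have "\<dots> = ennreal (\<Sum>c\<in>chain_types. \<integral>p. with_point c H p \<partial>(lborel \<Otimes>\<^sub>M mm))"
    by (intro sum_ennreal integral_nonneg_AE AE_I2 nonneg)
  finally show "(\<integral>\<^sup>+ \<omega>. ennreal (\<Sum>p\<leftarrow>all_points \<omega>. H p \<omega>) \<partial>mm) =
    ennreal (\<Sum>c\<in>chain_types. \<integral>p. with_point c H p \<partial>(lborel \<Otimes>\<^sub>M mm))" .
qed

lemma mm_sum_points_real:
  fixes H :: "real \<Rightarrow> (block \<Rightarrow> real list) \<Rightarrow> real"
  assumes meas: "(\<lambda>p. H (fst p) (snd p)) \<in> borel_measurable (time_blocks_borel)"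
    and sym: "\<And>t. block_symmetric (H t)"
    and int: "\<And>c. c \<in> chain_types \<Longrightarrow> integrable (lborel \<Otimes>\<^sub>M mm) (\<lambda>p. with_point c H p)"
  shows "has_bochner_integral mm (\<lambda>\<omega>. \<Sum>p\<leftarrow>all_points \<omega>. H p \<omega>)
    (\<Sum>c\<in>chain_types. \<integral>p. with_point c H p \<partial>(lborel \<Otimes>\<^sub>M mm))"
proof -
  have sp: "block_symmetric (\<lambda>\<omega>. max 0 (H t \<omega>))" "block_symmetric (\<lambda>\<omega>. max 0 (- H t \<omega>))" for t
    using sym[of t] unfolding block_symmetric_def by metis+
  have ip: "integrable (lborel \<Otimes>\<^sub>M mm) (\<lambda>p. max 0 (with_point c H p))"
    "integrable (lborel \<Otimes>\<^sub>M mm) (\<lambda>p. max 0 (- with_point c H p))"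
    if "c \<in> chain_types" for c
    using int[OF that] by auto
  have "has_bochner_integral mm (\<lambda>\<omega>. (\<Sum>p\<leftarrow>all_points \<omega>. max 0 (H p \<omega>)) - (\<Sum>p\<leftarrow>all_points \<omega>. max 0 (- H p \<omega>)))
    ((\<Sum>c\<in>chain_types. \<integral>p. max 0 (with_point c H p) \<partial>(lborel \<Otimes>\<^sub>M mm)) -
     (\<Sum>c\<in>chain_types. \<integral>p. max 0 (- with_point c H p) \<partial>(lborel \<Otimes>\<^sub>M mm)))"
    by (intro has_bochner_integral_diff mm_sum_points_nonneg sp ip) (use meas in measurable)
  moreover have "(\<Sum>p\<leftarrow>xs. max 0 (H p \<omega>)) - (\<Sum>p\<leftarrow>xs. max 0 (- H p \<omega>)) = (\<Sum>p\<leftarrow>xs. H p \<omega>)" for xs \<omega>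
    by (induction xs) (simp_all add: max_def)
  moreover have "(\<integral>p. max 0 (with_point c H p) \<partial>(lborel \<Otimes>\<^sub>M mm)) -
      (\<integral>p. max 0 (- with_point c H p) \<partial>(lborel \<Otimes>\<^sub>M mm)) =
      (\<integral>p. with_point c H p \<partial>(lborel \<Otimes>\<^sub>M mm))" if "c \<in> chain_types" for c
    unfolding Bochner_Integration.integral_diff[OF ip[OF that], symmetric]
    by (rule Bochner_Integration.integral_cong) (auto simp: max_def)
  ultimately show ?thesis by (simp add: sum_subtractf[symmetric] cong: sum.cong)
qed

text \<open>Positive and negative parts carry the formula from nonnegative to real functions, real
  and imaginary parts from there to complex ones.\<close>

theorem mm_sum_points:
  fixes H :: "real \<Rightarrow> (block \<Rightarrow> real list) \<Rightarrow> complex"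
  assumes meas: "(\<lambda>p. H (fst p) (snd p)) \<in> borel_measurable (time_blocks_borel)"
    and sym: "\<And>t. block_symmetric (H t)"
    and int: "\<And>c. c \<in> chain_types \<Longrightarrow> integrable (lborel \<Otimes>\<^sub>M mm) (\<lambda>p. with_point c H p)"
  shows "has_bochner_integral mm (\<lambda>\<omega>. \<Sum>p\<leftarrow>all_points \<omega>. H p \<omega>)
    (\<Sum>c\<in>chain_types. \<integral>p. with_point c H p \<partial>(lborel \<Otimes>\<^sub>M mm))"
proof -
  have sp: "block_symmetric (\<lambda>\<omega>. Re (H t \<omega>))" "block_symmetric (\<lambda>\<omega>. Im (H t \<omega>))" for t
    using sym[of t] unfolding block_symmetric_def by metis+
  have ip: "integrable (lborel \<Otimes>\<^sub>M mm) (\<lambda>p. Re (with_point c H p))"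
    "integrable (lborel \<Otimes>\<^sub>M mm) (\<lambda>p. Im (with_point c H p))"
    if "c \<in> chain_types" for c
    using int[OF that] by simp_all
  have "has_bochner_integral mm (\<lambda>\<omega>. of_real (\<Sum>p\<leftarrow>all_points \<omega>. Re (H p \<omega>)) + \<i> * of_real (\<Sum>p\<leftarrow>all_points \<omega>. Im (H p \<omega>)))
    (of_real (\<Sum>c\<in>chain_types. \<integral>p. Re (with_point c H p) \<partial>(lborel \<Otimes>\<^sub>M mm)) +
     \<i> * of_real (\<Sum>c\<in>chain_types. \<integral>p. Im (with_point c H p) \<partial>(lborel \<Otimes>\<^sub>M mm)))"
    by (intro has_bochner_integral_add has_bochner_integral_mult_right has_bochner_integral_of_real
        mm_sum_points_real sp ip) (use meas in measurable)
  moreover have "of_real (\<Sum>p\<leftarrow>xs. Re (H p \<omega>)) + \<i> * of_real (\<Sum>p\<leftarrow>xs. Im (H p \<omega>)) = (\<Sum>p\<leftarrow>xs. H p \<omega>)" for xs \<omega>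
    by (induction xs) (simp_all add: complex_eq_iff)
  moreover have "of_real (\<integral>p. Re (with_point c H p) \<partial>(lborel \<Otimes>\<^sub>M mm)) +
      \<i> * of_real (\<integral>p. Im (with_point c H p) \<partial>(lborel \<Otimes>\<^sub>M mm)) =
      (\<integral>p. with_point c H p \<partial>(lborel \<Otimes>\<^sub>M mm))" if "c \<in> chain_types" for c
    using int[OF that] by (simp add: complex_eq_iff)
  ultimately show ?thesis by (simp add: sum_distrib_left sum.distrib[symmetric] cong: sum.cong)
qed

section \<open>Integration by parts and measurability of the forms\<close>

lemma eventually_notin_finite:
  fixes S :: "real set"
  assumes "finite S"
  shows "\<forall>\<^sub>F s in at t. s \<notin> S"
proof -
  have "open (- (S - {t}))" using assms by (intro open_Compl finite_imp_closed) simp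
  then have "\<forall>\<^sub>F s in at t. s \<in> - (S - {t})" by (rule eventually_at_in_open') simp
  moreover have "\<forall>\<^sub>F s in at t. s \<noteq> t" by (simp add: eventually_at_filter)
  ultimately show ?thesis by eventually_elim auto
qed

text \<open>Subtracting from the product of \<phi> and \<Phi> the step function of its accumulated
  jumps leaves a continuous function with the classical derivative off S. The fundamental theorem
  with finitely many exceptional points applies to it.\<close>

lemma integration_by_parts_with_jumps:
  fixes \<Phi> d \<phi> \<phi>' L R :: "real \<Rightarrow> complex"
  assumes S: "finite S"
    and deriv: "\<And>t. t \<notin> S \<Longrightarrow> (\<Phi> has_vector_derivative d t) (at t)"
    and left: "\<And>p. p \<in> S \<Longrightarrow> (\<Phi> \<longlongrightarrow> L p) (at_left p)"
    and right: "\<And>p. p \<in> S \<Longrightarrow> (\<Phi> \<longlongrightarrow> R p) (at_right p)"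
    and \<phi>: "\<And>t. (\<phi> has_vector_derivative \<phi>' t) (at t)"
    and supp: "\<And>t. t \<notin> {a<..<b} \<Longrightarrow> \<phi> t = 0" "\<And>t. t \<notin> {a<..<b} \<Longrightarrow> \<phi>' t = 0"
    and int1: "integrable lborel (\<lambda>t. \<phi>' t * \<Phi> t)" and int2: "integrable lborel (\<lambda>t. \<phi> t * d t)"
  shows "(\<integral>t. \<phi>' t * \<Phi> t \<partial>lborel) = - (\<integral>t. \<phi> t * d t \<partial>lborel) - (\<Sum>p\<in>S. \<phi> p * (R p - L p))"
proof (cases "a < b")
  case False
  then have "\<phi> t = 0" "\<phi>' t = 0" for t using supp[of t] by auto
  then show ?thesis by simp
next
  case ab: True
  \<comment> \<open>The strict inequality makes T left-continuous; accordingly K takes the left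
    limit of \<Phi> at the points of S, whatever value \<Phi> has there.\<close>
  define T where "T s = (\<Sum>p\<in>{p \<in> S. p < s}. \<phi> p * (R p - L p))" for s
  define K where "K t = \<phi> t * (if t \<in> S then L t else \<Phi> t) - T t" for t
  have \<phi>c: "(\<phi> \<longlongrightarrow> \<phi> t) (at t within A)" for t A
    using \<phi>[of t] by (metis has_vector_derivative_continuous continuous_at_imp_continuous_at_within continuous_within)
  have ev_left: "\<forall>\<^sub>F s in at_left t. s \<notin> S \<and> T s = T t" for t
  proof -
    have "\<forall>\<^sub>F s in at_left t. \<forall>p\<in>{p \<in> S. p < t}. p < s"
      using S by (intro eventually_ball_finite) (auto intro: eventually_at_left_real[THEN eventually_mono])
    moreover have "\<forall>\<^sub>F s in at_left t. s < t" by (simp add: eventually_at_filter)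
    moreover have "\<forall>\<^sub>F s in at_left t. s \<notin> S" by (rule filter_leD[OF at_le[OF subset_UNIV] eventually_notin_finite[OF S]])
    ultimately show ?thesis
    proof eventually_elim
      case (elim s)
      then have "{p \<in> S. p < s} = {p \<in> S. p < t}" by fastforce
      then show ?case using elim by (simp add: T_def)
    qed
  qed
  have ev_right: "\<forall>\<^sub>F s in at_right t. s \<notin> S \<and> T s = T t + (if t \<in> S then \<phi> t * (R t - L t) else 0)" for t
  proof -
    have "\<forall>\<^sub>F s in at_right t. \<forall>p\<in>{p \<in> S. t < p}. s < p"
      using S by (intro eventually_ball_finite) (auto intro: eventually_at_right_real[THEN eventually_mono])
    moreover have "\<forall>\<^sub>F s in at_right t. t < s" by (simp add: eventually_at_filter)
    moreover have "\<forall>\<^sub>F s in at_right t. s \<notin> S" by (rule filter_leD[OF at_le[OF subset_UNIV] eventually_notin_finite[OF S]])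
    ultimately show ?thesis
    proof eventually_elim
      case (elim s)
      have "{p \<in> S. p < s} = {p \<in> S. p < t} \<union> (if t \<in> S then {t} else {})"
        using elim by (auto simp: not_less) (metis linorder_neqE_linordered_idom order.asym)+
      then show ?case using elim S by (simp add: T_def sum.union_disjoint)
    qed
  qed
  have lim_off: "(\<Phi> \<longlongrightarrow> \<Phi> t) (at t within A)" if "t \<notin> S" for t A
    using deriv[OF that] by (metis has_vector_derivative_continuous continuous_at_imp_continuous_at_within continuous_within)
  have contK: "continuous_on {a..b} K"
  proof (intro continuous_at_imp_continuous_on ballI)
    fix t
    have l: "(K \<longlongrightarrow> K t) (at_left t)"
    proof (rule Lim_transform_eventually)
      have "(\<Phi> \<longlongrightarrow> (if t \<in> S then L t else \<Phi> t)) (at_left t)" using left lim_off by simp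
      then show "((\<lambda>s. \<phi> s * \<Phi> s - T t) \<longlongrightarrow> K t) (at_left t)"
        unfolding K_def by (intro tendsto_intros \<phi>c)
      show "\<forall>\<^sub>F s in at_left t. \<phi> s * \<Phi> s - T t = K s"
        using ev_left by eventually_elim (simp add: K_def)
    qed
    have r: "(K \<longlongrightarrow> K t) (at_right t)"
    proof (rule Lim_transform_eventually)
      let ?e = "if t \<in> S then \<phi> t * (R t - L t) else 0"
      have "(\<Phi> \<longlongrightarrow> (if t \<in> S then R t else \<Phi> t)) (at_right t)" using right lim_off by simp
      then have "((\<lambda>s. \<phi> s * \<Phi> s - (T t + ?e)) \<longlongrightarrow> \<phi> t * (if t \<in> S then R t else \<Phi> t) - (T t + ?e)) (at_right t)"
        by (intro tendsto_intros \<phi>c)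
      also have "\<phi> t * (if t \<in> S then R t else \<Phi> t) - (T t + ?e) = K t" by (simp add: K_def algebra_simps)
      finally show "((\<lambda>s. \<phi> s * \<Phi> s - (T t + ?e)) \<longlongrightarrow> K t) (at_right t)" .
      show "\<forall>\<^sub>F s in at_right t. \<phi> s * \<Phi> s - (T t + ?e) = K s"
        using ev_right by eventually_elim (simp add: K_def)
    qed
    show "isCont K t" unfolding isCont_def using l r by (rule filterlim_split_at)
  qed
  let ?f = "\<lambda>t. \<phi> t * d t + \<phi>' t * \<Phi> t"
  have derK: "(K has_vector_derivative ?f t) (at t)" if t: "t \<in> {a<..<b} - S" for t
  proof -
    have "\<forall>\<^sub>F s in at t. \<phi> s * \<Phi> s - T t = K s"
      using ev_left[of t] ev_right[of t] t
      unfolding eventually_at_split by (auto simp: K_def elim: eventually_mono)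
    moreover have "((\<lambda>s. \<phi> s * \<Phi> s - T t) has_vector_derivative ?f t) (at t)"
      using deriv[of t] t by (auto intro!: derivative_eq_intros \<phi>)
    moreover have "\<phi> t * \<Phi> t - T t = K t" using t by (simp add: K_def)
    ultimately have "\<forall>\<^sub>F s in nhds t. \<phi> s * \<Phi> s - T t = K s"
      and d: "((\<lambda>s. \<phi> s * \<Phi> s - T t) has_vector_derivative ?f t) (at t)"
      by (simp_all add: eventually_nhds_conv_at)
    then obtain U where "open U" "t \<in> U" "\<And>s. s \<in> U \<Longrightarrow> \<phi> s * \<Phi> s - T t = K s"
      unfolding eventually_nhds by blast
    then show ?thesis
      using has_vector_derivative_transform_within_open[OF d] by blast
  qed
  have "(?f has_integral (K b - K a)) {a..b}"
    using fundamental_theorem_of_calculus_interior_strong[OF S _ derK contK] ab by simp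
  \<comment> \<open>At points of S from b on, \<phi> vanishes, so at b the function T has collected
    all jumps.\<close>
  moreover have "K b = - (\<Sum>p\<in>S. \<phi> p * (R p - L p))"
  proof -
    have "T b = (\<Sum>p\<in>S. \<phi> p * (R p - L p))"
      unfolding T_def using S supp(1) by (intro sum.mono_neutral_left) auto
    then show ?thesis by (simp add: K_def supp)
  qed
  moreover have "K a = 0"
  proof -
    have "T a = 0" unfolding T_def by (intro sum.neutral) (simp add: supp)
    then show ?thesis by (simp add: K_def supp)
  qed
  ultimately have "(?f has_integral - (\<Sum>p\<in>S. \<phi> p * (R p - L p))) {a..b}" by simp
  then have "(?f has_integral - (\<Sum>p\<in>S. \<phi> p * (R p - L p))) UNIV"
    by (rule has_integral_on_superset) (auto simp: supp)
  moreover have "(?f has_integral (\<integral>t. ?f t \<partial>lborel)) UNIV"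
    by (rule has_integral_integral_lborel) (intro Bochner_Integration.integrable_add int1 int2)
  ultimately have "(\<integral>t. ?f t \<partial>lborel) = - (\<Sum>p\<in>S. \<phi> p * (R p - L p))" by (rule has_integral_unique[rotated])
  moreover have "(\<integral>t. ?f t \<partial>lborel) = (\<integral>t. \<phi> t * d t \<partial>lborel) + (\<integral>t. \<phi>' t * \<Phi> t \<partial>lborel)"
    by (intro Bochner_Integration.integral_add int1 int2)
  ultimately show ?thesis by (simp add: algebra_simps eq_neg_iff_add_eq_0)
qed

section \<open>The integrand and its cut-off at the diagonals\<close>

definition integrand :: "(real list \<Rightarrow> 'k::separable_chilbert) \<Rightarrow> 'k kernel \<Rightarrow> 'k kernel \<Rightarrow>
    (real list \<Rightarrow> 'k) \<Rightarrow> (block \<Rightarrow> real list) \<Rightarrow> complex" where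
  "integrand f F G g \<omega> = cinner (f (\<omega> Bpi))
     (blinfun_apply (F (\<omega> Bsigma1) (\<omega> Btau1) (\<omega> Bupsilon1))
       (blinfun_apply (G (\<omega> Bsigma2) (\<omega> Btau2) (\<omega> Bupsilon2)) (g (\<omega> Brho))))"

definition off_diagonals :: "real \<Rightarrow> (block \<Rightarrow> real list) \<Rightarrow> bool" where
  "off_diagonals t \<omega> \<longleftrightarrow> (t, \<omega> Bsigma1, \<omega> Btau1, \<omega> Bupsilon1) \<in> off_diagonal \<and>
     (t, \<omega> Bsigma2, \<omega> Btau2, \<omega> Bupsilon2) \<in> off_diagonal"

text \<open>Off the diagonals nothing is known about the measurability of kernels; cutting the integrand
  off there changes it on a null set only.\<close>

definition cut_integrand :: "real \<Rightarrow> (real list \<Rightarrow> 'k::separable_chilbert) \<Rightarrow> 'k kernel \<Rightarrow> 'k kernel \<Rightarrow>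
    (real list \<Rightarrow> 'k) \<Rightarrow> (block \<Rightarrow> real list) \<Rightarrow> complex" where
  "cut_integrand t f F G g \<omega> = (if off_diagonals t \<omega> then integrand f F G g \<omega> else 0)"

lemma bform_eq_integrand: "bform f F G g = (\<integral>\<omega>. integrand f F G g \<omega> \<partial>completion mm)"
  unfolding bform_def integrand_def ..

lemma norm_integrand_le: "norm (integrand f F G g \<omega>) \<le> norm_integrand f F G g \<omega>"
proof -
  let ?F = "F (\<omega> Bsigma1) (\<omega> Btau1) (\<omega> Bupsilon1)" and ?G = "G (\<omega> Bsigma2) (\<omega> Btau2) (\<omega> Bupsilon2)"
  have "norm (integrand f F G g \<omega>) \<le> norm (f (\<omega> Bpi)) * norm (blinfun_apply ?F (blinfun_apply ?G (g (\<omega> Brho))))"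
    unfolding integrand_def by (rule norm_cinner_le)
  also have "\<dots> \<le> norm (f (\<omega> Bpi)) * (norm ?F * (norm ?G * norm (g (\<omega> Brho))))"
    by (intro mult_left_mono order_trans[OF norm_blinfun] norm_blinfun) simp_all
  finally show ?thesis by (simp add: norm_integrand_def mult.assoc)
qed

lemma norm_integrand_mono:
  assumes "\<And>ts. norm (f ts) \<le> norm (u ts)" "\<And>ts. norm (g ts) \<le> norm (v ts)"
  shows "norm_integrand f F G g \<omega> \<le> norm_integrand u F G v \<omega>"
  unfolding norm_integrand_def by (intro mult_mono assms mult_nonneg_nonneg) simp_all

lemma norm_integrand_nonneg: "0 \<le> norm_integrand f F G g \<omega>"
  by (simp add: norm_integrand_def)

lemma off_diagonals_iff:
  "off_diagonals t \<omega> \<longleftrightarrow> distinct (concat (map \<omega> [Bsigma1, Btau1, Bupsilon1])) \<and>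
     distinct (concat (map \<omega> [Bsigma2, Btau2, Bupsilon2])) \<and>
     t \<notin> set (concat (map \<omega> [Bsigma1, Btau1, Bupsilon1, Bsigma2, Btau2, Bupsilon2]))"
  by (auto simp: off_diagonals_def off_diagonal_def)

lemma measurable_off_diagonals:
  "Measurable.pred (time_blocks_borel) (\<lambda>p. off_diagonals (fst p) (snd p))"
proof -
  have "Measurable.pred (time_blocks_borel) (\<lambda>p::real \<times> (block \<Rightarrow> real list). distinct (concat (map (snd p) bs)))" for bs
    by (rule measurable_compose[OF measurable_snd]) (use measurable_distinct_blocks in \<open>simp only: pred_def\<close>)
  moreover have "Measurable.pred (time_blocks_borel) (\<lambda>p. fst p \<notin> set (concat (map (snd p) bs)))" for bs
    unfolding pred_def by (rule measurable_notin_blocks)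
  moreover have "Measurable.pred M P \<Longrightarrow> Measurable.pred M Q \<Longrightarrow> Measurable.pred M (\<lambda>x. P x \<and> Q x)"
    for M :: "(real \<times> (block \<Rightarrow> real list)) measure" and P Q
    by (intro pred_intros_logic)
  ultimately show ?thesis unfolding off_diagonals_iff by blast
qed

lemma generic_off_diagonals: "generic \<omega> \<Longrightarrow> t \<notin> set (all_points \<omega>) \<Longrightarrow> off_diagonals t \<omega>"
  unfolding generic_def off_diagonals_def off_diagonal_def by fastforce

lemma off_diagonals_cong:
  assumes "\<And>b. mset (\<omega> b) = mset (\<omega>' b)"
  shows "off_diagonals t \<omega> = off_diagonals t \<omega>'"
proof -
  have "mset (concat (map \<omega> bs)) = mset (concat (map \<omega>' bs))" for bs
    by (induction bs) (simp_all add: assms)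
  then show ?thesis unfolding off_diagonals_iff by (metis mset_eq_imp_distinct_iff mset_eq_setD)
qed

text \<open>Treats a fixed test vector and \<open>annihilate t f\<close> alike: joint continuity in
  time and coordinates is for measurability, the bound uniform in t for integrability.\<close>

definition vector_path :: "(real list \<Rightarrow> 'k::separable_chilbert) \<Rightarrow> (real \<Rightarrow> real list \<Rightarrow> 'k) \<Rightarrow> bool" where
  "vector_path u f \<longleftrightarrow> (\<forall>n b. continuous_on UNIV (\<lambda>p. f (fst p) (assemble n (snd p) b))) \<and>
     (\<forall>t. symmetric (f t)) \<and> (\<forall>t ts. norm (f t ts) \<le> norm (u ts))"

lemma continuous_index: "continuous_on A (\<lambda>p::real \<times> (index \<Rightarrow> real). snd p c)"
  by (rule continuous_on_product_then_coordinatewise) (intro continuous_intros)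

lemma continuous_map_assemble_snd:
  "continuous_map (top_of_set A) config_topology (\<lambda>p::real \<times> (index \<Rightarrow> real). assemble n (snd p) b)"
  by (rule continuous_map_assemble) (simp add: continuous_index)

lemma vector_path_const:
  assumes "f \<in> test_vectors" "\<And>ts. norm (f ts) \<le> norm (u ts)"
  shows "vector_path u (\<lambda>_. f)"
proof -
  have "continuous_map euclidean euclidean (f \<circ> (\<lambda>p::real \<times> (index \<Rightarrow> real). assemble n (snd p) b))" for n b
    using assms(1) continuous_map_assemble_snd[of UNIV] unfolding test_vectors_def
    by (intro continuous_map_compose) auto
  then show ?thesis using assms unfolding vector_path_def test_vectors_def by (simp add: comp_def)
qed

lemma vector_path_annihilate:
  assumes f: "f \<in> test_vectors" and bound: "\<And>t ts. norm (f (t # ts)) \<le> norm (u ts)"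
  shows "vector_path u (\<lambda>t. annihilate t f)"
proof -
  have "continuous_map euclidean euclidean (f \<circ> (\<lambda>p::real \<times> (index \<Rightarrow> real). fst p # assemble n (snd p) b))" for n b
  proof (rule continuous_map_compose)
    \<comment> \<open>Prepending the time shifts the coordinates of the block by one.\<close>
    have eq: "fst p # assemble n (snd p) b = map (\<lambda>i. case i of 0 \<Rightarrow> fst p | Suc i \<Rightarrow> snd p (b, i)) [0..<Suc (n b)]"
      for p :: "real \<times> (index \<Rightarrow> real)"
      by (rule nth_equalityI) (auto simp: assemble_def nth_Cons split: nat.split simp del: upt_Suc)
    show "continuous_map euclidean config_topology (\<lambda>p::real \<times> (index \<Rightarrow> real). fst p # assemble n (snd p) b)"
      unfolding eq
    proof (rule continuous_map_into_config)
      fix i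
      show "continuous_map euclidean euclideanreal (\<lambda>p::real \<times> (index \<Rightarrow> real). case i of 0 \<Rightarrow> fst p | Suc i \<Rightarrow> snd p (b, i))"
        by (cases i) (simp_all add: continuous_index continuous_on_fst)
    qed
    show "continuous_map config_topology euclidean f" using f unfolding test_vectors_def by simp
  qed
  moreover have "symmetric (annihilate t f)" for t
    using f unfolding test_vectors_def annihilate_def symmetric_def by (metis (mono_tags, lifting) mem_Collect_eq mset.simps(2))
  ultimately show ?thesis using bound unfolding vector_path_def by (simp add: annihilate_def comp_def)
qed

text \<open>Transports the continuity required in \<open>class_C0\<close> from lists to real
  coordinates.\<close>

lemma continuous_on_kernel:
  assumes F: "class_C0 F" and A: "\<And>p. p \<in> A \<Longrightarrow> (fst p, assemble n (snd p) b1, assemble n (snd p) b2, assemble n (snd p) b3) \<in> off_diagonal"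
  shows "continuous_on A (\<lambda>p. F (fst p) (assemble n (snd p) b1) (assemble n (snd p) b2) (assemble n (snd p) b3))"
proof -
  let ?q = "\<lambda>p::real \<times> (index \<Rightarrow> real). (fst p, assemble n (snd p) b1, assemble n (snd p) b2, assemble n (snd p) b3)"
  have "continuous_map (top_of_set A) kernel_topology ?q"
    unfolding kernel_topology_def
    by (intro continuous_map_pairedI continuous_map_assemble_snd) (simp add: continuous_on_fst)
  then have "continuous_map (top_of_set A) (subtopology kernel_topology off_diagonal) ?q"
    unfolding continuous_map_in_subtopology using A by auto
  moreover have "continuous_map (subtopology kernel_topology off_diagonal) euclidean (\<lambda>(t, \<sigma>, \<tau>, \<upsilon>). F t \<sigma> \<tau> \<upsilon>)"
    using F unfolding class_C0_def by blast
  ultimately have "continuous_map (top_of_set A) euclidean ((\<lambda>(t, \<sigma>, \<tau>, \<upsilon>). F t \<sigma> \<tau> \<upsilon>) \<circ> ?q)"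
    by (rule continuous_map_compose)
  then show ?thesis by (simp add: comp_def)
qed

text \<open>In real coordinates, the set off the diagonals is Borel and the integrand is continuous
  on it. Extension by zero is then Borel jointly in time and configuration, as Fubini's theorem
  requires.\<close>

lemma measurable_cut_integrand:
  assumes F: "class_C0 F" and G: "class_C0 G" and f: "vector_path u f" and g: "vector_path v g"
  shows "(\<lambda>p. cut_integrand (fst p) (f (fst p)) (F (fst p)) (G (fst p)) (g (fst p)) (snd p))
    \<in> borel_measurable (time_blocks_borel)"
proof -
  have "(\<lambda>(t, \<omega>). cut_integrand t (f t) (F t) (G t) (g t) \<omega>) \<in> borel_measurable (time_blocks_borel)"
  proof (rule measurable_by_strata)
    fix n
    let ?A = "{p. off_diagonals (fst p) (assemble n (snd p))}"
    let ?h = "\<lambda>p::real \<times> (index \<Rightarrow> real). integrand (f (fst p)) (F (fst p)) (G (fst p)) (g (fst p)) (assemble n (snd p))"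
    have A: "?A \<in> sets borel"
    proof -
      have "(\<lambda>p::real \<times> (index \<Rightarrow> real). (fst p, assemble n (snd p))) \<in> borel \<Otimes>\<^sub>M borel \<rightarrow>\<^sub>M time_blocks_borel"
        by (intro measurable_Pair measurable_assemble measurable_compose[OF measurable_snd measurable_index]) simp
      from measurable_compose[OF this measurable_off_diagonals]
      have "Measurable.pred (borel \<Otimes>\<^sub>M borel) (\<lambda>p::real \<times> (index \<Rightarrow> real). off_diagonals (fst p) (assemble n (snd p)))" by simp
      then show ?thesis unfolding pred_def borel_prod by simp
    qed
    have "continuous_on ?A ?h"
      unfolding integrand_def
    proof (intro bounded_bilinear.continuous_on[OF bounded_bilinear_cinner]
        bounded_bilinear.continuous_on[OF bounded_bilinear_blinfun_apply] continuous_on_kernel F G)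
      show "continuous_on ?A (\<lambda>p. f (fst p) (assemble n (snd p) Bpi))"
        using f unfolding vector_path_def by (blast intro: continuous_on_subset)
      show "continuous_on ?A (\<lambda>p. g (fst p) (assemble n (snd p) Brho))"
        using g unfolding vector_path_def by (blast intro: continuous_on_subset)
    qed (auto simp: off_diagonals_def)
    then have "(\<lambda>p. if p \<in> ?A then ?h p else 0) \<in> borel_measurable borel"
      using A by (intro borel_measurable_continuous_on_if) simp_all
    then show "(\<lambda>(t, r). cut_integrand t (f t) (F t) (G t) (g t) (assemble n r)) \<in> borel_measurable (borel \<Otimes>\<^sub>M borel)"
      unfolding borel_prod by (simp add: cut_integrand_def case_prod_beta)
  qed
  then show ?thesis by (simp add: case_prod_beta)
qed

lemma block_symmetric_cut_integrand:
  assumes F: "class_C0 F" and G: "class_C0 G" and f: "symmetric f" and g: "symmetric g"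
  shows "block_symmetric (cut_integrand t f (F s) (G s) g)"
  unfolding block_symmetric_def
proof (intro allI impI)
  fix \<omega> \<omega>' :: "block \<Rightarrow> real list" assume "\<forall>b. mset (\<omega> b) = mset (\<omega>' b)"
  then have eq: "mset (\<omega> b) = mset (\<omega>' b)" for b by simp
  have sym: "K s (\<omega> b1) (\<omega> b2) (\<omega> b3) = K s (\<omega>' b1) (\<omega>' b2) (\<omega>' b3)" if "class_C0 K"
    for K :: "real \<Rightarrow> 'a kernel" and b1 b2 b3
  proof -
    have "K s (\<omega> b1) (\<omega> b2) (\<omega> b3) = K s (\<omega>' b1) (\<omega> b2) (\<omega> b3)"
      using that eq[of b1] unfolding class_C0_def symmetric_def by blast
    also have "\<dots> = K s (\<omega>' b1) (\<omega>' b2) (\<omega> b3)"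
      using that eq[of b2] unfolding class_C0_def symmetric_def by blast
    also have "\<dots> = K s (\<omega>' b1) (\<omega>' b2) (\<omega>' b3)"
      using that eq[of b3] unfolding class_C0_def symmetric_def by blast
    finally show ?thesis .
  qed
  have "f (\<omega> Bpi) = f (\<omega>' Bpi)" "g (\<omega> Brho) = g (\<omega>' Brho)"
    using f g eq unfolding symmetric_def by blast+
  then show "cut_integrand t f (F s) (G s) g \<omega> = cut_integrand t f (F s) (G s) g \<omega>'"
    using sym[OF F] sym[OF G] off_diagonals_cong[of \<omega> \<omega>' t, OF eq]
    by (simp add: cut_integrand_def integrand_def)
qed

lemma AE_off_diagonals: "AE \<omega> in mm. off_diagonals t \<omega>"
  using AE_mm_generic AE_mm_notin_all_points[of t] by eventually_elim (rule generic_off_diagonals)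

text \<open>Meant for the uncut integrand, whose values on the diagonals are arbitrary: the
  completion absorbs changes on null sets.\<close>

lemma measurable_completion_cong_AE:
  assumes h: "h \<in> borel_measurable M" and ae: "AE \<omega> in M. h \<omega> = k \<omega>"
  shows "k \<in> borel_measurable (completion M)"
proof (rule measurableI)
  fix A :: "'b set" assume A: "A \<in> sets borel"
  have "AE \<omega> in completion M. \<omega> \<in> h -` A \<inter> space M \<longleftrightarrow> \<omega> \<in> k -` A \<inter> space M"
    using AE_completion[OF ae] by eventually_elim auto
  moreover have "h -` A \<inter> space M \<in> sets (completion M)"
    using measurable_sets[OF h A] by simp
  ultimately have "k -` A \<inter> space M \<in> sets (completion M)"
    by (rule completion.in_sets_AE) auto
  then show "k -` A \<inter> space (completion M) \<in> sets (completion M)" by simp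
qed simp

lemma measurable_section:
  assumes "(\<lambda>p. h (fst p) (snd p)) \<in> borel_measurable (time_blocks_borel)"
  shows "h t \<in> borel_measurable mm"
proof -
  have "(\<lambda>\<omega>. h (fst (t, \<omega>)) (snd (t, \<omega>))) \<in> borel_measurable blocks_borel"
    by (rule measurable_compose[OF measurable_Pair1' assms]) simp
  then show ?thesis by (intro measurable_mm) simp
qed

lemma bform_eq_cut:
  assumes F: "class_C0 F" and G: "class_C0 G" and f: "vector_path u f" and g: "vector_path v g"
  shows "bform (f t) (F t) (G t) (g t) = (\<integral>\<omega>. cut_integrand t (f t) (F t) (G t) (g t) \<omega> \<partial>mm)"
    and "integrand (f t) (F t) (G t) (g t) \<in> borel_measurable (completion mm)"
proof -
  let ?c = "cut_integrand t (f t) (F t) (G t) (g t)" and ?i = "integrand (f t) (F t) (G t) (g t)"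
  have m: "?c \<in> borel_measurable mm"
    by (rule measurable_section[where h = "\<lambda>t. cut_integrand t (f t) (F t) (G t) (g t)",
          OF measurable_cut_integrand[OF F G f g]])
  have ae: "AE \<omega> in mm. ?c \<omega> = ?i \<omega>"
    using AE_off_diagonals[of t] by eventually_elim (simp add: cut_integrand_def)
  show mi: "?i \<in> borel_measurable (completion mm)" by (rule measurable_completion_cong_AE[OF m ae])
  have "bform (f t) (F t) (G t) (g t) = (\<integral>\<omega>. ?c \<omega> \<partial>completion mm)"
    unfolding bform_eq_integrand
  proof (rule integral_cong_AE[OF mi measurable_completion[OF m]])
    show "AE \<omega> in completion mm. ?i \<omega> = ?c \<omega>"
      using AE_completion[OF ae] by eventually_elim simp
  qed
  also have "\<dots> = (\<integral>\<omega>. ?c \<omega> \<partial>mm)" by (rule integral_completion[OF m])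
  finally show "bform (f t) (F t) (G t) (g t) = (\<integral>\<omega>. ?c \<omega> \<partial>mm)" .
qed

section \<open>Integrability of the forms\<close>

lemma C1_family_class_C0: "class_C1 x \<Longrightarrow> F \<in> C1_family x \<Longrightarrow> class_C0 F"
  unfolding class_C1_def C1_family_def by auto

lemma locally_integrable_add:
  fixes h k :: "real \<Rightarrow> complex"
  assumes "locally_integrable euclideanreal lborel h" "locally_integrable euclideanreal lborel k"
  shows "locally_integrable euclideanreal lborel (\<lambda>t. h t + k t)"
proof -
  have [measurable]: "h \<in> borel_measurable lebesgue" "k \<in> borel_measurable lebesgue"
    using assms unfolding locally_integrable_def by auto
  have "(\<integral>\<^sup>+t\<in>K. ennreal (norm (h t + k t)) \<partial>lebesgue) < \<infinity>" if K: "compactin euclideanreal K" for K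
  proof -
    have "compact K" using K by simp
    then have [measurable]: "K \<in> sets lebesgue" by (intro sets_completionI_sets) (simp add: borel_compact)
    have "(\<integral>\<^sup>+t\<in>K. ennreal (norm (h t + k t)) \<partial>lebesgue) \<le>
      (\<integral>\<^sup>+t. ennreal (norm (h t)) * indicator K t + ennreal (norm (k t)) * indicator K t \<partial>lebesgue)"
      by (intro nn_integral_mono)
        (auto simp: norm_triangle_ineq split: split_indicator simp flip: ennreal_plus)
    also have "\<dots> = (\<integral>\<^sup>+t\<in>K. ennreal (norm (h t)) \<partial>lebesgue) + (\<integral>\<^sup>+t\<in>K. ennreal (norm (k t)) \<partial>lebesgue)"
      by (rule nn_integral_add) measurable
    also have "\<dots> < \<infinity>" using assms K unfolding locally_integrable_def by (simp add: less_top)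
    finally show ?thesis .
  qed
  moreover have "(\<lambda>t. h t + k t) \<in> borel_measurable lebesgue" by measurable
  ultimately show ?thesis unfolding locally_integrable_def by blast
qed

lemma locally_integrable_uminus:
  fixes h :: "real \<Rightarrow> complex"
  shows "locally_integrable euclideanreal lborel h \<Longrightarrow> locally_integrable euclideanreal lborel (\<lambda>t. - h t)"
  unfolding locally_integrable_def by simp

lemma locally_integrable_diff:
  fixes h k :: "real \<Rightarrow> complex"
  assumes "locally_integrable euclideanreal lborel h" "locally_integrable euclideanreal lborel k"
  shows "locally_integrable euclideanreal lborel (\<lambda>t. h t - k t)"
  using locally_integrable_add[OF assms(1) locally_integrable_uminus[OF assms(2)]] by simp

text \<open>The forms in Ito's formula contain \<open>annihilate t f\<close>, which varies with \<open>t\<close>, while the hypotheses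
  concern fixed test vectors. They are applied to test vectors \<open>u\<close> and \<open>v\<close> that dominate \<open>f\<close> and
  \<open>g\<close> as well as all \<open>annihilate t f\<close> and \<open>annihilate t g\<close>.\<close>

locale ito_pair =
  fixes x y :: "real \<Rightarrow> 'k::separable_chilbert kernel" and u v :: "real list \<Rightarrow> 'k"
  assumes C1_x: "class_C1 x" and C1_y: "class_C1 y"
    and ex_norm: "\<And>F G t. F \<in> C1_family x \<Longrightarrow> G \<in> C1_family y \<Longrightarrow> exists_in_norm u (F t) (G t) v"
    and int_norm: "\<And>F G. F \<in> C1_family x \<Longrightarrow> G \<in> C1_family y \<Longrightarrow> locally_integrable_in_norm u F G v"
begin

abbreviation cut_form :: "(real \<Rightarrow> real list \<Rightarrow> 'k) \<Rightarrow> (real \<Rightarrow> 'k kernel) \<Rightarrow> (real \<Rightarrow> 'k kernel) \<Rightarrow>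
    (real \<Rightarrow> real list \<Rightarrow> 'k) \<Rightarrow> real \<times> (block \<Rightarrow> real list) \<Rightarrow> complex" where
  "cut_form f F G g p \<equiv> cut_integrand (fst p) (f (fst p)) (F (fst p)) (G (fst p)) (g (fst p)) (snd p)"

context
  fixes F G :: "real \<Rightarrow> 'k kernel" and f g :: "real \<Rightarrow> real list \<Rightarrow> 'k"
  assumes F: "F \<in> C1_family x" and G: "G \<in> C1_family y"
    and f: "vector_path u f" and g: "vector_path v g"
begin

lemmas C0_F = C1_family_class_C0[OF C1_x F] and C0_G = C1_family_class_C0[OF C1_y G]

lemma integrand_bound: "norm (integrand (f t) (F t) (G t) (g t) \<omega>) \<le> norm_integrand u (F t) (G t) v \<omega>"
  using norm_integrand_le norm_integrand_mono f g unfolding vector_path_def by (meson order_trans)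

lemma cut_bound: "norm (cut_form f F G g (t, \<omega>)) \<le> norm_integrand u (F t) (G t) v \<omega>"
  using integrand_bound[of t \<omega>] norm_integrand_nonneg[of u "F t" "G t" v \<omega>]
  by (simp add: cut_integrand_def)

lemma integrable_integrand: "integrable (completion mm) (integrand (f t) (F t) (G t) (g t))"
  using ex_norm[OF F G, of t] unfolding exists_in_norm_def
  by (rule Bochner_Integration.integrable_bound)
    (auto simp: bform_eq_cut(2)[OF C0_F C0_G f g] norm_integrand_nonneg integrand_bound)

lemma measurable_cut_form: "cut_form f F G g \<in> borel_measurable (lborel \<Otimes>\<^sub>M mm)"
  by (rule measurable_lborel_mm[OF measurable_cut_integrand[OF C0_F C0_G f g]])

lemma measurable_cut_section: "(\<lambda>\<omega>. cut_form f F G g (t, \<omega>)) \<in> borel_measurable mm"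
  using measurable_section[where h = "\<lambda>t. cut_integrand t (f t) (F t) (G t) (g t)",
      OF measurable_cut_integrand[OF C0_F C0_G f g]] by simp

lemma bform_eq: "bform (f t) (F t) (G t) (g t) = (\<integral>\<omega>. cut_form f F G g (t, \<omega>) \<partial>mm)"
  using bform_eq_cut(1)[OF C0_F C0_G f g] by simp

text \<open>The bound is finite by existence in norm at the time t. The norm around the nonnegative
  integral matches the shape of \<open>locally_integrable_in_norm\<close>.\<close>

lemma nn_integral_cut_le:
  "(\<integral>\<^sup>+ \<omega>. ennreal (norm (cut_form f F G g (t, \<omega>))) \<partial>mm) \<le>
     ennreal (norm (\<integral>\<omega>. norm_integrand u (F t) (G t) v \<omega> \<partial>completion mm))"
proof -
  have "(\<integral>\<^sup>+ \<omega>. ennreal (norm (cut_form f F G g (t, \<omega>))) \<partial>mm) =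
      (\<integral>\<^sup>+ \<omega>. ennreal (norm (cut_form f F G g (t, \<omega>))) \<partial>completion mm)"
    by (rule nn_integral_completion[symmetric])
  also have "\<dots> \<le> (\<integral>\<^sup>+ \<omega>. ennreal (norm_integrand u (F t) (G t) v \<omega>) \<partial>completion mm)"
    by (intro nn_integral_mono ennreal_leI cut_bound)
  also have "\<dots> = ennreal (\<integral>\<omega>. norm_integrand u (F t) (G t) v \<omega> \<partial>completion mm)"
    using ex_norm[OF F G, of t] unfolding exists_in_norm_def
    by (rule nn_integral_eq_integral) (simp add: norm_integrand_nonneg)
  also have "\<dots> \<le> ennreal (norm (\<integral>\<omega>. norm_integrand u (F t) (G t) v \<omega> \<partial>completion mm))"
    by (intro ennreal_leI) simp
  finally show ?thesis .
qed

text \<open>Here local integrability in norm enters: it controls time and configuration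
  together.\<close>

lemma nn_integral_cut_finite:
  assumes "compact K"
  shows "(\<integral>\<^sup>+ t\<in>K. (\<integral>\<^sup>+ \<omega>. ennreal (norm (cut_form f F G g (t, \<omega>))) \<partial>mm) \<partial>lborel) < \<infinity>"
proof -
  let ?N = "\<lambda>t. ennreal (norm (\<integral>\<omega>. norm_integrand u (F t) (G t) v \<omega> \<partial>completion mm))"
  have "(\<integral>\<^sup>+ t\<in>K. (\<integral>\<^sup>+ \<omega>. ennreal (norm (cut_form f F G g (t, \<omega>))) \<partial>mm) \<partial>lborel) \<le> (\<integral>\<^sup>+ t\<in>K. ?N t \<partial>lborel)"
    by (intro nn_integral_mono mult_right_mono nn_integral_cut_le) simp
  also have "\<dots> = (\<integral>\<^sup>+ t\<in>K. ?N t \<partial>lebesgue)" by (rule nn_integral_completion[symmetric])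
  also have "\<dots> < \<infinity>"
    using int_norm[OF F G] assms unfolding locally_integrable_in_norm_def locally_integrable_def by simp
  finally show ?thesis .
qed

lemma integrable_cut_section: "integrable mm (\<lambda>\<omega>. cut_form f F G g (t, \<omega>))"
proof (rule integrableI_bounded[OF measurable_cut_section])
  show "(\<integral>\<^sup>+ \<omega>. ennreal (norm (cut_form f F G g (t, \<omega>))) \<partial>mm) < \<infinity>"
    using nn_integral_cut_le[of t] by (rule le_less_trans) simp
qed

text \<open>In use, \<psi> is a test function or its derivative; its compact support confines the
  time to K. This absolute integrability licenses the exchanges of time and configuration
  integrals.\<close>

lemma integrable_cut_form:
  fixes \<psi> :: "real \<Rightarrow> complex"
  assumes [measurable]: "\<psi> \<in> borel_measurable borel" and K: "compact K"
    and bound: "\<And>t. norm (\<psi> t) \<le> C * indicator K t"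
  shows "integrable (lborel \<Otimes>\<^sub>M mm) (\<lambda>p. \<psi> (fst p) * cut_form f F G g p)"
proof (rule integrableI_bounded)
  note [measurable] = measurable_cut_form
  show m: "(\<lambda>p. \<psi> (fst p) * cut_form f F G g p) \<in> borel_measurable (lborel \<Otimes>\<^sub>M mm)" by measurable
  have K' [measurable]: "K \<in> sets borel" using K by (rule borel_compact)
  have m2: "(\<lambda>t. \<integral>\<^sup>+ \<omega>. ennreal (norm (cut_form f F G g (t, \<omega>))) \<partial>mm) \<in> borel_measurable lborel"
    by (rule mm.borel_measurable_nn_integral_fst) measurable
  have "(\<integral>\<^sup>+ p. ennreal (norm (\<psi> (fst p) * cut_form f F G g p)) \<partial>(lborel \<Otimes>\<^sub>M mm)) =
      (\<integral>\<^sup>+ t. \<integral>\<^sup>+ \<omega>. ennreal (norm (\<psi> t)) * ennreal (norm (cut_form f F G g (t, \<omega>))) \<partial>mm \<partial>lborel)"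
    by (subst mm.nn_integral_fst[symmetric]) (simp_all add: norm_mult ennreal_mult measurable_compose[OF m])
  also have "\<dots> = (\<integral>\<^sup>+ t. ennreal (norm (\<psi> t)) * (\<integral>\<^sup>+ \<omega>. ennreal (norm (cut_form f F G g (t, \<omega>))) \<partial>mm) \<partial>lborel)"
    using measurable_cut_section by (intro nn_integral_cong nn_integral_cmult) measurable
  also have "\<dots> \<le> (\<integral>\<^sup>+ t. ennreal C * ((\<integral>\<^sup>+ \<omega>. ennreal (norm (cut_form f F G g (t, \<omega>))) \<partial>mm) * indicator K t) \<partial>lborel)"
  proof (rule nn_integral_mono)
    fix t
    let ?I = "\<integral>\<^sup>+ \<omega>. ennreal (norm (cut_form f F G g (t, \<omega>))) \<partial>mm"
    have "ennreal (norm (\<psi> t)) \<le> ennreal C * indicator K t"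
      using bound[of t] by (auto split: split_indicator simp: ennreal_leI)
    then have "ennreal (norm (\<psi> t)) * ?I \<le> ennreal C * indicator K t * ?I" by (rule mult_right_mono) simp
    then show "ennreal (norm (\<psi> t)) * ?I \<le> ennreal C * (?I * indicator K t)" by (simp add: ac_simps)
  qed
  also have "\<dots> = ennreal C * (\<integral>\<^sup>+ t\<in>K. (\<integral>\<^sup>+ \<omega>. ennreal (norm (cut_form f F G g (t, \<omega>))) \<partial>mm) \<partial>lborel)"
    using m2 by (intro nn_integral_cmult) measurable
  also have "\<dots> < \<infinity>"
    using nn_integral_cut_finite[OF K] by (simp add: ennreal_mult_less_top)
  finally show "(\<integral>\<^sup>+ p. ennreal (norm (\<psi> (fst p) * cut_form f F G g p)) \<partial>(lborel \<Otimes>\<^sub>M mm)) < \<infinity>" .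
qed

lemma
  fixes \<psi> :: "real \<Rightarrow> complex"
  assumes "\<psi> \<in> borel_measurable borel" and "compact K" and "\<And>t. norm (\<psi> t) \<le> C * indicator K t"
  shows integrable_bform: "integrable lborel (\<lambda>t. \<psi> t * bform (f t) (F t) (G t) (g t))"
    and integral_bform: "(\<integral>t. \<psi> t * bform (f t) (F t) (G t) (g t) \<partial>lborel) =
      (\<integral>p. \<psi> (fst p) * cut_form f F G g p \<partial>(lborel \<Otimes>\<^sub>M mm))"
proof -
  have eq: "(\<integral>\<omega>. \<psi> (fst (t, \<omega>)) * cut_form f F G g (t, \<omega>) \<partial>mm) = \<psi> t * bform (f t) (F t) (G t) (g t)" for t
    unfolding bform_eq by simp
  show "integrable lborel (\<lambda>t. \<psi> t * bform (f t) (F t) (G t) (g t))"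
    using lborel_mm.integrable_fst'[OF integrable_cut_form[OF assms]] unfolding eq .
  show "(\<integral>t. \<psi> t * bform (f t) (F t) (G t) (g t) \<partial>lborel) =
      (\<integral>p. \<psi> (fst p) * cut_form f F G g p \<partial>(lborel \<Otimes>\<^sub>M mm))"
    using lborel_mm.integral_fst'[OF integrable_cut_form[OF assms]] unfolding eq .
qed

lemma measurable_bform: "(\<lambda>t. bform (f t) (F t) (G t) (g t)) \<in> borel_measurable borel"
proof -
  have "(\<lambda>t. \<integral>\<omega>. cut_form f F G g (t, \<omega>) \<partial>mm) \<in> borel_measurable lborel"
    using measurable_cut_form by (intro mm.borel_measurable_lebesgue_integral) (simp add: case_prod_beta')
  then show ?thesis unfolding bform_eq by simp
qed

lemma locally_integrable_bform:
  "locally_integrable euclideanreal lborel (\<lambda>t. bform (f t) (F t) (G t) (g t))"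
  unfolding locally_integrable_def
proof (intro conjI allI impI)
  show "(\<lambda>t. bform (f t) (F t) (G t) (g t)) \<in> borel_measurable lebesgue"
    using measurable_bform by (intro measurable_completion) simp
  fix K assume "compactin euclideanreal K"
  then have K: "compact K" by simp
  have "(\<integral>\<^sup>+t\<in>K. ennreal (norm (bform (f t) (F t) (G t) (g t))) \<partial>lebesgue) =
      (\<integral>\<^sup>+t\<in>K. ennreal (norm (bform (f t) (F t) (G t) (g t))) \<partial>lborel)"
    by (rule nn_integral_completion)
  also have "\<dots> \<le> (\<integral>\<^sup>+ t\<in>K. (\<integral>\<^sup>+ \<omega>. ennreal (norm (cut_form f F G g (t, \<omega>))) \<partial>mm) \<partial>lborel)"
    unfolding bform_eq
    by (intro nn_integral_mono mult_right_mono integral_norm_bound_ennreal integrable_cut_section) simp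
  also have "\<dots> < \<infinity>" by (rule nn_integral_cut_finite[OF K])
  finally show "(\<integral>\<^sup>+t\<in>K. ennreal (norm (bform (f t) (F t) (G t) (g t))) \<partial>lebesgue) < \<infinity>" .
qed

end

end

section \<open>Derivatives and one-sided limits\<close>

lemma C1_has_vector_derivative:
  assumes "class_C1 x" "(t, \<sigma>, \<tau>, \<upsilon>) \<in> off_diagonal"
  shows "((\<lambda>s. x s \<sigma> \<tau> \<upsilon>) has_vector_derivative cderiv x t \<sigma> \<tau> \<upsilon>) (at t)"
proof -
  have "(\<lambda>s. x s \<sigma> \<tau> \<upsilon>) differentiable (at t)" using assms unfolding class_C1_def by blast
  then show ?thesis using assms(2) by (simp add: cderiv_def vector_derivative_works)
qed

text \<open>\<open>None\<close> stands for a point that does not enter the kernel. The one-sided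
  values are then the value itself, by continuity in time, so one formalism covers all chain
  types.\<close>

definition insert_slot :: "slot option \<Rightarrow> real \<Rightarrow> 'k kernel \<Rightarrow> 'k kernel" where
  "insert_slot j = (case j of None \<Rightarrow> (\<lambda>_ F. F) | Some i \<Rightarrow> insert_time i)"

definition right_value :: "slot option \<Rightarrow> (real \<Rightarrow> 'k::separable_chilbert kernel) \<Rightarrow> real \<Rightarrow> 'k kernel" where
  "right_value j x = (case j of None \<Rightarrow> x | Some i \<Rightarrow> Rplus i x)"

definition left_value :: "slot option \<Rightarrow> (real \<Rightarrow> 'k::separable_chilbert kernel) \<Rightarrow> real \<Rightarrow> 'k kernel" where
  "left_value j x = (case j of None \<Rightarrow> x | Some i \<Rightarrow> Rminus i x)"

lemma right_value_family: "right_value j x \<in> C1_family x"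
  and left_value_family: "left_value j x \<in> C1_family x"
  unfolding right_value_def left_value_def C1_family_def by (cases j; simp)+

lemma C1_one_sided_limits:
  assumes x: "class_C1 x" and off: "(t, \<sigma>, \<tau>, \<upsilon>) \<in> off_diagonal"
  shows "((\<lambda>s. insert_slot j t (x s) \<sigma> \<tau> \<upsilon>) \<longlongrightarrow> right_value j x t \<sigma> \<tau> \<upsilon>) (at_right t)"
    and "((\<lambda>s. insert_slot j t (x s) \<sigma> \<tau> \<upsilon>) \<longlongrightarrow> left_value j x t \<sigma> \<tau> \<upsilon>) (at_left t)"
proof -
  have c: "((\<lambda>s. x s \<sigma> \<tau> \<upsilon>) \<longlongrightarrow> x t \<sigma> \<tau> \<upsilon>) (at t within A)" for A
    using C1_has_vector_derivative[OF x off]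
    by (metis has_vector_derivative_continuous continuous_at_imp_continuous_at_within continuous_within)
  show "((\<lambda>s. insert_slot j t (x s) \<sigma> \<tau> \<upsilon>) \<longlongrightarrow> right_value j x t \<sigma> \<tau> \<upsilon>) (at_right t)"
  proof (cases j)
    case None then show ?thesis using c by (simp add: insert_slot_def right_value_def)
  next
    case (Some i)
    obtain A where A: "((\<lambda>s. insert_time i t (x s) \<sigma> \<tau> \<upsilon>) \<longlongrightarrow> A) (at_right t)"
      using x off unfolding class_C1_def by blast
    then have "Lim (at_right t) (\<lambda>s. insert_time i t (x s) \<sigma> \<tau> \<upsilon>) = A"
      by (intro tendsto_Lim) simp
    then show ?thesis using A off Some by (simp add: insert_slot_def right_value_def Rplus_def)
  qed
  show "((\<lambda>s. insert_slot j t (x s) \<sigma> \<tau> \<upsilon>) \<longlongrightarrow> left_value j x t \<sigma> \<tau> \<upsilon>) (at_left t)"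
  proof (cases j)
    case None then show ?thesis using c by (simp add: insert_slot_def left_value_def)
  next
    case (Some i)
    obtain A where A: "((\<lambda>s. insert_time i t (x s) \<sigma> \<tau> \<upsilon>) \<longlongrightarrow> A) (at_left t)"
      using x off unfolding class_C1_def by blast
    then have "Lim (at_left t) (\<lambda>s. insert_time i t (x s) \<sigma> \<tau> \<upsilon>) = A"
      by (intro tendsto_Lim) simp
    then show ?thesis using A off Some by (simp add: insert_slot_def left_value_def Rminus_def)
  qed
qed

text \<open>The time p may occur among the arguments, but only once. By symmetry it can be moved to
  the front of its argument, and the remaining arguments are off the diagonal at p, where
  \<open>C1_one_sided_limits\<close> applies.\<close>

lemma C1_limits_exist:
  assumes x: "class_C1 x" and dist: "distinct (\<sigma> @ \<tau> @ \<upsilon>)"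
  obtains A B where "((\<lambda>s. x s \<sigma> \<tau> \<upsilon>) \<longlongrightarrow> A) (at_left p)" "((\<lambda>s. x s \<sigma> \<tau> \<upsilon>) \<longlongrightarrow> B) (at_right p)"
proof -
  have sym: "symmetric (\<lambda>\<alpha>. x t \<alpha> \<tau> \<upsilon>)" "symmetric (\<lambda>\<alpha>. x t \<sigma> \<alpha> \<upsilon>)" "symmetric (\<lambda>\<alpha>. x t \<sigma> \<tau> \<alpha>)" for t \<sigma> \<tau> \<upsilon>
  proof -
    have "class_C0 x" using x unfolding class_C1_def by blast
    then show "symmetric (\<lambda>\<alpha>. x t \<alpha> \<tau> \<upsilon>)" "symmetric (\<lambda>\<alpha>. x t \<sigma> \<alpha> \<upsilon>)" "symmetric (\<lambda>\<alpha>. x t \<sigma> \<tau> \<alpha>)"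
      unfolding class_C0_def by blast+
  qed
  obtain j \<sigma>' \<tau>' \<upsilon>' where "(p, \<sigma>', \<tau>', \<upsilon>') \<in> off_diagonal"
    and eq: "\<And>s. x s \<sigma> \<tau> \<upsilon> = insert_slot j p (x s) \<sigma>' \<tau>' \<upsilon>'"
  proof -
    consider "p \<notin> set (\<sigma> @ \<tau> @ \<upsilon>)" | "p \<in> set \<sigma>" | "p \<in> set \<tau>" | "p \<in> set \<upsilon>" by auto
    then show thesis
    proof cases
      case 1
      then show ?thesis using dist by (intro that[of \<sigma> \<tau> \<upsilon> None]) (auto simp: off_diagonal_def insert_slot_def)
    next
      case 2
      then have "mset \<sigma> = mset (p # remove1 p \<sigma>)" by simp
      then have "x s \<sigma> \<tau> \<upsilon> = x s (p # remove1 p \<sigma>) \<tau> \<upsilon>" for s using sym(1) unfolding symmetric_def by blast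
      moreover have "(p, remove1 p \<sigma>, \<tau>, \<upsilon>) \<in> off_diagonal"
        using dist 2 unfolding off_diagonal_def by (auto dest: in_set_remove1[THEN iffD1, rotated] notin_set_remove1)
      ultimately show ?thesis by (intro that[of "remove1 p \<sigma>" \<tau> \<upsilon> "Some Creation"]) (auto simp: insert_slot_def)
    next
      case 3
      then have "mset \<tau> = mset (p # remove1 p \<tau>)" by simp
      then have "x s \<sigma> \<tau> \<upsilon> = x s \<sigma> (p # remove1 p \<tau>) \<upsilon>" for s using sym(2) unfolding symmetric_def by blast
      moreover have "(p, \<sigma>, remove1 p \<tau>, \<upsilon>) \<in> off_diagonal"
        using dist 3 unfolding off_diagonal_def by auto
      ultimately show ?thesis by (intro that[of \<sigma> "remove1 p \<tau>" \<upsilon> "Some Number"]) (auto simp: insert_slot_def)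
    next
      case 4
      then have "mset \<upsilon> = mset (p # remove1 p \<upsilon>)" by simp
      then have "x s \<sigma> \<tau> \<upsilon> = x s \<sigma> \<tau> (p # remove1 p \<upsilon>)" for s using sym(3) unfolding symmetric_def by blast
      moreover have "(p, \<sigma>, \<tau>, remove1 p \<upsilon>) \<in> off_diagonal"
        using dist 4 unfolding off_diagonal_def by auto
      ultimately show ?thesis by (intro that[of \<sigma> \<tau> "remove1 p \<upsilon>" "Some Annihilation"]) (auto simp: insert_slot_def)
    qed
  qed
  then show thesis using C1_one_sided_limits[OF x, of p \<sigma>' \<tau>' \<upsilon>' j] by (intro that) (auto simp: eq)
qed

lemma tendsto_integrand:
  assumes "((\<lambda>s. X s (\<omega> Bsigma1) (\<omega> Btau1) (\<omega> Bupsilon1)) \<longlongrightarrow> A) T"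
    and "((\<lambda>s. Y s (\<omega> Bsigma2) (\<omega> Btau2) (\<omega> Bupsilon2)) \<longlongrightarrow> B) T"
  shows "((\<lambda>s. integrand f (X s) (Y s) g \<omega>) \<longlongrightarrow> cinner (f (\<omega> Bpi)) (blinfun_apply A (blinfun_apply B (g (\<omega> Brho))))) T"
  unfolding integrand_def
  by (intro bounded_bilinear.tendsto[OF bounded_bilinear_cinner]
      bounded_bilinear.tendsto[OF bounded_bilinear_blinfun_apply] tendsto_const assms)

lemma has_vector_derivative_integrand:
  assumes x: "class_C1 x" and y: "class_C1 y" and off: "off_diagonals t \<omega>"
  shows "((\<lambda>s. integrand f (x s) (y s) g \<omega>) has_vector_derivative
    (integrand f (cderiv x t) (y t) g \<omega> + integrand f (x t) (cderiv y t) g \<omega>)) (at t)"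
proof -
  have dx: "((\<lambda>s. x s (\<omega> Bsigma1) (\<omega> Btau1) (\<omega> Bupsilon1)) has_vector_derivative
      cderiv x t (\<omega> Bsigma1) (\<omega> Btau1) (\<omega> Bupsilon1)) (at t)"
    using off unfolding off_diagonals_def by (intro C1_has_vector_derivative[OF x]) simp
  have dy: "((\<lambda>s. y s (\<omega> Bsigma2) (\<omega> Btau2) (\<omega> Bupsilon2)) has_vector_derivative
      cderiv y t (\<omega> Bsigma2) (\<omega> Btau2) (\<omega> Bupsilon2)) (at t)"
    using off unfolding off_diagonals_def by (intro C1_has_vector_derivative[OF y]) simp
  note bl = bounded_bilinear_blinfun_apply
  have "((\<lambda>s. blinfun_apply (y s (\<omega> Bsigma2) (\<omega> Btau2) (\<omega> Bupsilon2)) (g (\<omega> Brho))) has_vector_derivative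
      blinfun_apply (cderiv y t (\<omega> Bsigma2) (\<omega> Btau2) (\<omega> Bupsilon2)) (g (\<omega> Brho))) (at t)"
    by (rule bounded_linear.has_vector_derivative[OF bounded_bilinear.bounded_linear_left[OF bl] dy])
  from bounded_linear.has_vector_derivative[OF bounded_bilinear.bounded_linear_right[OF bounded_bilinear_cinner]
      bounded_bilinear.has_vector_derivative[OF bl dx this], of "f (\<omega> Bpi)"]
  show ?thesis by (simp add: integrand_def cinner_add_right add.commute)
qed

text \<open>For a generic configuration the cut changes the integrand at finitely many times only,
  which limits do not see.\<close>

lemma eventually_cut_eq:
  assumes "generic \<omega>"
  shows "\<forall>\<^sub>F s in at t within A. cut_integrand s f (X s) (Y s) g \<omega> = integrand f (X s) (Y s) g \<omega>"
proof (rule filter_leD[OF at_le[OF subset_UNIV]])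
  show "\<forall>\<^sub>F s in at t. cut_integrand s f (X s) (Y s) g \<omega> = integrand f (X s) (Y s) g \<omega>"
    using eventually_notin_finite[OF finite_set[of "all_points \<omega>"]]
    by eventually_elim (simp add: cut_integrand_def generic_off_diagonals[OF assms])
qed

lemma has_vector_derivative_cut_integrand:
  assumes x: "class_C1 x" and y: "class_C1 y" and gen: "generic \<omega>" and t: "t \<notin> set (all_points \<omega>)"
  shows "((\<lambda>s. cut_integrand s f (x s) (y s) g \<omega>) has_vector_derivative
    (cut_integrand t f (cderiv x t) (y t) g \<omega> + cut_integrand t f (x t) (cderiv y t) g \<omega>)) (at t)"
proof -
  have off: "off_diagonals s \<omega>" if "s \<in> - set (all_points \<omega>)" for s
    using that by (intro generic_off_diagonals[OF gen]) simp
  have "((\<lambda>s. integrand f (x s) (y s) g \<omega>) has_vector_derivative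
    (integrand f (cderiv x t) (y t) g \<omega> + integrand f (x t) (cderiv y t) g \<omega>)) (at t)"
    by (rule has_vector_derivative_integrand[OF x y off]) (use t in simp)
  then have "((\<lambda>s. cut_integrand s f (x s) (y s) g \<omega>) has_vector_derivative
    (integrand f (cderiv x t) (y t) g \<omega> + integrand f (x t) (cderiv y t) g \<omega>)) (at t)"
    by (rule has_vector_derivative_transform_within_open[where S = "- set (all_points \<omega>)"])
      (use t off in \<open>auto simp: cut_integrand_def open_Compl finite_imp_closed\<close>)
  then show ?thesis using off[of t] t by (simp add: cut_integrand_def)
qed

lemma cut_integrand_limits_exist:
  assumes x: "class_C1 x" and y: "class_C1 y" and gen: "generic \<omega>"
  shows "\<exists>L R. ((\<lambda>s. cut_integrand s f (x s) (y s) g \<omega>) \<longlongrightarrow> L) (at_left p) \<and>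
    ((\<lambda>s. cut_integrand s f (x s) (y s) g \<omega>) \<longlongrightarrow> R) (at_right p)"
proof -
  have d: "distinct (\<omega> Bsigma1 @ \<omega> Btau1 @ \<omega> Bupsilon1)" "distinct (\<omega> Bsigma2 @ \<omega> Btau2 @ \<omega> Bupsilon2)"
    using gen unfolding generic_def by auto
  obtain A B where "((\<lambda>s. x s (\<omega> Bsigma1) (\<omega> Btau1) (\<omega> Bupsilon1)) \<longlongrightarrow> A) (at_left p)"
    "((\<lambda>s. x s (\<omega> Bsigma1) (\<omega> Btau1) (\<omega> Bupsilon1)) \<longlongrightarrow> B) (at_right p)"
    by (rule C1_limits_exist[OF x d(1)])
  moreover obtain C D where "((\<lambda>s. y s (\<omega> Bsigma2) (\<omega> Btau2) (\<omega> Bupsilon2)) \<longlongrightarrow> C) (at_left p)"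
    "((\<lambda>s. y s (\<omega> Bsigma2) (\<omega> Btau2) (\<omega> Bupsilon2)) \<longlongrightarrow> D) (at_right p)"
    by (rule C1_limits_exist[OF y d(2)])
  ultimately have "\<exists>L. ((\<lambda>s. integrand f (x s) (y s) g \<omega>) \<longlongrightarrow> L) (at_left p)"
    "\<exists>R. ((\<lambda>s. integrand f (x s) (y s) g \<omega>) \<longlongrightarrow> R) (at_right p)"
    using tendsto_integrand by blast+
  then show ?thesis
    using tendsto_cong[OF eventually_cut_eq[OF gen, of f x y g p]] by blast
qed

section \<open>Limits at an added point\<close>

text \<open>The slots of the first and the second kernel that receive a point of type \<open>c\<close>; \<open>None\<close> if the
  chain does not meet the kernel.\<close>

definition slot1 :: "block set \<Rightarrow> slot option" where
  "slot1 c = (if Bsigma1 \<in> c then Some Creation else if Btau1 \<in> c then Some Number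
     else if Bupsilon1 \<in> c then Some Annihilation else None)"

definition slot2 :: "block set \<Rightarrow> slot option" where
  "slot2 c = (if Bsigma2 \<in> c then Some Creation else if Btau2 \<in> c then Some Number
     else if Bupsilon2 \<in> c then Some Annihilation else None)"

definition annihilate_if :: "bool \<Rightarrow> (real list \<Rightarrow> 'k) \<Rightarrow> real \<Rightarrow> real list \<Rightarrow> 'k" where
  "annihilate_if b f t = (if b then annihilate t f else f)"

lemma generic_add_point:
  assumes c: "c \<in> chain_types" and gen: "generic \<omega>" and t: "t \<notin> set (all_points \<omega>)"
  shows "generic (add_point c t \<omega>)"
proof -
  have sub: "t \<notin> set (\<omega> b)" "set (\<omega> b) \<subseteq> set (all_points \<omega>)" for b using gen t unfolding generic_def by auto
  have all: "set (all_points (add_point c t \<omega>)) = insert t (set (all_points \<omega>))"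
    using c by (auto simp: chain_types_def all_points_def add_point_def)
  have "set (add_point c t \<omega> b) \<subseteq> set (all_points (add_point c t \<omega>))" for b
    unfolding all using sub(2)[of b] by (auto simp: add_point_def)
  moreover have "distinct (add_point c t \<omega> Bsigma1 @ add_point c t \<omega> Btau1 @ add_point c t \<omega> Bupsilon1)"
    "distinct (add_point c t \<omega> Bsigma2 @ add_point c t \<omega> Btau2 @ add_point c t \<omega> Bupsilon2)"
    "distinct (all_points (add_point c t \<omega>))"
    using c gen sub(1) unfolding generic_def all_points_def
    by (auto simp: chain_types_def add_point_def)
  ultimately show ?thesis unfolding generic_def by blast
qed

text \<open>The added point is an argument of the kernels while their time subscript tends to it.
  This is the situation in which \<open>Rplus\<close> and \<open>Rminus\<close> are defined, and
  what remains is the configuration without the point, off the diagonals at t.\<close>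

lemma cut_integrand_add_point_limits:
  fixes f g :: "real list \<Rightarrow> 'k::separable_chilbert"
  assumes x: "class_C1 x" and y: "class_C1 y" and c: "c \<in> chain_types" and gen: "generic \<omega>"
    and t: "t \<notin> set (all_points \<omega>)"
  shows "((\<lambda>s. cut_integrand s f (x s) (y s) g (add_point c t \<omega>)) \<longlongrightarrow>
      cut_integrand t (annihilate_if (Bpi \<in> c) f t) (right_value (slot1 c) x t) (right_value (slot2 c) y t)
        (annihilate_if (Brho \<in> c) g t) \<omega>) (at_right t)"
    and "((\<lambda>s. cut_integrand s f (x s) (y s) g (add_point c t \<omega>)) \<longlongrightarrow>
      cut_integrand t (annihilate_if (Bpi \<in> c) f t) (left_value (slot1 c) x t) (left_value (slot2 c) y t)
        (annihilate_if (Brho \<in> c) g t) \<omega>) (at_left t)"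
proof -
  let ?\<omega> = "add_point c t \<omega>"
  have off: "off_diagonals t \<omega>" by (rule generic_off_diagonals[OF gen t])
  then have o1: "(t, \<omega> Bsigma1, \<omega> Btau1, \<omega> Bupsilon1) \<in> off_diagonal"
    and o2: "(t, \<omega> Bsigma2, \<omega> Btau2, \<omega> Bupsilon2) \<in> off_diagonal"
    unfolding off_diagonals_def by auto
  \<comment> \<open>A chain type meets each kernel in at most one block, so t is prepended to at
    most one of its three arguments.\<close>
  have ins: "K (?\<omega> Bsigma1) (?\<omega> Btau1) (?\<omega> Bupsilon1) = insert_slot (slot1 c) t K (\<omega> Bsigma1) (\<omega> Btau1) (\<omega> Bupsilon1)"
    "K (?\<omega> Bsigma2) (?\<omega> Btau2) (?\<omega> Bupsilon2) = insert_slot (slot2 c) t K (\<omega> Bsigma2) (\<omega> Btau2) (\<omega> Bupsilon2)"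
    for K :: "'k kernel"
    using c by (auto simp: chain_types_def slot1_def slot2_def insert_slot_def add_point_def)
  have vec: "f (?\<omega> Bpi) = annihilate_if (Bpi \<in> c) f t (\<omega> Bpi)" "g (?\<omega> Brho) = annihilate_if (Brho \<in> c) g t (\<omega> Brho)"
    by (simp_all add: annihilate_if_def annihilate_def add_point_def)
  note ev = eventually_cut_eq[OF generic_add_point[OF c gen t], where f = f and X = x and Y = y and g = g]
  have "((\<lambda>s. integrand f (x s) (y s) g ?\<omega>) \<longlongrightarrow>
      integrand (annihilate_if (Bpi \<in> c) f t) (right_value (slot1 c) x t) (right_value (slot2 c) y t)
        (annihilate_if (Brho \<in> c) g t) \<omega>) (at_right t)"
    using tendsto_integrand[where \<omega> = ?\<omega> and f = f and g = g and X = x and Y = y, unfolded ins vec,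
        OF C1_one_sided_limits(1)[OF x o1] C1_one_sided_limits(1)[OF y o2]]
    unfolding integrand_def[of "annihilate_if (Bpi \<in> c) f t"] .
  then show "((\<lambda>s. cut_integrand s f (x s) (y s) g ?\<omega>) \<longlongrightarrow>
      cut_integrand t (annihilate_if (Bpi \<in> c) f t) (right_value (slot1 c) x t) (right_value (slot2 c) y t)
        (annihilate_if (Brho \<in> c) g t) \<omega>) (at_right t)"
    using off tendsto_cong[OF ev] by (simp add: cut_integrand_def[of t])
  have "((\<lambda>s. integrand f (x s) (y s) g ?\<omega>) \<longlongrightarrow>
      integrand (annihilate_if (Bpi \<in> c) f t) (left_value (slot1 c) x t) (left_value (slot2 c) y t)
        (annihilate_if (Brho \<in> c) g t) \<omega>) (at_left t)"
    using tendsto_integrand[where \<omega> = ?\<omega> and f = f and g = g and X = x and Y = y, unfolded ins vec,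
        OF C1_one_sided_limits(2)[OF x o1] C1_one_sided_limits(2)[OF y o2]]
    unfolding integrand_def[of "annihilate_if (Bpi \<in> c) f t"] .
  then show "((\<lambda>s. cut_integrand s f (x s) (y s) g ?\<omega>) \<longlongrightarrow>
      cut_integrand t (annihilate_if (Bpi \<in> c) f t) (left_value (slot1 c) x t) (left_value (slot2 c) y t)
        (annihilate_if (Brho \<in> c) g t) \<omega>) (at_left t)"
    using off tendsto_cong[OF ev] by (simp add: cut_integrand_def[of t])
qed

text \<open>Reading the jump along the sequence 1 / (n + 1) makes it a countable limit of measurable
  functions, hence measurable in time and configuration together.\<close>

definition jump_at :: "(real \<Rightarrow> complex) \<Rightarrow> real \<Rightarrow> complex" where
  "jump_at h p = lim (\<lambda>n. h (p + 1 / real (Suc n)) - h (p - 1 / real (Suc n)))"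

lemma jump_at_eq:
  assumes "(h \<longlongrightarrow> L) (at_left p)" "(h \<longlongrightarrow> R) (at_right p)"
  shows "jump_at h p = R - L"
  unfolding jump_at_def
proof (intro limI tendsto_diff)
  have z: "(\<lambda>n. 1 / real (Suc n)) \<longlonglongrightarrow> 0" using LIMSEQ_inverse_real_of_nat by (simp add: inverse_eq_divide)
  have "filterlim (\<lambda>n. p + 1 / real (Suc n)) (at_right p) sequentially"
    using tendsto_add[OF tendsto_const z, of p] by (auto simp: filterlim_at)
  then show "(\<lambda>n. h (p + 1 / real (Suc n))) \<longlonglongrightarrow> R" by (rule filterlim_compose[OF assms(2)])
  have "filterlim (\<lambda>n. p - 1 / real (Suc n)) (at_left p) sequentially"
    using tendsto_diff[OF tendsto_const z, of p] by (auto simp: filterlim_at)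
  then show "(\<lambda>n. h (p - 1 / real (Suc n))) \<longlonglongrightarrow> L" by (rule filterlim_compose[OF assms(1)])
qed

section \<open>Test functions\<close>

lemma test_function_derivative:
  assumes "\<phi> \<in> test_functions"
  obtains \<phi>' where "\<And>t. (\<phi> has_vector_derivative \<phi>' t) (at t)" "continuous_on UNIV \<phi>'"
    "\<And>t. vector_derivative \<phi> (at t) = \<phi>' t"
proof
  have d: "((\<lambda>\<psi> t. vector_derivative \<psi> (at t)) ^^ n) \<phi> differentiable_on UNIV" for n
    using assms unfolding test_functions_def by blast
  show "(\<phi> has_vector_derivative vector_derivative \<phi> (at t)) (at t)" for t
    using d[of 0] by (simp add: differentiable_on_def vector_derivative_works)
  show "continuous_on UNIV (\<lambda>t. vector_derivative \<phi> (at t))"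
    using d[of 1] by (intro differentiable_imp_continuous_on) simp
qed simp

lemma test_function_support:
  assumes \<phi>: "\<phi> \<in> test_functions" and d: "\<And>t. (\<phi> has_vector_derivative \<phi>' t) (at t)"
  obtains M :: real where "0 < M" "\<And>t. t \<notin> {-M<..<M} \<Longrightarrow> \<phi> t = 0" "\<And>t. t \<notin> {-M<..<M} \<Longrightarrow> \<phi>' t = 0"
proof -
  let ?S = "closure {t. \<phi> t \<noteq> 0}"
  have "bounded ?S" using \<phi> unfolding test_functions_def by (simp add: compact_imp_bounded)
  then obtain M where M: "0 < M" "\<And>t. t \<in> ?S \<Longrightarrow> \<bar>t\<bar> < M"
    unfolding bounded_pos_less by (auto simp: real_norm_def)
  have out: "t \<notin> ?S" if "t \<notin> {-M<..<M}" for t using M(2)[of t] that by auto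
  have zero: "\<phi> t = 0" if "t \<notin> ?S" for t using that closure_subset[of "{t. \<phi> t \<noteq> 0}"] by auto
  moreover have "\<phi>' t = 0" if "t \<notin> ?S" for t
  proof -
    \<comment> \<open>Off its closed support \<phi> vanishes on an open set, hence so does its
      derivative.\<close>
    have "((\<lambda>_. 0) has_vector_derivative \<phi>' t) (at t)"
    proof (rule has_vector_derivative_transform_within_open[OF d[of t]])
      show "open (- ?S)" by (rule open_Compl[OF closed_closure])
      show "t \<in> - ?S" using that by simp
      show "\<phi> s = 0" if "s \<in> - ?S" for s by (rule zero) (use that in simp)
    qed
    then show ?thesis by (rule vector_derivative_unique_at) (rule has_vector_derivative_const)
  qed
  ultimately show thesis using out M(1) that by blast
qed

section \<open>Ito's formula\<close>

lemma bounded_by_indicator: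
  fixes h :: "real \<Rightarrow> complex"
  assumes c: "continuous_on UNIV h" and s: "\<And>t. t \<notin> {-M<..<M} \<Longrightarrow> h t = 0"
  obtains C where "\<And>t. norm (h t) \<le> C * indicator {-M..M} t"
proof -
  have "compact (h ` {-M..M})"
    by (rule compact_continuous_image[OF continuous_on_subset[OF c]]) simp_all
  then obtain C where C: "\<And>t. t \<in> {-M..M} \<Longrightarrow> norm (h t) \<le> C"
    using compact_imp_bounded[THEN bounded_iff[THEN iffD1]] by (metis imageI)
  have "norm (h t) \<le> C * indicator {-M..M} t" for t
  proof (cases "t \<in> {-M..M}")
    case True then show ?thesis using C by simp
  next
    case False
    then have "h t = 0" by (intro s) auto
    then show ?thesis using False by simp
  qed
  then show thesis by (rule that)
qed

lemma AE_lborel_mm_generic: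
  "AE p in lborel \<Otimes>\<^sub>M mm. generic (snd p) \<and> fst p \<notin> set (all_points (snd p))"
proof (rule lborel_mm.AE_pair_measure)
  have "Measurable.pred (time_blocks_borel) (\<lambda>p::real \<times> (block \<Rightarrow> real list). generic (snd p))"
    by (rule measurable_compose[OF measurable_snd]) (use measurable_generic in \<open>simp only: pred_def\<close>)
  moreover have "Measurable.pred (time_blocks_borel) (\<lambda>p. fst p \<notin> set (all_points (snd p)))"
    unfolding pred_def all_points_concat by (rule measurable_notin_blocks)
  ultimately have "Measurable.pred (time_blocks_borel) (\<lambda>p. generic (snd p) \<and> fst p \<notin> set (all_points (snd p)))"
    by (rule pred_intros_logic)
  then have "Measurable.pred (lborel \<Otimes>\<^sub>M mm) (\<lambda>p. generic (snd p) \<and> fst p \<notin> set (all_points (snd p)))"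
    by (rule measurable_lborel_mm)
  then show "{p \<in> space (lborel \<Otimes>\<^sub>M mm). generic (snd p) \<and> fst p \<notin> set (all_points (snd p))} \<in> sets (lborel \<Otimes>\<^sub>M mm)"
    unfolding pred_def .
  show "AE t in lborel. AE \<omega> in mm. generic (snd (t, \<omega>)) \<and> fst (t, \<omega>) \<notin> set (all_points (snd (t, \<omega>)))"
  proof (rule AE_I2)
    fix t :: real
    show "AE \<omega> in mm. generic (snd (t, \<omega>)) \<and> fst (t, \<omega>) \<notin> set (all_points (snd (t, \<omega>)))"
      using AE_mm_generic AE_mm_notin_all_points[of t] by eventually_elim simp
  qed
qed

context ito_pair
begin

context
  fixes f g :: "real list \<Rightarrow> 'k"
  assumes f: "vector_path u (\<lambda>_. f)" "vector_path u (\<lambda>t. annihilate t f)"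
    and g: "vector_path v (\<lambda>_. g)" "vector_path v (\<lambda>t. annihilate t g)"
begin

lemma vector_path_annihilate_if:
  "vector_path u (annihilate_if b f)" "vector_path v (annihilate_if b g)"
  using f g by (cases b; simp add: annihilate_if_def[abs_def])+

lemma family: "x \<in> C1_family x" "cderiv x \<in> C1_family x" "y \<in> C1_family y" "cderiv y \<in> C1_family y"
  unfolding C1_family_def by simp_all

abbreviation right_form :: "block set \<Rightarrow> real \<Rightarrow> complex" where
  "right_form c t \<equiv> bform (annihilate_if (Bpi \<in> c) f t) (right_value (slot1 c) x t)
     (right_value (slot2 c) y t) (annihilate_if (Brho \<in> c) g t)"

abbreviation left_form :: "block set \<Rightarrow> real \<Rightarrow> complex" where
  "left_form c t \<equiv> bform (annihilate_if (Bpi \<in> c) f t) (left_value (slot1 c) x t)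
     (left_value (slot2 c) y t) (annihilate_if (Brho \<in> c) g t)"

abbreviation path_value :: "real \<Rightarrow> (block \<Rightarrow> real list) \<Rightarrow> complex" where
  "path_value t \<omega> \<equiv> cut_integrand t f (x t) (y t) g \<omega>"

lemma measurable_jump:
  "(\<lambda>q. jump_at (\<lambda>s. path_value s (snd q)) (fst q)) \<in> borel_measurable (time_blocks_borel)"
proof -
  note m = measurable_cut_integrand[OF C1_family_class_C0[OF C1_x family(1)] C1_family_class_C0[OF C1_y family(3)] f(1) g(1)]
  have "(\<lambda>q. path_value (fst q + e) (snd q)) \<in> borel_measurable (time_blocks_borel)" for e
  proof -
    have "(\<lambda>q::real \<times> (block \<Rightarrow> real list). (fst q + e, snd q)) \<in> time_blocks_borel \<rightarrow>\<^sub>M time_blocks_borel"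
      by measurable
    from measurable_compose[OF this m] show ?thesis by simp
  qed
  from this[of "1 / real (Suc n)" for n] this[of "- (1 / real (Suc n))" for n]
  have "(\<lambda>q. path_value (fst q + 1 / real (Suc n)) (snd q) - path_value (fst q - 1 / real (Suc n)) (snd q))
      \<in> borel_measurable (time_blocks_borel)" for n
    by (intro borel_measurable_diff) (simp_all only: diff_conv_add_uminus)
  then show ?thesis unfolding jump_at_def by (rule borel_measurable_lim_metric)
qed

lemma block_symmetric_jump: "block_symmetric (\<lambda>\<omega>. jump_at (\<lambda>s. path_value s \<omega>) t)"
proof -
  have "symmetric f" "symmetric g" using f(1) g(1) unfolding vector_path_def by auto
  then have "block_symmetric (path_value s)" for s
    by (intro block_symmetric_cut_integrand C1_family_class_C0[OF C1_x family(1)] C1_family_class_C0[OF C1_y family(3)])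
  then have "(\<And>b. mset (\<omega> b) = mset (\<omega>' b)) \<Longrightarrow> path_value s \<omega> = path_value s \<omega>'" for s \<omega> \<omega>'
    by (rule block_symmetricD)
  then have "(\<And>b. mset (\<omega> b) = mset (\<omega>' b)) \<Longrightarrow> (\<lambda>s. path_value s \<omega>) = (\<lambda>s. path_value s \<omega>')" for \<omega> \<omega>'
    by blast
  then have "(\<And>b. mset (\<omega> b) = mset (\<omega>' b)) \<Longrightarrow>
      jump_at (\<lambda>s. path_value s \<omega>) t = jump_at (\<lambda>s. path_value s \<omega>') t" for \<omega> \<omega>'
    by (rule arg_cong)
  then show ?thesis unfolding block_symmetric_def by blast
qed

lemma jump_add_point:
  assumes "c \<in> chain_types" "generic \<omega>" "t \<notin> set (all_points \<omega>)"
  shows "jump_at (\<lambda>s. path_value s (add_point c t \<omega>)) t =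
    cut_form (annihilate_if (Bpi \<in> c) f) (right_value (slot1 c) x) (right_value (slot2 c) y) (annihilate_if (Brho \<in> c) g) (t, \<omega>) -
    cut_form (annihilate_if (Bpi \<in> c) f) (left_value (slot1 c) x) (left_value (slot2 c) y) (annihilate_if (Brho \<in> c) g) (t, \<omega>)"
  using jump_at_eq[OF cut_integrand_add_point_limits(2,1)[OF C1_x C1_y assms]] by simp

text \<open>Regularity in time is known for single configurations only, so Fubini's theorem brings
  the time integral inside for the integration by parts and out again afterwards; for the jumps,
  Mecke's formula does the latter.\<close>

lemma ito_weak:
  assumes \<phi>: "\<phi> \<in> test_functions"
  shows "- (\<integral>t. vector_derivative \<phi> (at t) * bform f (x t) (y t) g \<partial>lborel) =
    (\<integral>t. \<phi> t * (bform f (cderiv x t) (y t) g + bform f (x t) (cderiv y t) g +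
      (\<Sum>c\<in>chain_types. right_form c t - left_form c t)) \<partial>lborel)"
proof -
  obtain \<phi>' where \<phi>': "\<And>t. (\<phi> has_vector_derivative \<phi>' t) (at t)" "continuous_on UNIV \<phi>'"
    "\<And>t. vector_derivative \<phi> (at t) = \<phi>' t"
    using test_function_derivative[OF \<phi>] by blast
  obtain M where M: "0 < M" "\<And>t. t \<notin> {-M<..<M} \<Longrightarrow> \<phi> t = 0" "\<And>t. t \<notin> {-M<..<M} \<Longrightarrow> \<phi>' t = 0"
    using test_function_support[OF \<phi> \<phi>'(1)] by blast
  have c\<phi>: "continuous_on UNIV \<phi>"
    using \<phi>'(1) by (intro continuous_at_imp_continuous_on) (metis has_vector_derivative_continuous)
  obtain C where C: "\<And>t. norm (\<phi> t) \<le> C * indicator {-M..M} t" using bounded_by_indicator[OF c\<phi> M(2)] by blast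
  obtain C' where C': "\<And>t. norm (\<phi>' t) \<le> C' * indicator {-M..M} t" using bounded_by_indicator[OF \<phi>'(2) M(3)] by blast
  have m\<phi> [measurable]: "\<phi> \<in> borel_measurable borel" and m\<phi>' [measurable]: "\<phi>' \<in> borel_measurable borel"
    using c\<phi> \<phi>'(2) by (auto intro: borel_measurable_continuous_onI)
  have K: "compact {-M..M}" by simp
  let ?\<Phi> = "path_value"
  let ?d1 = "cut_form (\<lambda>_. f) (cderiv x) y (\<lambda>_. g)" and ?d2 = "cut_form (\<lambda>_. f) x (cderiv y) (\<lambda>_. g)"
  let ?d = "\<lambda>t \<omega>. ?d1 (t, \<omega>) + ?d2 (t, \<omega>)"
  let ?R = "\<lambda>c. cut_form (annihilate_if (Bpi \<in> c) f) (right_value (slot1 c) x) (right_value (slot2 c) y) (annihilate_if (Brho \<in> c) g)"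
  let ?L = "\<lambda>c. cut_form (annihilate_if (Bpi \<in> c) f) (left_value (slot1 c) x) (left_value (slot2 c) y) (annihilate_if (Brho \<in> c) g)"
  note fam_R = right_value_family[of _ x] right_value_family[of _ y]
    and fam_L = left_value_family[of _ x] left_value_family[of _ y]
  have int\<Phi>: "integrable (lborel \<Otimes>\<^sub>M mm) (\<lambda>p. \<phi>' (fst p) * ?\<Phi> (fst p) (snd p))"
    by (rule integrable_cut_form[OF family(1,3) f(1) g(1) m\<phi>' K C'])
  have int1: "integrable (lborel \<Otimes>\<^sub>M mm) (\<lambda>p. \<phi> (fst p) * ?d1 p)"
    by (rule integrable_cut_form[OF family(2,3) f(1) g(1) m\<phi> K C])
  have int2: "integrable (lborel \<Otimes>\<^sub>M mm) (\<lambda>p. \<phi> (fst p) * ?d2 p)"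
    by (rule integrable_cut_form[OF family(1,4) f(1) g(1) m\<phi> K C])
  have int12: "integrable (lborel \<Otimes>\<^sub>M mm) (\<lambda>p. \<phi> (fst p) * (?d1 p + ?d2 p))"
    using Bochner_Integration.integrable_add[OF int1 int2] by (simp add: distrib_left)
  have intR: "integrable (lborel \<Otimes>\<^sub>M mm) (\<lambda>p. \<phi> (fst p) * ?R c p)" for c
    by (rule integrable_cut_form[OF fam_R vector_path_annihilate_if m\<phi> K C])
  have intL: "integrable (lborel \<Otimes>\<^sub>M mm) (\<lambda>p. \<phi> (fst p) * ?L c p)" for c
    by (rule integrable_cut_form[OF fam_L vector_path_annihilate_if m\<phi> K C])

  \<comment> \<open>The contribution of a single point to the integration by parts, in the form to
    which Mecke's formula applies.\<close>
  define H where "H p \<omega> = \<phi> p * jump_at (\<lambda>s. ?\<Phi> s \<omega>) p" for p \<omega>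
  have mH: "(\<lambda>q. H (fst q) (snd q)) \<in> borel_measurable (time_blocks_borel)"
    unfolding H_def using measurable_jump by measurable
  have symH: "block_symmetric (H t)" for t
    unfolding block_symmetric_def H_def
    by (intro allI impI arg_cong[where f = "\<lambda>z. \<phi> t * z"] block_symmetricD[OF block_symmetric_jump]) simp
  \<comment> \<open>Almost always the configuration is generic and the added time new to it, so the
    jump is the difference of right and left values. Their separate integrability yields that of
    H.\<close>
  have aeH: "AE p in lborel \<Otimes>\<^sub>M mm. with_point c H p = \<phi> (fst p) * ?R c p - \<phi> (fst p) * ?L c p"
    if c: "c \<in> chain_types" for c
    using AE_lborel_mm_generic
  proof eventually_elim
    case (elim p)
    then show ?case
      using jump_add_point[OF c, of "snd p" "fst p"] by (simp add: H_def right_diff_distrib)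
  qed
  have mHc: "(\<lambda>p. with_point c H p) \<in> borel_measurable (lborel \<Otimes>\<^sub>M mm)" for c
    by (rule measurable_lborel_mm[OF measurable_add_point_fun[OF mH]])
  have intRL: "integrable (lborel \<Otimes>\<^sub>M mm) (\<lambda>p. \<phi> (fst p) * ?R c p - \<phi> (fst p) * ?L c p)" for c
    by (intro Bochner_Integration.integrable_diff intR intL)
  have intH: "integrable (lborel \<Otimes>\<^sub>M mm) (\<lambda>p. with_point c H p)" if c: "c \<in> chain_types" for c
    using integrable_cong_AE[OF mHc borel_measurable_integrable[OF intRL] aeH[OF c]] intRL by simp
  have H_eq: "(\<integral>p. with_point c H p \<partial>(lborel \<Otimes>\<^sub>M mm)) =
      (\<integral>p. \<phi> (fst p) * ?R c p \<partial>(lborel \<Otimes>\<^sub>M mm)) - (\<integral>p. \<phi> (fst p) * ?L c p \<partial>(lborel \<Otimes>\<^sub>M mm))"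
    if c: "c \<in> chain_types" for c
    using integral_cong_AE[OF mHc borel_measurable_integrable[OF intRL] aeH[OF c]]
      Bochner_Integration.integral_diff[OF intR intL] by simp
  have mecke: "has_bochner_integral mm (\<lambda>\<omega>. \<Sum>p\<leftarrow>all_points \<omega>. H p \<omega>)
    (\<Sum>c\<in>chain_types. \<integral>p. with_point c H p \<partial>(lborel \<Otimes>\<^sub>M mm))"
    by (rule mm_sum_points[OF mH symH intH])

  have int\<Phi>': "integrable (lborel \<Otimes>\<^sub>M mm) (\<lambda>(t, \<omega>). \<phi>' t * ?\<Phi> t \<omega>)"
    and int12': "integrable (lborel \<Otimes>\<^sub>M mm) (\<lambda>(t, \<omega>). \<phi> t * ?d t \<omega>)"
    using int\<Phi> int12 by (simp_all add: case_prod_beta')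
  \<comment> \<open>Two conditions hold for almost every configuration: it is generic, which gives
    derivatives and limits, and by Fubini's theorem both products with \<phi> and its derivative are
    integrable in time.\<close>
  have ibp: "AE \<omega> in mm. (\<integral>t. \<phi>' t * ?\<Phi> t \<omega> \<partial>lborel) =
      - (\<integral>t. \<phi> t * ?d t \<omega> \<partial>lborel) - (\<Sum>p\<leftarrow>all_points \<omega>. H p \<omega>)"
    using AE_mm_generic lborel_mm.AE_integrable_snd[OF int\<Phi>'] lborel_mm.AE_integrable_snd[OF int12']
  proof eventually_elim
    case (elim \<omega>)
    \<comment> \<open>The limits are chosen for this configuration alone; measurability in the
      configuration is left to \<open>jump_at\<close>, which has the same value.\<close>
    have "\<forall>p. \<exists>L. \<exists>R. ((\<lambda>s. ?\<Phi> s \<omega>) \<longlongrightarrow> L) (at_left p) \<and> ((\<lambda>s. ?\<Phi> s \<omega>) \<longlongrightarrow> R) (at_right p)"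
      using cut_integrand_limits_exist[OF C1_x C1_y elim(1), of f g] by (rule allI)
    from choice[OF this] obtain Lf where "\<forall>p. \<exists>R. ((\<lambda>s. ?\<Phi> s \<omega>) \<longlongrightarrow> Lf p) (at_left p) \<and> ((\<lambda>s. ?\<Phi> s \<omega>) \<longlongrightarrow> R) (at_right p)" ..
    from choice[OF this] obtain Rf where
      "\<forall>p. ((\<lambda>s. ?\<Phi> s \<omega>) \<longlongrightarrow> Lf p) (at_left p) \<and> ((\<lambda>s. ?\<Phi> s \<omega>) \<longlongrightarrow> Rf p) (at_right p)" ..
    then have LR: "((\<lambda>s. ?\<Phi> s \<omega>) \<longlongrightarrow> Lf p) (at_left p)" "((\<lambda>s. ?\<Phi> s \<omega>) \<longlongrightarrow> Rf p) (at_right p)" for p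
      by blast+
    have "(\<integral>t. \<phi>' t * ?\<Phi> t \<omega> \<partial>lborel) = - (\<integral>t. \<phi> t * ?d t \<omega> \<partial>lborel) -
        (\<Sum>p\<in>set (all_points \<omega>). \<phi> p * (Rf p - Lf p))"
    proof (rule integration_by_parts_with_jumps)
      show "((\<lambda>s. ?\<Phi> s \<omega>) has_vector_derivative ?d t \<omega>) (at t)" if "t \<notin> set (all_points \<omega>)" for t
        using has_vector_derivative_cut_integrand[OF C1_x C1_y elim(1) that, of f g] by simp
    qed (use LR \<phi>'(1) M elim(2,3) in simp_all)
    \<comment> \<open>The points of a generic configuration are distinct, so the sum over their set
      is the sum over the list.\<close>
    also have "(\<Sum>p\<in>set (all_points \<omega>). \<phi> p * (Rf p - Lf p)) = (\<Sum>p\<leftarrow>all_points \<omega>. H p \<omega>)"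
      using elim(1) jump_at_eq[OF LR]
      by (simp add: H_def generic_def sum_list_distinct_conv_sum_set)
    finally show ?case .
  qed
  have "(\<integral>t. \<phi>' t * bform f (x t) (y t) g \<partial>lborel) = (\<integral>p. \<phi>' (fst p) * ?\<Phi> (fst p) (snd p) \<partial>(lborel \<Otimes>\<^sub>M mm))"
    by (rule integral_bform[OF family(1,3) f(1) g(1) m\<phi>' K C'])
  also have "\<dots> = (\<integral>\<omega>. (\<integral>t. \<phi>' t * ?\<Phi> t \<omega> \<partial>lborel) \<partial>mm)"
    using lborel_mm.integral_snd[OF int\<Phi>'] by (simp add: case_prod_beta')
  also have "\<dots> = (\<integral>\<omega>. - (\<integral>t. \<phi> t * ?d t \<omega> \<partial>lborel) - (\<Sum>p\<leftarrow>all_points \<omega>. H p \<omega>) \<partial>mm)"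
    \<comment> \<open>Measurability of the right-hand side comes from integrability, by Fubini's
      theorem for the first term and by Mecke's formula for the second.\<close>
    by (rule integral_cong_AE[OF borel_measurable_integrable[OF lborel_mm.integrable_snd[OF int\<Phi>']] _ ibp])
      (rule borel_measurable_diff[OF borel_measurable_uminus[OF borel_measurable_integrable[OF
            lborel_mm.integrable_snd[OF int12']]] borel_measurable_has_bochner_integral[OF mecke]])
  also have "\<dots> = - (\<integral>\<omega>. (\<integral>t. \<phi> t * ?d t \<omega> \<partial>lborel) \<partial>mm) - (\<integral>\<omega>. (\<Sum>p\<leftarrow>all_points \<omega>. H p \<omega>) \<partial>mm)"
    using lborel_mm.integrable_snd[OF int12'] mecke by (simp add: has_bochner_integral_iff)
  also have "(\<integral>\<omega>. (\<integral>t. \<phi> t * ?d t \<omega> \<partial>lborel) \<partial>mm) = (\<integral>p. \<phi> (fst p) * (?d1 p + ?d2 p) \<partial>(lborel \<Otimes>\<^sub>M mm))"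
    using lborel_mm.integral_snd[OF int12'] by (simp add: case_prod_beta')
  also have "\<dots> = (\<integral>p. \<phi> (fst p) * ?d1 p \<partial>(lborel \<Otimes>\<^sub>M mm)) + (\<integral>p. \<phi> (fst p) * ?d2 p \<partial>(lborel \<Otimes>\<^sub>M mm))"
    using Bochner_Integration.integral_add[OF int1 int2] by (simp add: distrib_left)
  also have "(\<integral>\<omega>. (\<Sum>p\<leftarrow>all_points \<omega>. H p \<omega>) \<partial>mm) =
      (\<Sum>c\<in>chain_types. (\<integral>p. \<phi> (fst p) * ?R c p \<partial>(lborel \<Otimes>\<^sub>M mm)) - (\<integral>p. \<phi> (fst p) * ?L c p \<partial>(lborel \<Otimes>\<^sub>M mm)))"
    using has_bochner_integral_integral_eq[OF mecke] H_eq by simp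
  finally have lhs: "(\<integral>t. \<phi>' t * bform f (x t) (y t) g \<partial>lborel) =
    - ((\<integral>p. \<phi> (fst p) * ?d1 p \<partial>(lborel \<Otimes>\<^sub>M mm)) + (\<integral>p. \<phi> (fst p) * ?d2 p \<partial>(lborel \<Otimes>\<^sub>M mm))) -
    (\<Sum>c\<in>chain_types. (\<integral>p. \<phi> (fst p) * ?R c p \<partial>(lborel \<Otimes>\<^sub>M mm)) - (\<integral>p. \<phi> (fst p) * ?L c p \<partial>(lborel \<Otimes>\<^sub>M mm)))" .
  note b1 = integral_bform[OF family(2,3) f(1) g(1) m\<phi> K C] integrable_bform[OF family(2,3) f(1) g(1) m\<phi> K C]
  note b2 = integral_bform[OF family(1,4) f(1) g(1) m\<phi> K C] integrable_bform[OF family(1,4) f(1) g(1) m\<phi> K C]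
  note bR = integral_bform[OF fam_R vector_path_annihilate_if m\<phi> K C] integrable_bform[OF fam_R vector_path_annihilate_if m\<phi> K C]
  note bL = integral_bform[OF fam_L vector_path_annihilate_if m\<phi> K C] integrable_bform[OF fam_L vector_path_annihilate_if m\<phi> K C]
  have "(\<integral>t. \<phi> t * (bform f (cderiv x t) (y t) g + bform f (x t) (cderiv y t) g +
      (\<Sum>c\<in>chain_types. right_form c t - left_form c t)) \<partial>lborel) =
    (\<integral>t. \<phi> t * bform f (cderiv x t) (y t) g + \<phi> t * bform f (x t) (cderiv y t) g +
      (\<Sum>c\<in>chain_types. \<phi> t * right_form c t - \<phi> t * left_form c t) \<partial>lborel)"
    by (simp add: distrib_left sum_distrib_left right_diff_distrib)
  also have "\<dots> = (\<integral>t. \<phi> t * bform f (cderiv x t) (y t) g \<partial>lborel) + (\<integral>t. \<phi> t * bform f (x t) (cderiv y t) g \<partial>lborel) +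
      (\<Sum>c\<in>chain_types. (\<integral>t. \<phi> t * right_form c t \<partial>lborel) - (\<integral>t. \<phi> t * left_form c t \<partial>lborel))"
    using b1(2) b2(2) bR(2) bL(2) by simp
  also have "\<dots> = - (\<integral>t. \<phi>' t * bform f (x t) (y t) g \<partial>lborel)"
    unfolding lhs b1(1) b2(1) bR(1) bL(1) by simp
  finally show ?thesis unfolding \<phi>'(3) by simp
qed

text \<open>The forms are Borel functions of t, so the Lebesgue integrals in the definition of the
  Schwartz derivative are integrals for \<open>lborel\<close>, to which \<open>ito_weak\<close>
  applies.\<close>

lemma ito_schwartz:
  "has_schwartz_derivative (\<lambda>t. bform f (x t) (y t) g)
    (\<lambda>t. bform f (cderiv x t) (y t) g + bform f (x t) (cderiv y t) g +
      (\<Sum>c\<in>chain_types. right_form c t - left_form c t))"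
    (is "has_schwartz_derivative ?h ?k")
proof -
  note fam_R = right_value_family[of _ x] right_value_family[of _ y]
    and fam_L = left_value_family[of _ x] left_value_family[of _ y]
  have li_sum: "locally_integrable euclideanreal lborel (\<lambda>t. \<Sum>c\<in>S. right_form c t - left_form c t)"
    if "finite S" for S
    using that
  proof induction
    case empty
    show ?case by (simp add: locally_integrable_def)
  next
    case (insert c S)
    have "(\<Sum>c\<in>insert c S. right_form c t - left_form c t) =
        (right_form c t - left_form c t) + (\<Sum>c\<in>S. right_form c t - left_form c t)" for t
      using insert.hyps by (rule sum.insert)
    then show ?case
      by (simp only:)
        (intro locally_integrable_add locally_integrable_diff insert.IH
          locally_integrable_bform[OF fam_R vector_path_annihilate_if]
          locally_integrable_bform[OF fam_L vector_path_annihilate_if])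
  qed
  have li: "locally_integrable euclideanreal lborel ?h" "locally_integrable euclideanreal lborel ?k"
    by (intro locally_integrable_add li_sum finite_chain_types locally_integrable_bform[OF family(1,3) f(1) g(1)]
        locally_integrable_bform[OF family(2,3) f(1) g(1)] locally_integrable_bform[OF family(1,4) f(1) g(1)])+
  have mh [measurable]: "?h \<in> borel_measurable borel" by (rule measurable_bform[OF family(1,3) f(1) g(1)])
  have mk [measurable]: "?k \<in> borel_measurable borel"
    by (intro borel_measurable_add borel_measurable_sum borel_measurable_diff
        measurable_bform[OF family(2,3) f(1) g(1)] measurable_bform[OF family(1,4) f(1) g(1)]
        measurable_bform[OF fam_R vector_path_annihilate_if] measurable_bform[OF fam_L vector_path_annihilate_if])
  have "schwartz_derivative ?h \<phi> = (\<integral>t. ?k t * \<phi> t \<partial>lebesgue)" if \<phi>: "\<phi> \<in> test_functions" for \<phi>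
  proof -
    obtain \<phi>' where \<phi>': "\<And>t. (\<phi> has_vector_derivative \<phi>' t) (at t)" "continuous_on UNIV \<phi>'"
      "\<And>t. vector_derivative \<phi> (at t) = \<phi>' t"
      using test_function_derivative[OF \<phi>] by blast
    have "continuous_on UNIV \<phi>"
      using \<phi>'(1) by (intro continuous_at_imp_continuous_on) (metis has_vector_derivative_continuous)
    then have [measurable]: "\<phi> \<in> borel_measurable borel" "\<phi>' \<in> borel_measurable borel"
      using \<phi>'(2) by (auto intro: borel_measurable_continuous_onI)
    have "schwartz_derivative ?h \<phi> = - (\<integral>t. ?h t * \<phi>' t \<partial>lborel)"
      unfolding schwartz_derivative_def \<phi>'(3) by (subst integral_completion) simp_all
    also have "\<dots> = - (\<integral>t. vector_derivative \<phi> (at t) * ?h t \<partial>lborel)"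
      unfolding \<phi>'(3) by (simp add: mult.commute)
    also have "\<dots> = (\<integral>t. \<phi> t * ?k t \<partial>lborel)" by (rule ito_weak[OF \<phi>])
    also have "\<dots> = (\<integral>t. ?k t * \<phi> t \<partial>lebesgue)"
    proof -
      have "(\<lambda>t. ?k t * \<phi> t) \<in> borel_measurable lborel" using mk by measurable
      from integral_completion[OF this] show ?thesis by (simp add: mult.commute)
    qed
    finally show ?thesis .
  qed
  then show ?thesis unfolding has_schwartz_derivative_def using li by blast
qed

end

text \<open>The hypotheses cover the one-sided values and not their difference; integrability for
  both values allows the difference to be taken out of the integral.\<close>

lemma bform_jump:
  assumes f: "vector_path u f" and g: "vector_path v g"
  shows "G \<in> C1_family y \<Longrightarrow> bform (f t) (jump i x t) (G t) (g t) =
      bform (f t) (Rplus i x t) (G t) (g t) - bform (f t) (Rminus i x t) (G t) (g t)"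
    and "F \<in> C1_family x \<Longrightarrow> bform (f t) (F t) (jump i y t) (g t) =
      bform (f t) (F t) (Rplus i y t) (g t) - bform (f t) (F t) (Rminus i y t) (g t)"
proof -
  have fam: "Rplus i z \<in> C1_family z" "Rminus i z \<in> C1_family z" for z :: "real \<Rightarrow> 'k kernel"
    unfolding C1_family_def by auto
  have cinner_diff: "cinner a (b - c) = cinner a b - cinner a c" for a b c :: 'k
    by (rule bounded_bilinear.diff_right[OF bounded_bilinear_cinner])
  show "bform (f t) (jump i x t) (G t) (g t) =
      bform (f t) (Rplus i x t) (G t) (g t) - bform (f t) (Rminus i x t) (G t) (g t)" if G: "G \<in> C1_family y"
  proof -
    have "integrand (f t) (jump i x t) (G t) (g t) \<omega> =
      integrand (f t) (Rplus i x t) (G t) (g t) \<omega> - integrand (f t) (Rminus i x t) (G t) (g t) \<omega>" for \<omega>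
      by (simp add: integrand_def jump_def blinfun.diff_left cinner_diff)
    then have "bform (f t) (jump i x t) (G t) (g t) = (\<integral>\<omega>. integrand (f t) (Rplus i x t) (G t) (g t) \<omega> -
        integrand (f t) (Rminus i x t) (G t) (g t) \<omega> \<partial>completion mm)"
      unfolding bform_eq_integrand by (intro Bochner_Integration.integral_cong refl)
    then show ?thesis
      unfolding bform_eq_integrand
      by (simp only: Bochner_Integration.integral_diff[OF integrable_integrand[OF fam(1) G f g]
            integrable_integrand[OF fam(2) G f g]])
  qed
  show "bform (f t) (F t) (jump i y t) (g t) =
      bform (f t) (F t) (Rplus i y t) (g t) - bform (f t) (F t) (Rminus i y t) (g t)" if F: "F \<in> C1_family x"
  proof -
    have "integrand (f t) (F t) (jump i y t) (g t) \<omega> =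
      integrand (f t) (F t) (Rplus i y t) (g t) \<omega> - integrand (f t) (F t) (Rminus i y t) (g t) \<omega>" for \<omega>
      by (simp add: integrand_def jump_def blinfun.diff_left blinfun.diff_right cinner_diff)
    then have "bform (f t) (F t) (jump i y t) (g t) = (\<integral>\<omega>. integrand (f t) (F t) (Rplus i y t) (g t) \<omega> -
        integrand (f t) (F t) (Rminus i y t) (g t) \<omega> \<partial>completion mm)"
      unfolding bform_eq_integrand by (intro Bochner_Integration.integral_cong refl)
    then show ?thesis
      unfolding bform_eq_integrand
      by (simp only: Bochner_Integration.integral_diff[OF integrable_integrand[OF F fam(1) f g]
            integrable_integrand[OF F fam(2) f g]])
  qed
qed

end

lemma sum_chain_types:
  "(\<Sum>c\<in>chain_types. h c) = h {Bpi, Bsigma1} + h {Bpi, Btau1, Bsigma2} + h {Bpi, Btau1, Btau2, Brho} +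
     h {Bpi, Btau1, Brho} + h {Bpi, Bsigma2} + h {Bpi, Btau2, Brho} + h {Bpi, Brho} + h {Bupsilon1, Bsigma2} +
     h {Bupsilon1, Btau2, Brho} + h {Bupsilon1, Brho} + (h {Bupsilon2, Brho} :: 'a::comm_monoid_add)"
  unfolding chain_types_def by (simp add: set_eq_subset add.assoc)

theorem theorem3p2p1:
  fixes x y :: "real \<Rightarrow> 'k::separable_chilbert kernel"
    and f g :: "real list \<Rightarrow> 'k"
  assumes "class_C1 x" and "class_C1 y"
    and "\<And>u v F G t. u \<in> test_vectors \<Longrightarrow> v \<in> test_vectors \<Longrightarrow> F \<in> C1_family x \<Longrightarrow> G \<in> C1_family y \<Longrightarrow>
           exists_in_norm u (F t) (G t) v"
    and "\<And>u v F G. u \<in> test_vectors \<Longrightarrow> v \<in> test_vectors \<Longrightarrow> F \<in> C1_family x \<Longrightarrow> G \<in> C1_family y \<Longrightarrow>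
           locally_integrable_in_norm u F G v"
    and "f \<in> test_vectors" and "g \<in> test_vectors"
  shows "has_schwartz_derivative (\<lambda>t. bform f (x t) (y t) g)
    (\<lambda>t.
      (bform f (cderiv x t) (y t) g + bform f (x t) (cderiv y t) g
        + ito_correction Annihilation Creation x y t f g)
    + (bform (annihilate t f) (jump Creation x t) (y t) g
        + bform (annihilate t f) (x t) (jump Creation y t) g
        + ito_correction Number Creation x y t (annihilate t f) g)
    + (bform (annihilate t f) (jump Number x t) (y t) (annihilate t g)
        + bform (annihilate t f) (x t) (jump Number y t) (annihilate t g)
        + ito_correction Number Number x y t (annihilate t f) (annihilate t g))
    + (bform f (jump Annihilation x t) (y t) (annihilate t g)
        + bform f (x t) (jump Annihilation y t) (annihilate t g)
        + ito_correction Annihilation Number x y t f (annihilate t g)))"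
proof -
  obtain u :: "real list \<Rightarrow> 'k" where u: "u \<in> test_vectors" "\<And>ts. norm (f ts) \<le> norm (u ts)"
    "\<And>t ts. norm (f (t # ts)) \<le> norm (u ts)"
    by (rule test_vector_dominated[OF assms(5)]) blast
  obtain v :: "real list \<Rightarrow> 'k" where v: "v \<in> test_vectors" "\<And>ts. norm (g ts) \<le> norm (v ts)"
    "\<And>t ts. norm (g (t # ts)) \<le> norm (v ts)"
    by (rule test_vector_dominated[OF assms(6)]) blast
  interpret ito_pair x y u v
    by (rule ito_pair.intro) (use assms(1-4) u(1) v(1) in auto)
  note f = vector_path_const[OF assms(5) u(2)] vector_path_annihilate[OF assms(5) u(3)]
  note g = vector_path_const[OF assms(6) v(2)] vector_path_annihilate[OF assms(6) v(3)]
  have fam: "x \<in> C1_family x" "y \<in> C1_family y" unfolding C1_family_def by simp_all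
  note jumps = bform_jump(1)[OF f(2) g(1) fam(2)] bform_jump(2)[OF f(2) g(1) fam(1)]
    bform_jump(1)[OF f(2) g(2) fam(2)] bform_jump(2)[OF f(2) g(2) fam(1)]
    bform_jump(1)[OF f(1) g(2) fam(2)] bform_jump(2)[OF f(1) g(2) fam(1)]
  show ?thesis
    \<comment> \<open>A type meeting one kernel gives the jump of that kernel, a type meeting both
      gives the correction for its two slots, and for \<open>{Bpi, Brho}\<close> right and left
      values cancel. Membership of \<open>Bpi\<close> and \<open>Brho\<close> decides whether f and
      g are annihilated at t.\<close>
    using ito_schwartz[OF f g]
    unfolding sum_chain_types
    by (simp add: jumps ito_correction_def annihilate_if_def right_value_def left_value_def
        slot1_def slot2_def algebra_simps)
qed

end
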